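(* Let $h>0$, $N\ge2$, $a\in\mathcal{A}_N$, and $\phi:\mathbb{R}\to[0,\infty)$ with $M^<(2h)<\infty$ and $\lim_{l\to\infty}M^>(l)=+\infty$. Let $(M^>)^{-1}(l)=\inf\{r\ge0: M^>(r)\ge l\}$. Let $(U^N_t)$ be the $N$-actor system in the representation described in the context. For $0\le s<t$ let $E=E_s=\inf\{r>0:\mathbf{N}^a([s,t]\times[0,r])\ge1\}$ and let $t-Z\in[s,t]$ be the time coordinate of the atom of $\mathbf{N}^a$ at height $E$. Then there exists a Poisson process $(P_r(NM^<(2h)))_{r\ge0}$ of rate $NM^<(2h)$, independent of $\mathbf{N}^a$, such that: 1. $|U_t^N(a)|\le (M^>)^{-1}(E)+h+\frac{2h}{N}P_Z(NM^<(2h))$ in the usual stochastic order; 2. $\mathbb{E}|U_t^N(a)|\le \inf_{s\in(0,t]}\big(\mathbb{E}((M^>)^{-1}(E_s))+h+h(t-s)M^<(2h)\big)$.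
   Context: $\mathcal{A}_N=\{1,\dots,N\}$. $\Phi(r)=\phi(r)+\phi(-r)$, $M^<(l)=\sup\{\Phi(r):r\in[0,l]\}$, $M^>(l)=\inf\{\Phi(r): r>l\}$. Let $(\mathbf{N}^a: a\in\mathcal{A}_N)$ be an i.i.d. family of Poisson random measures on $\mathbb{R}^+\times\mathbb{R}^+$ with intensity $ds\,dz$, and let the system (with arbitrary real initial values $U_0^N(b)$) solve, for each $a$, $$U_t^{N}(a)=U_0^{N}(a)-\int_0^t \int_0^{\infty} U_{s-}^{N}(a)\mathbf{1}\{z \leq \Phi(U_{s-}^{N}(a))\}\mathbf{N}^{a}(ds,dz)+ \frac{h}{N}\sum_{b\neq a}\int_0^t \int_0^{\infty}\big(\mathbf{1}\{z \leq \phi(U_{s-}^{N}(b))\}-\mathbf{1}\{\phi(U_{s-}^{N}(b))<z \leq \Phi(U_{s-}^{N}(b))\}\big)\mathbf{N}^{b}(ds,dz).$$ For nonnegative random variables, $X\le Y$ in the usual stochastic order means $\mathbb{P}(X>r)\le\mathbb{P}(Y>r)$ for all $r\ge0$. *)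

theory Defs
  imports "HOL-Probability.Probability"
begin

definition Phi :: "(real \<Rightarrow> real) \<Rightarrow> real \<Rightarrow> real" where
  "Phi \<phi> r = \<phi> r + \<phi> (- r)"

text \<open>M^<(l) = sup of Phi on [0,l] (meaningful when bounded above).\<close>
definition Mlt :: "(real \<Rightarrow> real) \<Rightarrow> real \<Rightarrow> real" where
  "Mlt \<phi> l = Sup (Phi \<phi> ` {0..l})"

text \<open>M^>(l) = inf of Phi on (l,infinity) (Phi is nonnegative, so bounded below).\<close>
definition Mgt :: "(real \<Rightarrow> real) \<Rightarrow> real \<Rightarrow> real" where
  "Mgt \<phi> l = Inf (Phi \<phi> ` {l<..})"

text \<open>Generalised inverse (M^>)^{-1}(l) = inf{r >= 0 : M^>(r) >= l}, extended-real valued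
  (inf of the empty set is +infinity).\<close>
definition Mgt_inv :: "(real \<Rightarrow> real) \<Rightarrow> ereal \<Rightarrow> ereal" where
  "Mgt_inv \<phi> l = Inf {ereal r | r. r \<ge> 0 \<and> ereal (Mgt \<phi> r) \<ge> l}"

definition quadrant :: "(real \<times> real) set" where
  "quadrant = {0..} \<times> {0..}"

definition ecount :: "(real \<times> real) set \<Rightarrow> (real \<times> real) set \<Rightarrow> enat" where
  "ecount S B = (if finite (S \<inter> B) then enat (card (S \<inter> B)) else \<infinity>)"

definition poisson_law :: "'w measure \<Rightarrow> ('w \<Rightarrow> enat) \<Rightarrow> real \<Rightarrow> bool" where
  "poisson_law M X \<mu> \<longleftrightarrow> X \<in> measurable M (count_space UNIV) \<and>
     (\<forall>k::nat. measure M {\<omega> \<in> space M. X \<omega> = enat k} = exp (- \<mu>) * \<mu> ^ k / fact k)"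

text \<open>A family (N a, a in I) of i.i.d. Poisson random measures on R+ x R+ with intensity
  Lebesgue measure ds dz; N a \<omega> is the (simple) set of atoms.\<close>
definition prm_family :: "'w measure \<Rightarrow> nat set \<Rightarrow> (nat \<Rightarrow> 'w \<Rightarrow> (real \<times> real) set) \<Rightarrow> bool" where
  "prm_family M I Nm \<longleftrightarrow>
     (\<forall>a\<in>I. \<forall>\<omega>\<in>space M. Nm a \<omega> \<subseteq> quadrant) \<and>
     (\<forall>a\<in>I. \<forall>B \<in> sets (borel :: (real \<times> real) measure). B \<subseteq> quadrant \<longrightarrow>
        emeasure lborel B < \<infinity> \<longrightarrow> poisson_law M (\<lambda>\<omega>. ecount (Nm a \<omega>) B) (measure lborel B)) \<and>
     (\<forall>(J::nat set) (ab :: nat \<Rightarrow> nat \<times> (real \<times> real) set). finite J \<longrightarrow>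
        (\<forall>j\<in>J. fst (ab j) \<in> I \<and> snd (ab j) \<in> sets borel \<and> snd (ab j) \<subseteq> quadrant
                 \<and> emeasure lborel (snd (ab j)) < \<infinity>) \<longrightarrow>
        (\<forall>i\<in>J. \<forall>j\<in>J. i \<noteq> j \<longrightarrow> fst (ab i) = fst (ab j) \<longrightarrow> snd (ab i) \<inter> snd (ab j) = {}) \<longrightarrow>
        prob_space.indep_vars M (\<lambda>_. count_space UNIV) (\<lambda>j \<omega>. ecount (Nm (fst (ab j)) \<omega>) (snd (ab j))) J)"

definition left_lim :: "(real \<Rightarrow> real) \<Rightarrow> real \<Rightarrow> real" where
  "left_lim f s = Lim (at_left s) f"

definition cadlag_path :: "(real \<Rightarrow> real) \<Rightarrow> bool" where
  "cadlag_path f \<longleftrightarrow> (\<forall>s\<ge>0. continuous (at_right s) f) \<and>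
                      (\<forall>s>0. \<exists>l. (f \<longlongrightarrow> l) (at_left s))"

definition reset_atoms where
  "reset_atoms \<phi> S f t = {(s, z) \<in> S. 0 < s \<and> s \<le> t \<and> z \<le> Phi \<phi> (left_lim f s)}"

text \<open>Pathwise form of the stochastic equation: the integrals against the counting measures
  are sums over the (finitely many) relevant atoms.\<close>
definition system_eq ::
  "(real \<Rightarrow> real) \<Rightarrow> real \<Rightarrow> nat \<Rightarrow> (nat \<Rightarrow> real) \<Rightarrow> (nat \<Rightarrow> (real \<times> real) set)
     \<Rightarrow> (nat \<Rightarrow> real \<Rightarrow> real) \<Rightarrow> bool" where
  "system_eq \<phi> h N U0 S X \<longleftrightarrow>
     (\<forall>a\<in>{1..N}. cadlag_path (X a) \<and> X a 0 = U0 a) \<and>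
     (\<forall>a\<in>{1..N}. \<forall>t\<ge>0. finite (reset_atoms \<phi> (S a) (X a) t)) \<and>
     (\<forall>a\<in>{1..N}. \<forall>t\<ge>0.
        X a t = U0 a
          - (\<Sum>(s, z) \<in> reset_atoms \<phi> (S a) (X a) t. left_lim (X a) s)
          + h / real N * (\<Sum>b \<in> {1..N} - {a}.
               \<Sum>(s, z) \<in> reset_atoms \<phi> (S b) (X b) t.
                  (if z \<le> \<phi> (left_lim (X b) s) then 1 else 0)
                - (if \<phi> (left_lim (X b) s) < z \<and> z \<le> Phi \<phi> (left_lim (X b) s) then 1 else 0)))"

definition is_actor_system ::
  "'w measure \<Rightarrow> (real \<Rightarrow> real) \<Rightarrow> real \<Rightarrow> nat \<Rightarrow> (nat \<Rightarrow> real)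
     \<Rightarrow> (nat \<Rightarrow> 'w \<Rightarrow> (real \<times> real) set) \<Rightarrow> (nat \<Rightarrow> real \<Rightarrow> 'w \<Rightarrow> real) \<Rightarrow> bool" where
  "is_actor_system M \<phi> h N U0 Nm U \<longleftrightarrow>
     (\<forall>b\<in>{1..N}. \<forall>t\<ge>0. U b t \<in> borel_measurable M) \<and>
     (AE \<omega> in M. system_eq \<phi> h N U0 (\<lambda>b. Nm b \<omega>) (\<lambda>b t. U b t \<omega>))"

definition Eheight :: "(nat \<Rightarrow> 'w \<Rightarrow> (real \<times> real) set) \<Rightarrow> nat \<Rightarrow> real \<Rightarrow> real \<Rightarrow> 'w \<Rightarrow> ereal" where
  "Eheight Nm a s t \<omega> = Inf {ereal r | r. r > 0 \<and> ecount (Nm a \<omega>) ({s..t} \<times> {0..r}) \<ge> 1}"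

definition Zlag :: "(nat \<Rightarrow> 'w \<Rightarrow> (real \<times> real) set) \<Rightarrow> nat \<Rightarrow> real \<Rightarrow> real \<Rightarrow> 'w \<Rightarrow> real" where
  "Zlag Nm a s t \<omega> = t - (THE u. (u, real_of_ereal (Eheight Nm a s t \<omega>)) \<in> Nm a \<omega> \<and> s \<le> u \<and> u \<le> t)"

definition poisson_process :: "'w measure \<Rightarrow> real \<Rightarrow> (real \<Rightarrow> 'w \<Rightarrow> nat) \<Rightarrow> bool" where
  "poisson_process M rate P \<longleftrightarrow>
     (\<forall>r\<ge>0. P r \<in> measurable M (count_space UNIV)) \<and>
     (\<forall>\<omega>\<in>space M. P 0 \<omega> = 0 \<and> mono_on {0..} (\<lambda>r. P r \<omega>) \<and>
        (\<forall>r\<ge>0. \<exists>\<delta>>0. \<forall>r'\<in>{r..r+\<delta>}. P r' \<omega> = P r \<omega>)) \<and>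
     (\<forall>s t. 0 \<le> s \<longrightarrow> s \<le> t \<longrightarrow> (\<forall>k::nat.
        measure M {\<omega> \<in> space M. P t \<omega> - P s \<omega> = k} = exp (- (rate * (t - s))) * (rate * (t - s)) ^ k / fact k)) \<and>
     (\<forall>(n::nat) (ts :: nat \<Rightarrow> real). 0 \<le> ts 0 \<longrightarrow> (\<forall>i. ts i \<le> ts (Suc i)) \<longrightarrow>
        prob_space.indep_vars M (\<lambda>_. count_space UNIV) (\<lambda>i \<omega>. P (ts (Suc i)) \<omega> - P (ts i) \<omega>) {..<n})"

definition indep_of_prm :: "'w measure \<Rightarrow> (real \<Rightarrow> 'w \<Rightarrow> nat) \<Rightarrow> ('w \<Rightarrow> (real \<times> real) set) \<Rightarrow> bool" where
  "indep_of_prm M P Na \<longleftrightarrow>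
     prob_space.indep_set M
       (sigma_sets (space M) {P r -` A \<inter> space M | r A. r \<ge> 0})
       (sigma_sets (space M) {(\<lambda>\<omega>. ecount (Na \<omega>) B) -` A \<inter> space M | B A.
           B \<in> sets (borel :: (real \<times> real) measure) \<and> B \<subseteq> quadrant \<and> emeasure lborel B < \<infinity>})"

end

theory Submission
  imports Defs
begin

text \<open>
  At time \<open>t - Z\<close> actor \<open>a\<close> is either reset by its lowest atom, of height \<open>E\<close>, or has
  \<open>\<Phi>(U) < E\<close>; in both cases \<open>|U| \<le> (M\<^sup>>)\<^sup>-\<^sup>1(E)\<close> there. Starting from its last reset, \<open>a\<close> then
  moves by at most \<open>h/N\<close> per reset of another actor. Call a reset small if \<open>|U| \<le> 2h\<close> just
  before it. Between two resets of the same actor of which the second is not small, more than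
  \<open>2N\<close> resets occur, so among any \<open>2N\<close> consecutive ones at most \<open>N - 1\<close> are not small. Hence the
  number of resets is at most \<open>N\<close> plus twice the number of small ones, and small resets come
  from atoms below height \<open>M\<^sup><(2h)\<close> of the other actors, whose number, read backwards
  from \<open>t\<close>, is a Poisson process independent of the atoms of \<open>a\<close>. For the mean one uses that \<open>Z\<close>
  is uniform on \<open>[0, t - s]\<close>.
\<close>

section \<open>Counting resets along a path\<close>

text \<open>The rate \<open>Phi \<phi>\<close> is controlled only near zero: an actor far from zero
  can be reset by an atom of any height, so no Poisson process of fixed rate dominates all resets.
  The small resets do sit below the fixed height \<open>Mlt \<phi> (2 * h)\<close>, and the others
  are charged to them. The threshold \<open>2 * h\<close> comes from the size of the kicks: a reset
  puts the actor at 0, every other reset moves it by at most \<open>h / N\<close>, so getting beyond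
  \<open>2 * h\<close> takes more than \<open>2 * N\<close> of them, twice the number of actors.
  Then \<open>h / N\<close> times \<open>N + 2 * P\<close> gives the constants \<open>h\<close> and
  \<open>2 * h / N\<close>. The bound holds outcome by outcome on an almost sure event, so the
  stochastic order is an inclusion of events up to null sets. The remaining difficulty is the mean
  of the process at the random time \<open>Zlag\<close>: independence is known for counts of atoms
  in regions only, so the law of the lag enters through events that fix a time slot and a height
  layer of the lowest atom. The mean \<open>(t - s) / 2\<close> of the lag cancels the 2 of
  \<open>2 * h / N\<close>, and the \<open>N\<close> of the rate cancels its denominator.\<close>

lemma finite_initial_segment:
  fixes T :: "'a::linorder set"
  assumes "finite T" "m \<le> card T"
  shows "\<exists>A\<subseteq>T. card A = m \<and> (\<forall>x\<in>A. \<forall>y\<in>T - A. x < y)"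
  using assms(2)
proof (induction m)
  case 0
  then show ?case by (intro exI[of _ "{}"]) auto
next
  case (Suc m)
  then obtain A where A: "A \<subseteq> T" "card A = m" "\<forall>x\<in>A. \<forall>y\<in>T - A. x < y" by auto
  have fin: "finite (T - A)" using assms by auto
  have ne: "T - A \<noteq> {}" using A Suc.prems by auto
  define y where "y = Min (T - A)"
  have y: "y \<in> T - A" "\<And>x. x \<in> T - A \<Longrightarrow> y \<le> x"
    using Min_in[OF fin ne] Min_le[OF fin] by (auto simp: y_def)
  show ?case
  proof (intro exI[of _ "insert y A"] conjI ballI)
    show "insert y A \<subseteq> T" using A y by auto
    show "card (insert y A) = Suc m"
      using y A finite_subset[OF A(1) assms(1)] by auto
    fix x z assume "x \<in> insert y A" "z \<in> T - insert y A"
    then show "x < z" using A(3) y by (auto simp: less_le)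
  qed
qed

text \<open>Any \<open>m\<close> consecutive elements contain at most \<open>card C\<close> big ones, since two big
  elements with the same label are more than \<open>m\<close> places apart; so in each complete
  window the small ones are in the majority.\<close>
lemma card_le_if_big_separated:
  fixes T :: "'a::linorder set" and label :: "'a \<Rightarrow> 'c"
  assumes "finite T" "finite C" "label ` T \<subseteq> C" "2 * card C \<le> m"
    and sep: "\<And>x y. x \<in> T \<Longrightarrow> y \<in> T \<Longrightarrow> x < y \<Longrightarrow> label x = label y \<Longrightarrow> big y \<Longrightarrow>
                m < card {z\<in>T. x < z \<and> z < y}"
  shows "card T \<le> card C + 2 * card {x\<in>T. \<not> big x}"
  using assms(1,3) sep
proof (induction "card T" arbitrary: T rule: less_induct)
  case less
  \<comment> \<open>\<open>A\<close> is an initial segment with at most \<open>m\<close> elements,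
    so everything between two of its elements is in \<open>A\<close>; separation then forbids two
    big elements with one label.\<close>
  have big_bound: "card {x\<in>A. big x} \<le> card C" if A: "A \<subseteq> T" "card A \<le> m" "\<And>x y. x \<in> A \<Longrightarrow> y \<in> T - A \<Longrightarrow> x < y" for A
  proof (rule card_inj_on_le[of label])
    have finA: "finite A" using A less.prems finite_subset by blast
    have no: False if xy: "x \<in> A" "y \<in> A" "label x = label y" "big y" "x < y" for x y
    proof -
      have "{z\<in>T. x < z \<and> z < y} \<subseteq> A"
      proof
        fix z assume z: "z \<in> {z\<in>T. x < z \<and> z < y}"
        show "z \<in> A"
        proof (rule ccontr)
          assume "z \<notin> A"
          then have "y < z" using A(3)[of y z] xy z by auto
          with z show False by auto
        qed
      qed
      then have "card {z\<in>T. x < z \<and> z < y} \<le> m"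
        using card_mono[OF finA] A(2) by (meson order_trans)
      moreover have "m < card {z\<in>T. x < z \<and> z < y}"
        using less.prems(3)[of x y] xy A(1) by auto
      ultimately show False by simp
    qed
    show "inj_on label {x\<in>A. big x}"
    proof (rule inj_onI)
      fix x y assume "x \<in> {x\<in>A. big x}" "y \<in> {x\<in>A. big x}" "label x = label y"
      then show "x = y" using no[of x y] no[of y x] by (cases x y rule: linorder_cases) auto
    qed
    show "label ` {x \<in> A. big x} \<subseteq> C" using A(1) less.prems(2) by blast
    show "finite C" by fact
  qed
  have split: "card A = card {x\<in>A. big x} + card {x\<in>A. \<not> big x}" if "finite A" for A
    using that by (subst card_Un_disjoint[symmetric]) (auto intro: arg_cong[where f=card])
  \<comment> \<open>Cutting off \<open>m\<close> elements decreases \<open>T\<close> only for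
    \<open>m > 0\<close>; \<open>m = 0\<close> leaves no labels at all. The incomplete last window
    is where the additive \<open>card C\<close> is spent.\<close>
  show ?case
  proof (cases "card T \<le> m \<or> m = 0")
    case True
    then consider "card T \<le> m" | "m = 0" by blast
    then show ?thesis
    proof cases
      case 1
      then show ?thesis using big_bound[of T] split[OF less.prems(1)] by auto
    next
      case 2
      then have "card C = 0" using assms by auto
      then have "T = {}" using less.prems(2) assms(2) by auto
      then show ?thesis by simp
    qed
  next
    case False
    obtain A where A: "A \<subseteq> T" "card A = m" "\<forall>x\<in>A. \<forall>y\<in>T - A. x < y"
      using finite_initial_segment[OF less.prems(1), of m] False by auto
    have finA: "finite A" using A less.prems finite_subset by blast
    have cT: "card T = m + card (T - A)"
      using card_Diff_subset[OF finA A(1)] False A(2) by simp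
    have IH: "card (T - A) \<le> card C + 2 * card {x\<in>T - A. \<not> big x}"
    proof (rule less.hyps)
      show "card (T - A) < card T" using cT False by simp
      show "finite (T - A)" "label ` (T - A) \<subseteq> C" using less.prems by auto
      fix x y assume xy: "x \<in> T - A" "y \<in> T - A" "x < y" "label x = label y" "big y"
      \<comment> \<open>Nothing of \<open>A\<close> lies above \<open>x\<close>, so removing
        \<open>A\<close> keeps the separation hypothesis.\<close>
      have "z \<notin> A" if "x < z" for z using A(3) xy(1) that less_asym by blast
      then have "{z \<in> T - A. x < z \<and> z < y} = {z \<in> T. x < z \<and> z < y}" by blast
      then show "m < card {z \<in> T - A. x < z \<and> z < y}"
        using less.prems(3)[of x y] xy by auto
    qed
    have "card {x\<in>A. big x} \<le> card C" using big_bound[of A] A by auto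
    then have "m \<le> 2 * card {x\<in>A. \<not> big x}" using split[OF finA] A(2) assms(4) by linarith
    moreover have "card {x\<in>T. \<not> big x} = card {x\<in>A. \<not> big x} + card {x\<in>T - A. \<not> big x}"
      using less.prems(1) finA A(1)
      by (subst card_Un_disjoint[symmetric]) (auto intro!: arg_cong[where f=card])
    ultimately show ?thesis using IH cT by linarith
  qed
qed

text \<open>One fixed outcome: \<open>S b\<close> is the atom set of actor \<open>b\<close> and
  \<open>X b\<close> its path. \<open>simple\<close> forbids simultaneous atoms, also of different
  actors; it holds almost surely and is assumed here so that the counting is purely
  deterministic.\<close>

locale actor_path =
  fixes \<phi> :: "real \<Rightarrow> real" and h :: real and N :: nat and U0 :: "nat \<Rightarrow> real"
    and S :: "nat \<Rightarrow> (real \<times> real) set" and X :: "nat \<Rightarrow> real \<Rightarrow> real"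
  assumes h_pos: "h > 0"
    and sys: "system_eq \<phi> h N U0 S X"
    and simple: "\<And>b c u z w. b \<in> {1..N} \<Longrightarrow> c \<in> {1..N} \<Longrightarrow> (u, z) \<in> S b \<Longrightarrow> (u, w) \<in> S c \<Longrightarrow> b = c \<and> z = w"
begin

text \<open>\<open>simple\<close> leaves at most one atom of an actor per instant, so times can
  stand for the atoms; \<open>mark\<close> recovers the height.\<close>

definition resets :: "nat \<Rightarrow> real set" where
  "resets b = {u. 0 < u \<and> (\<exists>z. (u, z) \<in> S b \<and> z \<le> Phi \<phi> (left_lim (X b) u))}"

definition mark :: "nat \<Rightarrow> real \<Rightarrow> real" where
  "mark b u = (THE z. (u, z) \<in> S b)"

definition sgn_jump :: "nat \<Rightarrow> real \<Rightarrow> real" where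
  "sgn_jump b u = (if mark b u \<le> \<phi> (left_lim (X b) u) then 1 else 0)
     - (if \<phi> (left_lim (X b) u) < mark b u \<and> mark b u \<le> Phi \<phi> (left_lim (X b) u) then 1 else 0)"

lemma abs_sgn_jump_le: "\<bar>sgn_jump b u\<bar> \<le> 1"
  by (auto simp: sgn_jump_def)

lemma mark_eq: "b \<in> {1..N} \<Longrightarrow> (u, z) \<in> S b \<Longrightarrow> mark b u = z"
  unfolding mark_def using simple[of b b u] by (intro the_equality) auto

lemma reset_atoms_eq:
  assumes "b \<in> {1..N}"
  shows "reset_atoms \<phi> (S b) (X b) t = (\<lambda>u. (u, mark b u)) ` (resets b \<inter> {..t})"
  using mark_eq[OF assms] by (force simp: reset_atoms_def resets_def image_iff)

lemma inj_on_Pair_mark: "inj_on (\<lambda>u. (u, mark b u)) A"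
  by (auto simp: inj_on_def)

lemma finite_resets_atMost:
  assumes "b \<in> {1..N}" shows "finite (resets b \<inter> {..t})"
proof (cases "t \<ge> 0")
  case True
  then have "finite (reset_atoms \<phi> (S b) (X b) t)"
    using sys assms by (auto simp: system_eq_def)
  then show ?thesis
    unfolding reset_atoms_eq[OF assms] by (rule finite_imageD) (rule inj_on_Pair_mark)
next
  case False
  then have "resets b \<inter> {..t} = {}" by (auto simp: resets_def)
  then show ?thesis by simp
qed

lemma finite_resets_bounded: "b \<in> {1..N} \<Longrightarrow> A \<subseteq> {..t} \<Longrightarrow> finite (resets b \<inter> A)"
  by (rule finite_subset[OF _ finite_resets_atMost[of b t]]) auto

lemma finite_resets_Ioc: "b \<in> {1..N} \<Longrightarrow> finite (resets b \<inter> {u<..v})"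
  by (rule finite_resets_bounded[of _ _ v]) auto

lemma resets_disjoint: "b \<in> {1..N} \<Longrightarrow> c \<in> {1..N} \<Longrightarrow> u \<in> resets b \<Longrightarrow> u \<in> resets c \<Longrightarrow> b = c"
  unfolding resets_def using simple by blast

lemma X_eq_sum:
  assumes "b \<in> {1..N}" "0 \<le> t"
  shows "X b t = U0 b - (\<Sum>u\<in>resets b \<inter> {..t}. left_lim (X b) u)
     + h / N * (\<Sum>c\<in>{1..N} - {b}. \<Sum>u\<in>resets c \<inter> {..t}. sgn_jump c u)"
proof -
  have "X b t = U0 b
          - (\<Sum>(s, z) \<in> reset_atoms \<phi> (S b) (X b) t. left_lim (X b) s)
          + h / real N * (\<Sum>c \<in> {1..N} - {b}.
               \<Sum>(s, z) \<in> reset_atoms \<phi> (S c) (X c) t.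
                  (if z \<le> \<phi> (left_lim (X c) s) then 1 else 0)
                - (if \<phi> (left_lim (X c) s) < z \<and> z \<le> Phi \<phi> (left_lim (X c) s) then 1 else 0))"
    using sys assms unfolding system_eq_def by blast
  also have "(\<Sum>(s, z) \<in> reset_atoms \<phi> (S b) (X b) t. left_lim (X b) s) =
      (\<Sum>u\<in>resets b \<inter> {..t}. left_lim (X b) u)"
    unfolding reset_atoms_eq[OF assms(1)] by (simp add: sum.reindex[OF inj_on_Pair_mark])
  also have "(\<Sum>c \<in> {1..N} - {b}.
               \<Sum>(s, z) \<in> reset_atoms \<phi> (S c) (X c) t.
                  (if z \<le> \<phi> (left_lim (X c) s) then 1 else 0)
                - (if \<phi> (left_lim (X c) s) < z \<and> z \<le> Phi \<phi> (left_lim (X c) s) then 1 else 0))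
      = (\<Sum>c\<in>{1..N} - {b}. \<Sum>u\<in>resets c \<inter> {..t}. sgn_jump c u)"
  proof (intro sum.cong refl)
    fix c assume "c \<in> {1..N} - {b}"
    then have c: "c \<in> {1..N}" by simp
    show "(\<Sum>(s, z) \<in> reset_atoms \<phi> (S c) (X c) t.
                  (if z \<le> \<phi> (left_lim (X c) s) then 1 else 0)
                - (if \<phi> (left_lim (X c) s) < z \<and> z \<le> Phi \<phi> (left_lim (X c) s) then 1 else 0))
      = (\<Sum>u\<in>resets c \<inter> {..t}. sgn_jump c u)"
      unfolding reset_atoms_eq[OF c] by (simp add: sum.reindex[OF inj_on_Pair_mark] sgn_jump_def)
  qed
  finally show ?thesis by simp
qed

lemma X_increment:
  assumes "b \<in> {1..N}" "0 \<le> u" "u \<le> v"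
  shows "X b v = X b u - (\<Sum>w\<in>resets b \<inter> {u<..v}. left_lim (X b) w)
     + h / N * (\<Sum>c\<in>{1..N} - {b}. \<Sum>w\<in>resets c \<inter> {u<..v}. sgn_jump c w)"
proof -
  have split: "sum f (resets c \<inter> {..v}) = sum f (resets c \<inter> {..u}) + sum f (resets c \<inter> {u<..v})"
    if "c \<in> {1..N}" for c and f :: "real \<Rightarrow> real"
    using finite_resets_atMost[OF that] finite_resets_Ioc[OF that] assms
    by (subst sum.union_disjoint[symmetric]) (auto intro!: sum.cong)
  have "(\<Sum>c\<in>{1..N} - {b}. \<Sum>w\<in>resets c \<inter> {..v}. sgn_jump c w) =
     (\<Sum>c\<in>{1..N} - {b}. \<Sum>w\<in>resets c \<inter> {..u}. sgn_jump c w)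
     + (\<Sum>c\<in>{1..N} - {b}. \<Sum>w\<in>resets c \<inter> {u<..v}. sgn_jump c w)"
    by (subst sum.distrib[symmetric], intro sum.cong refl split) auto
  then show ?thesis
    using assms split[OF assms(1), of "left_lim (X b)"]
    by (simp add: X_eq_sum ring_distribs)
qed

definition other_resets :: "nat \<Rightarrow> real set \<Rightarrow> nat" where
  "other_resets b A = (\<Sum>c\<in>{1..N} - {b}. card (resets c \<inter> A))"

text \<open>Without a reset of \<open>b\<close> itself only the kicks caused by the others act, each
  of size at most \<open>h / N\<close>.\<close>

lemma X_between_resets:
  assumes "b \<in> {1..N}" "0 \<le> u" "u \<le> v" "resets b \<inter> {u<..v} = {}"
  shows "\<bar>X b v\<bar> \<le> \<bar>X b u\<bar> + h / N * other_resets b {u<..v}"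
proof -
  have "\<bar>\<Sum>c\<in>{1..N} - {b}. \<Sum>w\<in>resets c \<inter> {u<..v}. sgn_jump c w\<bar>
     \<le> (\<Sum>c\<in>{1..N} - {b}. \<Sum>w\<in>resets c \<inter> {u<..v}. 1)"
    by (intro order.trans[OF sum_abs] sum_mono abs_sgn_jump_le)
  then have "\<bar>\<Sum>c\<in>{1..N} - {b}. \<Sum>w\<in>resets c \<inter> {u<..v}. sgn_jump c w\<bar> \<le> other_resets b {u<..v}"
    by (simp add: other_resets_def)
  then have "\<bar>h / N * (\<Sum>c\<in>{1..N} - {b}. \<Sum>w\<in>resets c \<inter> {u<..v}. sgn_jump c w)\<bar>
     \<le> h / N * other_resets b {u<..v}"
    using h_pos by (simp add: abs_mult mult_left_mono divide_right_mono)
  then show ?thesis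
    unfolding X_increment[OF assms(1-3)] assms(4) sum.empty diff_zero by linarith
qed

text \<open>Resets are locally finite, so before \<open>v\<close> there is a last one (or time 0),
  and all paths are constant from there up to \<open>v\<close>. Left limits thus become values at
  earlier times.\<close>

lemma left_lim_eq:
  assumes "0 < v"
  obtains u where "0 \<le> u" "u < v" "\<And>c. c \<in> {1..N} \<Longrightarrow> resets c \<inter> {u<..<v} = {}"
    "\<And>b w. b \<in> {1..N} \<Longrightarrow> u \<le> w \<Longrightarrow> w < v \<Longrightarrow> left_lim (X b) v = X b w"
proof -
  define F where "F = insert 0 (\<Union>c\<in>{1..N}. resets c \<inter> {..<v})"
  have F: "finite F" "F \<noteq> {}" unfolding F_def
    by (auto simp del: UN_simps intro!: finite_resets_bounded[of _ _ v])
  define u where "u = Max F"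
  have u: "0 \<le> u" "u < v" "\<And>c. c \<in> {1..N} \<Longrightarrow> resets c \<inter> {u<..<v} = {}"
  proof -
    show "0 \<le> u" unfolding u_def by (rule Max_ge[OF F(1)]) (simp add: F_def)
    show "u < v" using Max_in[OF F] assms by (auto simp: u_def F_def)
    fix c assume c: "c \<in> {1..N}"
    show "resets c \<inter> {u<..<v} = {}"
    proof -
      have "w \<le> u" if "w \<in> resets c" "w < v" for w
        unfolding u_def by (rule Max_ge[OF F(1)]) (use that c in \<open>auto simp: F_def\<close>)
      then show ?thesis by force
    qed
  qed
  have const: "X b w = X b u" if "b \<in> {1..N}" "u \<le> w" "w < v" for b w
  proof -
    have "resets c \<inter> {u<..w} = {}" if "c \<in> {1..N}" for c
      using u(3)[OF that] \<open>w < v\<close> by auto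
    then show ?thesis using X_increment[of b u w] that u by simp
  qed
  have ll: "left_lim (X b) v = X b u" if "b \<in> {1..N}" for b
  proof -
    have "eventually (\<lambda>w. X b w = X b u) (at_left v)"
      by (rule eventually_at_leftI[OF _ u(2)], rule const[OF that]) auto
    then have "(X b \<longlongrightarrow> X b u) (at_left v)" by (rule tendsto_eventually)
    then show ?thesis unfolding left_lim_def by (intro tendsto_Lim) auto
  qed
  show thesis
  proof (rule that[OF u(1,2,3)])
    fix b w assume "b \<in> {1..N}" "u \<le> w" "w < v"
    then show "left_lim (X b) v = X b w" using ll[of b] const[of b w] by metis
  qed
qed

text \<open>Over a short interval ending at \<open>v\<close> the only reset is that of
  \<open>b\<close>, which subtracts the left limit, equal to the value before. A simultaneous kick
  from another actor is excluded by \<open>resets_disjoint\<close>.\<close>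

lemma X_reset:
  assumes "b \<in> {1..N}" "v \<in> resets b" shows "X b v = 0"
proof -
  have v: "0 < v" using assms by (simp add: resets_def)
  obtain u where u: "0 \<le> u" "u < v" "\<And>c. c \<in> {1..N} \<Longrightarrow> resets c \<inter> {u<..<v} = {}"
    "\<And>b w. b \<in> {1..N} \<Longrightarrow> u \<le> w \<Longrightarrow> w < v \<Longrightarrow> left_lim (X b) v = X b w"
    using left_lim_eq[OF v] by blast
  have iv: "{u<..v} = insert v {u<..<v}" using u by auto
  have "resets c \<inter> {u<..v} = {}" if "c \<in> {1..N} - {b}" for c
    unfolding iv using u(3)[of c] that resets_disjoint[of b c v] assms by auto
  moreover have "resets b \<inter> {u<..v} = {v}"
    unfolding iv using u(3)[of b] assms by auto
  ultimately show ?thesis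
    using X_increment[of b u v] u(1,2) u(4)[of b u] assms(1) by simp
qed

lemma X_no_reset:
  assumes "b \<in> {1..N}" "0 < v" "\<And>c. c \<in> {1..N} \<Longrightarrow> v \<notin> resets c"
  shows "X b v = left_lim (X b) v"
proof -
  obtain u where u: "0 \<le> u" "u < v" "\<And>c. c \<in> {1..N} \<Longrightarrow> resets c \<inter> {u<..<v} = {}"
    "\<And>b w. b \<in> {1..N} \<Longrightarrow> u \<le> w \<Longrightarrow> w < v \<Longrightarrow> left_lim (X b) v = X b w"
    using left_lim_eq[OF assms(2)] by blast
  have iv: "{u<..v} = insert v {u<..<v}" using u by auto
  have "resets c \<inter> {u<..v} = {}" if "c \<in> {1..N}" for c
    unfolding iv using u(3)[OF that] assms(3)[OF that] by auto
  then show ?thesis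
    using X_increment[of b u v] u(1,2) u(4)[of b u] assms(1) by simp
qed

lemma left_lim_between_resets:
  assumes "b \<in> {1..N}" "0 \<le> u" "u < v" "resets b \<inter> {u<..<v} = {}"
  shows "\<bar>left_lim (X b) v\<bar> \<le> \<bar>X b u\<bar> + h / N * other_resets b {u<..<v}"
proof -
  obtain u' where u': "0 \<le> u'" "u' < v" "\<And>c. c \<in> {1..N} \<Longrightarrow> resets c \<inter> {u'<..<v} = {}"
    "\<And>b w. b \<in> {1..N} \<Longrightarrow> u' \<le> w \<Longrightarrow> w < v \<Longrightarrow> left_lim (X b) v = X b w"
    using left_lim_eq[of v] assms by auto
  \<comment> \<open>Both after \<open>u\<close> and inside the last constancy interval before
    \<open>v\<close>: the left limit is the value at \<open>w < v\<close>, and a reset at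
    \<open>v\<close> itself is not counted.\<close>
  define w where "w = max u u'"
  have "\<bar>X b w\<bar> \<le> \<bar>X b u\<bar> + h / N * other_resets b {u<..w}"
  proof (rule X_between_resets)
    have "{u<..w} \<subseteq> {u<..<v}" using assms(3) u'(2) by (auto simp: w_def)
    then show "resets b \<inter> {u<..w} = {}" using assms(4) by blast
  qed (use assms in \<open>auto simp: w_def\<close>)
  also have "real (other_resets b {u<..w}) \<le> other_resets b {u<..<v}"
    unfolding other_resets_def of_nat_le_iff using assms u'
    by (intro sum_mono card_mono finite_resets_bounded[of _ _ v]) (auto simp: w_def)
  finally show ?thesis
    using u'(4)[OF assms(1), of w] assms(3) u'(2) h_pos
    by (simp add: w_def divide_right_mono mult_left_mono)
qed

text \<open>Between the previous reset of an actor, which puts it at 0, and a reset with left limit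
  beyond \<open>2 * h\<close> there are more than \<open>2 * N\<close> resets of others, none of
  them by \<open>a\<close>. This is the separation required by
  \<open>card_le_if_big_separated\<close>, with \<open>m = 2 * N\<close> and actors as
  labels.\<close>

lemma other_resets_le:
  assumes a: "a \<in> {1..N}" and "0 \<le> \<tau>" "\<tau> \<le> t" and no_a: "resets a \<inter> {\<tau><..t} = {}"
  shows "other_resets a {\<tau><..t} \<le>
    N + 2 * (\<Sum>c\<in>{1..N} - {a}. card {u \<in> resets c \<inter> {\<tau><..t}. \<bar>left_lim (X c) u\<bar> \<le> 2 * h})"
proof -
  define C where "C = {1..N} - {a}"
  define T where "T = (\<Union>c\<in>C. resets c \<inter> {\<tau><..t})"
  define label where "label u = (THE c. c \<in> C \<and> u \<in> resets c)" for u
  define big where "big u \<longleftrightarrow> 2 * h < \<bar>left_lim (X (label u)) u\<bar>" for u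
  have fin: "finite (resets c \<inter> {\<tau><..t})" if "c \<in> C" for c
    using that by (intro finite_resets_bounded[of _ _ t]) (auto simp: C_def)
  have finT: "finite T" unfolding T_def by (intro finite_UN_I fin) (simp_all add: C_def)
  have label_eq: "label u = c" if "c \<in> C" "u \<in> resets c" for c u
    unfolding label_def using that resets_disjoint by (auto simp: C_def)
  have N_pos: "0 < N" using a by auto
  have card_UN: "card (\<Union>c\<in>C. resets c \<inter> A) = (\<Sum>c\<in>C. card (resets c \<inter> A))" if "A \<subseteq> {\<tau><..t}" for A
  proof (rule card_UN_disjoint)
    show "finite C" by (simp add: C_def)
    show "\<forall>i\<in>C. finite (resets i \<inter> A)" using that by (auto intro!: finite_subset[OF Int_mono[OF order_refl that] fin])
    show "\<forall>i\<in>C. \<forall>j\<in>C. i \<noteq> j \<longrightarrow> resets i \<inter> A \<inter> (resets j \<inter> A) = {}"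
      using label_eq by blast
  qed
  have "card T \<le> card C + 2 * card {x\<in>T. \<not> big x}"
  proof (rule card_le_if_big_separated[where m="2 * N" and label=label])
    show "finite T" "finite C" by (simp_all add: finT C_def)
    show "label ` T \<subseteq> C"
    proof safe
      fix u assume "u \<in> T"
      then obtain c where "c \<in> C" "u \<in> resets c" by (auto simp: T_def)
      then show "label u \<in> C" using label_eq by simp
    qed
    have "card C \<le> card {1..N}" unfolding C_def by (intro card_mono) auto
    then show "2 * card C \<le> 2 * N" by simp
    fix x y assume xy: "x \<in> T" "y \<in> T" "x < y" "label x = label y" "big y"
    define b where "b = label y"
    have b: "b \<in> C" "x \<in> resets b" "y \<in> resets b" "\<tau> < x" "x \<le> t" "\<tau> < y" "y \<le> t"
    proof -
      obtain c d where cd: "c \<in> C" "x \<in> resets c" "d \<in> C" "y \<in> resets d"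
        and "\<tau> < x" "x \<le> t" "\<tau> < y" "y \<le> t" using xy(1,2) by (auto simp: T_def)
      moreover have "c = b" "d = b" using label_eq cd xy(4) by (auto simp: b_def)
      ultimately show "b \<in> C" "x \<in> resets b" "y \<in> resets b" "\<tau> < x" "x \<le> t" "\<tau> < y" "y \<le> t"
        by auto
    qed
    have bN: "b \<in> {1..N}" using b by (simp add: C_def)
    \<comment> \<open>\<open>x\<close> need not be the reset just before \<open>y\<close>; the last
      one, \<open>x'\<close>, is where the motion from 0 starts.\<close>
    define x' where "x' = Max (resets b \<inter> {x..<y})"
    have fx: "finite (resets b \<inter> {x..<y})" using bN by (intro finite_resets_bounded[of _ _ y]) auto
    have ne: "resets b \<inter> {x..<y} \<noteq> {}" using b xy by auto
    have x': "x' \<in> resets b" "x \<le> x'" "x' < y" using Max_in[OF fx ne] by (auto simp: x'_def)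
    have no: "resets b \<inter> {x'<..<y} = {}"
    proof -
      have "w \<le> x'" if "w \<in> resets b" "x \<le> w" "w < y" for w
        unfolding x'_def using that by (intro Max_ge[OF fx]) auto
      then show ?thesis using x' by force
    qed
    have "2 * h < \<bar>left_lim (X b) y\<bar>" using xy(5) by (simp add: big_def b_def)
    also have "\<dots> \<le> \<bar>X b x'\<bar> + h / N * other_resets b {x'<..<y}"
      using x' b no assms(2) by (intro left_lim_between_resets bN) auto
    also have "X b x' = 0" using X_reset[OF bN x'(1)] .
    finally have "2 * real N < other_resets b {x'<..<y}"
      using h_pos N_pos by (simp add: field_simps)
    then have "2 * N < other_resets b {x'<..<y}"
      by (metis of_nat_less_iff of_nat_mult of_nat_numeral)
    also have "other_resets b {x'<..<y} \<le> (\<Sum>c\<in>{1..N}. card (resets c \<inter> {x'<..<y}))"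
      unfolding other_resets_def by (intro sum_mono2) auto
    \<comment> \<open>By \<open>no_a\<close> the actor \<open>a\<close> contributes nothing, so the
      count runs over \<open>C\<close> as in \<open>T\<close>.\<close>
    also have "\<dots> = (\<Sum>c\<in>C. card (resets c \<inter> {x'<..<y}))"
    proof (rule sum.mono_neutral_right)
      have "resets a \<inter> {x'<..<y} = {}" using no_a x' b by fastforce
      then show "\<forall>i\<in>{1..N} - C. card (resets i \<inter> {x'<..<y}) = 0" by (auto simp: C_def)
    qed (auto simp: C_def)
    also have "\<dots> = card (\<Union>c\<in>C. resets c \<inter> {x'<..<y})"
      using x' b by (intro card_UN[symmetric]) auto
    also have "\<dots> \<le> card {z\<in>T. x < z \<and> z < y}"
      using x' b by (intro card_mono finite_subset[OF _ finT]) (auto simp: T_def)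
    finally show "2 * N < card {z\<in>T. x < z \<and> z < y}" .
  qed
  moreover have "card C \<le> N" using a by (auto simp: C_def)
  moreover have "card {x\<in>T. \<not> big x} =
      (\<Sum>c\<in>C. card {u \<in> resets c \<inter> {\<tau><..t}. \<bar>left_lim (X c) u\<bar> \<le> 2 * h})"
  proof -
    have eq: "{x\<in>T. \<not> big x} = (\<Union>c\<in>C. {u \<in> resets c \<inter> {\<tau><..t}. \<bar>left_lim (X c) u\<bar> \<le> 2 * h})"
    proof -
      have "big u \<longleftrightarrow> 2 * h < \<bar>left_lim (X c) u\<bar>" if "c \<in> C" "u \<in> resets c" for c u
        using label_eq[OF that] by (simp add: big_def)
      then show ?thesis unfolding T_def by (auto simp del: UN_simps simp: not_less)
    qed
    show ?thesis unfolding eq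
    proof (rule card_UN_disjoint)
      show "finite C" by (simp add: C_def)
      show "\<forall>i\<in>C. finite {u \<in> resets i \<inter> {\<tau><..t}. \<bar>left_lim (X i) u\<bar> \<le> 2 * h}"
        by (intro ballI finite_Collect_conjI disjI1) (simp only: Collect_mem_eq fin)
      show "\<forall>i\<in>C. \<forall>j\<in>C. i \<noteq> j \<longrightarrow>
        {u \<in> resets i \<inter> {\<tau><..t}. \<bar>left_lim (X i) u\<bar> \<le> 2 * h} \<inter>
        {u \<in> resets j \<inter> {\<tau><..t}. \<bar>left_lim (X j) u\<bar> \<le> 2 * h} = {}"
        using label_eq by blast
    qed
  qed
  moreover have "other_resets a {\<tau><..t} = card T"
    unfolding other_resets_def T_def using card_UN[of "{\<tau><..t}"] by (simp add: C_def)
  ultimately show ?thesis by (simp add: C_def)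
qed

end

section \<open>The total rate, its generalised inverse, and the pathwise bound\<close>

lemma Phi_minus: "Phi \<phi> (- r) = Phi \<phi> r"
  by (simp add: Phi_def)

lemma Phi_abs: "Phi \<phi> \<bar>r\<bar> = Phi \<phi> r"
  by (cases "r \<ge> 0") (auto simp: Phi_minus)

lemma Phi_le_Mlt:
  assumes "bdd_above (Phi \<phi> ` {0..l})" "\<bar>x\<bar> \<le> l"
  shows "Phi \<phi> x \<le> Mlt \<phi> l"
  unfolding Mlt_def using assms
  by (subst Phi_abs[symmetric]) (intro cSUP_upper, auto)

lemma Mlt_nonneg:
  assumes "\<And>r. \<phi> r \<ge> 0" "bdd_above (Phi \<phi> ` {0..l})" "0 \<le> l"
  shows "0 \<le> Mlt \<phi> l"
  using Phi_le_Mlt[OF assms(2), of 0] assms(1)[of 0] assms(3) by (simp add: Phi_def)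

lemma bdd_below_Phi:
  assumes "\<And>r. \<phi> r \<ge> 0" shows "bdd_below (Phi \<phi> ` A)"
  by (rule bdd_belowI[of _ 0]) (auto simp: Phi_def assms)

lemma Mgt_le_Phi:
  assumes "\<And>r. \<phi> r \<ge> 0" "l < \<bar>x\<bar>"
  shows "Mgt \<phi> l \<le> Phi \<phi> x"
  unfolding Mgt_def using assms
  by (subst Phi_abs[symmetric]) (intro cINF_lower bdd_below_Phi, auto)

lemma mono_Mgt:
  assumes "\<And>r. \<phi> r \<ge> 0" shows "mono (Mgt \<phi>)"
  unfolding Mgt_def
  by (intro monoI cINF_superset_mono bdd_below_Phi assms) auto

lemma Mgt_inv_nonneg: "0 \<le> Mgt_inv \<phi> l"
  unfolding Mgt_inv_def by (intro Inf_greatest) auto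

text \<open>If \<open>r\<close> lay below \<open>\<bar>x\<bar>\<close>, then
  \<open>Mgt \<phi> r \<le> Phi \<phi> x < l\<close>, so \<open>r\<close> does not compete in the
  infimum.\<close>

lemma abs_le_Mgt_inv:
  assumes "\<And>r. \<phi> r \<ge> 0" "ereal (Phi \<phi> x) < l"
  shows "ereal \<bar>x\<bar> \<le> Mgt_inv \<phi> l"
  unfolding Mgt_inv_def
proof (rule Inf_greatest)
  fix y assume "y \<in> {ereal r |r. 0 \<le> r \<and> l \<le> ereal (Mgt \<phi> r)}"
  then obtain r where r: "y = ereal r" "l \<le> ereal (Mgt \<phi> r)" by auto
  show "ereal \<bar>x\<bar> \<le> y"
  proof (rule ccontr)
    assume "\<not> ?thesis"
    then have "r < \<bar>x\<bar>" by (simp add: r)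
    then have "Mgt \<phi> r \<le> Phi \<phi> x" by (intro Mgt_le_Phi assms) auto
    then have "ereal (Mgt \<phi> r) \<le> ereal (Phi \<phi> x)" by simp
    with r(2) have "l \<le> ereal (Phi \<phi> x)" by (rule order_trans)
    with assms(2) show False by simp
  qed
qed

text \<open>A deterministic estimate for an arbitrary atom \<open>(\<tau>0, e)\<close> of
  \<open>a\<close>. Later resets of \<open>a\<close> only help: at each of them \<open>X a\<close>
  returns to 0, so the last one can replace \<open>\<tau>0\<close> as the starting time.\<close>

lemma (in actor_path) abs_X_le:
  assumes a: "a \<in> {1..N}" and \<phi>: "\<And>r. \<phi> r \<ge> 0" and bdd: "bdd_above (Phi \<phi> ` {0..2 * h})"
    and atom: "(\<tau>0, e) \<in> S a" "0 < \<tau>0" "\<tau>0 \<le> t"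
    and fin: "\<And>c. c \<in> {1..N} \<Longrightarrow> finite (S c \<inter> {\<tau>0<..t} \<times> {..Mlt \<phi> (2 * h)})"
  shows "ereal \<bar>X a t\<bar> \<le> Mgt_inv \<phi> (ereal e) + ereal h +
     ereal (2 * h / N * (\<Sum>c\<in>{1..N} - {a}. card (S c \<inter> {\<tau>0<..t} \<times> {..Mlt \<phi> (2 * h)})))"
proof -
  define n where "n = (\<Sum>c\<in>{1..N} - {a}. card (S c \<inter> {\<tau>0<..t} \<times> {..Mlt \<phi> (2 * h)}))"
  define F where "F = insert \<tau>0 (resets a \<inter> {\<tau>0<..t})"
  have F: "finite F" "F \<noteq> {}" using finite_resets_Ioc[OF a] by (auto simp: F_def)
  define \<tau> where "\<tau> = Max F"
  have \<tau>: "\<tau>0 \<le> \<tau>" "\<tau> \<le> t" "resets a \<inter> {\<tau><..t} = {}"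
  proof -
    show *: "\<tau>0 \<le> \<tau>" unfolding \<tau>_def by (rule Max_ge[OF F(1)]) (simp add: F_def)
    show "\<tau> \<le> t" using Max_in[OF F] atom by (auto simp: \<tau>_def F_def)
    have "w \<le> \<tau>" if "w \<in> resets a" "\<tau>0 < w" "w \<le> t" for w
      unfolding \<tau>_def by (rule Max_ge[OF F(1)]) (use that in \<open>auto simp: F_def\<close>)
    then show "resets a \<inter> {\<tau><..t} = {}" using * by force
  qed
  have X0: "ereal \<bar>X a \<tau>0\<bar> \<le> Mgt_inv \<phi> (ereal e)"
  proof (cases "e \<le> Phi \<phi> (left_lim (X a) \<tau>0)")
    case True
    then have "\<tau>0 \<in> resets a" using atom by (auto simp: resets_def)
    then show ?thesis using X_reset[OF a] Mgt_inv_nonneg by (simp flip: zero_ereal_def)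
  next
    case False
    \<comment> \<open>The atom of \<open>a\<close> at \<open>\<tau>0\<close> is too high to reset
      \<open>a\<close>, and by \<open>simple\<close> no other actor has an atom at that
      time.\<close>
    have "\<tau>0 \<notin> resets c" if "c \<in> {1..N}" for c
    proof
      assume "\<tau>0 \<in> resets c"
      then obtain z where z: "(\<tau>0, z) \<in> S c" "z \<le> Phi \<phi> (left_lim (X c) \<tau>0)" by (auto simp: resets_def)
      have "a = c \<and> e = z" by (rule simple[OF a that atom(1) z(1)])
      with z False show False by simp
    qed
    then have "X a \<tau>0 = left_lim (X a) \<tau>0" using X_no_reset[OF a] atom by blast
    then show ?thesis using abs_le_Mgt_inv[of \<phi> "left_lim (X a) \<tau>0" "ereal e"] \<phi> False by simp
  qed
  have X\<tau>: "ereal \<bar>X a \<tau>\<bar> \<le> Mgt_inv \<phi> (ereal e)"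
    using Max_in[OF F] X0 X_reset[OF a] Mgt_inv_nonneg
    unfolding \<tau>_def[symmetric] by (auto simp: F_def simp flip: zero_ereal_def)
  \<comment> \<open>A small reset comes from an atom of height at most \<open>Phi\<close> of a value
    of modulus at most \<open>2 * h\<close>, hence at most \<open>Mlt \<phi> (2 * h)\<close>.
    Attaching its mark maps the resets injectively to such atoms.\<close>
  have "(\<Sum>c\<in>{1..N} - {a}. card {u \<in> resets c \<inter> {\<tau><..t}. \<bar>left_lim (X c) u\<bar> \<le> 2 * h})
     \<le> (\<Sum>c\<in>{1..N} - {a}. card (S c \<inter> {\<tau>0<..t} \<times> {..Mlt \<phi> (2 * h)}))"
  proof (rule sum_mono)
    fix c assume c: "c \<in> {1..N} - {a}"
    show "card {u \<in> resets c \<inter> {\<tau><..t}. \<bar>left_lim (X c) u\<bar> \<le> 2 * h}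
        \<le> card (S c \<inter> {\<tau>0<..t} \<times> {..Mlt \<phi> (2 * h)})"
    proof (rule card_inj_on_le[OF inj_on_Pair_mark[of c]])
      show "(\<lambda>u. (u, mark c u)) ` {u \<in> resets c \<inter> {\<tau><..t}. \<bar>left_lim (X c) u\<bar> \<le> 2 * h}
        \<subseteq> S c \<inter> {\<tau>0<..t} \<times> {..Mlt \<phi> (2 * h)}"
      proof (rule image_subsetI)
        fix u assume "u \<in> {u \<in> resets c \<inter> {\<tau><..t}. \<bar>left_lim (X c) u\<bar> \<le> 2 * h}"
        then have u: "u \<in> resets c" "u \<in> {\<tau><..t}" "\<bar>left_lim (X c) u\<bar> \<le> 2 * h" by auto
        then obtain z where z: "(u, z) \<in> S c" "z \<le> Phi \<phi> (left_lim (X c) u)"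
          by (auto simp: resets_def)
        have m: "mark c u = z" using mark_eq z(1) c by auto
        then show "(u, mark c u) \<in> S c \<inter> {\<tau>0<..t} \<times> {..Mlt \<phi> (2 * h)}"
          using z u \<tau>(1) Phi_le_Mlt[OF bdd u(3)] by auto
      qed
    qed (use fin c in auto)
  qed
  then have "other_resets a {\<tau><..t}
      \<le> N + 2 * (\<Sum>c\<in>{1..N} - {a}. card (S c \<inter> {\<tau>0<..t} \<times> {..Mlt \<phi> (2 * h)}))"
    using other_resets_le[OF a _ \<tau>(2,3)] \<tau>(1) atom(2) by linarith
  then have "other_resets a {\<tau><..t} \<le> N + 2 * n" by (simp add: n_def)
  then have "real (other_resets a {\<tau><..t}) \<le> real N + 2 * real n" by linarith
  then have "h / N * other_resets a {\<tau><..t} \<le> h / N * (real N + 2 * real n)"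
    using h_pos by (intro mult_left_mono) auto
  also have "\<dots> = h + 2 * h / N * n" using a by (simp add: field_simps)
  finally have "\<bar>X a t\<bar> \<le> \<bar>X a \<tau>\<bar> + (h + 2 * h / N * n)"
    using X_between_resets[OF a _ \<tau>(2,3)] \<tau>(1) atom(2) by linarith
  then have "ereal \<bar>X a t\<bar> \<le> ereal \<bar>X a \<tau>\<bar> + (ereal h + ereal (2 * h / N * n))"
    by simp
  also have "\<dots> \<le> Mgt_inv \<phi> (ereal e) + (ereal h + ereal (2 * h / N * n))"
    by (intro add_right_mono X\<tau>)
  finally show ?thesis by (simp add: add.assoc n_def)
qed

section \<open>Families of Poisson random measures\<close>

text \<open>The value at \<open>\<infinity>\<close> is 0 to agree with \<open>card\<close> of an
  infinite set, so \<open>card (S \<inter> B)\<close> is always a function of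
  \<open>ecount S B\<close>.\<close>

definition fin_enat :: "enat \<Rightarrow> nat" where
  "fin_enat e = (case e of enat n \<Rightarrow> n | \<infinity> \<Rightarrow> 0)"

lemma fin_enat_ecount: "fin_enat (ecount S B) = card (S \<inter> B)"
  by (auto simp: fin_enat_def ecount_def)

lemma ecount_eq_enat_iff: "ecount S B = enat k \<longleftrightarrow> finite (S \<inter> B) \<and> card (S \<inter> B) = k"
  by (auto simp: ecount_def)

lemma one_le_ecount_iff: "1 \<le> ecount S B \<longleftrightarrow> S \<inter> B \<noteq> {}"
  by (auto simp: ecount_def one_enat_def Suc_le_eq card_gt_0_iff)

lemma ecount_eq_0_iff: "ecount S B = 0 \<longleftrightarrow> S \<inter> B = {}"
  by (auto simp: ecount_def zero_enat_def)

lemma two_le_ecount: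
  assumes "x \<in> S" "y \<in> S" "x \<in> B" "y \<in> B" "x \<noteq> y"
  shows "2 \<le> ecount S B"
proof (cases "finite (S \<inter> B)")
  case True
  have "card {x, y} \<le> card (S \<inter> B)" using assms True by (intro card_mono) auto
  then show ?thesis using assms True by (simp add: ecount_def numeral_eq_enat)
qed (simp add: ecount_def)

lemma ecount_UN_disjoint:
  assumes "finite I" "disjoint_family_on B I"
  shows "ecount S (\<Union>i\<in>I. B i) = (\<Sum>i\<in>I. ecount S (B i))"
  using assms
proof (induction I rule: finite_induct)
  case empty
  then show ?case by (simp add: ecount_def zero_enat_def)
next
  case (insert x F)
  have 1: "B x \<inter> (\<Union>i\<in>F. B i) = {}"
    using insert.hyps insert.prems by (fastforce simp: disjoint_family_on_def)
  have 2: "disjoint_family_on B F"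
    using insert.prems by (rule disjoint_family_on_mono[rotated]) auto
  have "ecount S (B x \<union> C) = ecount S (B x) + ecount S C" if "B x \<inter> C = {}" for C
    using that by (auto simp: ecount_def Int_Un_distrib intro!: card_Un_disjoint)
  from this[OF 1] show ?case using insert.IH[OF 2] insert.hyps by simp
qed

text \<open>The regions for which \<open>prm_family\<close> prescribes laws and
  independence.\<close>

definition test_set :: "(real \<times> real) set \<Rightarrow> bool" where
  "test_set B \<longleftrightarrow> B \<in> sets borel \<and> B \<subseteq> quadrant \<and> emeasure lborel B < \<infinity>"

lemma test_set_subset:
  assumes "test_set B" "A \<subseteq> B" "A \<in> sets borel" shows "test_set A"
  unfolding test_set_def
proof (intro conjI)
  show "emeasure lborel A < \<infinity>"
    using emeasure_mono[OF assms(2), of lborel] assms by (auto simp: test_set_def intro: le_less_trans)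
qed (use assms in \<open>auto simp: test_set_def\<close>)

lemma emeasure_lborel_Times:
  fixes A B :: "real set"
  assumes "A \<in> sets borel" "B \<in> sets borel"
  shows "emeasure lborel (A \<times> B) = emeasure lborel A * emeasure lborel B"
  using assms by (subst lborel_prod[symmetric]) (simp add: lborel.emeasure_pair_measure_Times)

lemma test_set_Times:
  assumes "A \<in> sets borel" "A \<subseteq> {0..}" "emeasure lborel A < \<infinity>"
    "B \<in> sets borel" "B \<subseteq> {0..}" "emeasure lborel B < \<infinity>"
  shows "test_set (A \<times> B)"
  unfolding test_set_def quadrant_def using assms
  by (auto simp: emeasure_lborel_Times ennreal_mult_less_top borel_Times)

lemma measure_lborel_Times:
  fixes A B :: "real set"
  assumes "A \<in> sets borel" "B \<in> sets borel"
  shows "measure lborel (A \<times> B) = measure lborel A * measure lborel B"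
  using assms by (simp add: measure_def emeasure_lborel_Times enn2real_mult)

lemma test_set_box: "0 \<le> l \<Longrightarrow> 0 \<le> l' \<Longrightarrow> test_set ({l..u} \<times> {l'..u'})"
  by (intro test_set_Times) (auto simp: emeasure_lborel_Icc_eq)

lemma measurable_sum_countable:
  fixes f :: "'i \<Rightarrow> 'a \<Rightarrow> 'b :: {countable, comm_monoid_add}"
  assumes "\<And>i. i \<in> I \<Longrightarrow> f i \<in> measurable M (count_space UNIV)"
  shows "(\<lambda>x. \<Sum>i\<in>I. f i x) \<in> measurable M (count_space UNIV)"
proof (cases "finite I")
  case True
  then show ?thesis using assms
  proof (induction I rule: finite_induct)
    case (insert i I)
    have "(\<lambda>x. f i x + (\<Sum>i\<in>I. f i x)) \<in> measurable M (count_space UNIV)"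
      by (rule measurable_compose_countable[where f="\<lambda>n x. n + (\<Sum>i\<in>I. f i x)" and g="f i"])
         (use insert in \<open>auto intro: measurable_compose\<close>)
    then show ?case using insert by simp
  qed auto
qed simp

section \<open>Transport of independence and sums of independent Poisson variables\<close>

context prob_space
begin

lemma indep_vars_reindex:
  assumes "indep_vars M' X (f ` J)" "inj_on f J"
  shows "indep_vars (\<lambda>j. M' (f j)) (\<lambda>j. X (f j)) J"
proof -
  have "indep_vars (\<lambda>j. PiM {f j} M') (\<lambda>j \<omega>. restrict (\<lambda>i. X i \<omega>) {f j}) J"
    using assms by (intro indep_vars_restrict[OF assms(1)]) (auto simp: disjoint_family_on_def inj_on_def)
  then have "indep_vars (\<lambda>j. M' (f j)) (\<lambda>j \<omega>. (\<lambda>x. x (f j)) (restrict (\<lambda>i. X i \<omega>) {f j})) J"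
    by (rule indep_vars_compose2) (rule measurable_component_singleton, simp)
  then show ?thesis by simp
qed

text \<open>The processes built later agree with plain atom counts only off a null set; this carries
  independence across.\<close>

lemma indep_vars_cong_AE:
  assumes "indep_vars M' X I" and "\<And>i. i \<in> I \<Longrightarrow> Y i \<in> measurable M (M' i)"
    and "AE \<omega> in M. \<forall>i\<in>I. X i \<omega> = Y i \<omega>"
  shows "indep_vars M' Y I"
  unfolding indep_vars_def2 indep_sets_def
proof (intro conjI allI impI ballI subsetI)
  fix i assume "i \<in> I" then show "random_variable (M' i) (Y i)" by (rule assms)
next
  fix i E assume "i \<in> I" "E \<in> {Y i -` A \<inter> space M |A. A \<in> sets (M' i)}"
  then show "E \<in> events" using assms(2) by (auto intro: measurable_sets)
next
  fix J A assume J: "J \<subseteq> I" "J \<noteq> {}" "finite J" "A \<in> (\<Pi> i\<in>J. {Y i -` A \<inter> space M |A. A \<in> sets (M' i)})"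
  have "\<forall>j\<in>J. \<exists>B. B \<in> sets (M' j) \<and> A j = Y j -` B \<inter> space M" using J(4) by (auto simp: Pi_iff)
  then obtain B where B: "\<And>j. j \<in> J \<Longrightarrow> B j \<in> sets (M' j)" "\<And>j. j \<in> J \<Longrightarrow> A j = Y j -` B j \<inter> space M"
    by metis
  have mX: "X j -` B j \<inter> space M \<in> events" if "j \<in> J" for j
    by (rule measurable_sets[OF _ B(1)[OF that]]) (use assms(1) J that in \<open>auto simp: indep_vars_def2\<close>)
  have mY: "Y j -` B j \<inter> space M \<in> events" if "j \<in> J" for j
    by (rule measurable_sets[OF assms(2) B(1)[OF that]]) (use J that in auto)
  have "prob (\<Inter>j\<in>J. A j) = prob (\<Inter>j\<in>J. Y j -` B j \<inter> space M)"
    using B by (auto intro!: arg_cong[where f=prob])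
  also have "\<dots> = prob (\<Inter>j\<in>J. X j -` B j \<inter> space M)"
  proof (rule measure_eq_AE)
    show "AE \<omega> in M. (\<omega> \<in> (\<Inter>j\<in>J. Y j -` B j \<inter> space M)) = (\<omega> \<in> (\<Inter>j\<in>J. X j -` B j \<inter> space M))"
      using assms(3) by (rule AE_mp) (use J(1) in \<open>auto simp: subset_eq\<close>)
    show "(\<Inter>j\<in>J. Y j -` B j \<inter> space M) \<in> events" "(\<Inter>j\<in>J. X j -` B j \<inter> space M) \<in> events"
      using J(2,3) mX mY by (intro sets.finite_INT; blast)+
  qed
  also have "\<dots> = (\<Prod>j\<in>J. prob (X j -` B j \<inter> space M))"
    using assms(1) J B by (intro indep_varsD[of M' X I]) auto
  also have "\<dots> = (\<Prod>j\<in>J. prob (A j))"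
  proof (rule prod.cong[OF refl])
    fix j assume j: "j \<in> J"
    with J(1) have jI: "j \<in> I" by blast
    have "AE \<omega> in M. (\<omega> \<in> X j -` B j \<inter> space M) = (\<omega> \<in> Y j -` B j \<inter> space M)"
      using assms(3) by (rule AE_mp) (rule AE_I2, use jI in simp)
    then have "prob (X j -` B j \<inter> space M) = prob (Y j -` B j \<inter> space M)"
      by (rule measure_eq_AE[OF _ mX[OF j] mY[OF j]])
    then show "prob (X j -` B j \<inter> space M) = prob (A j)"
      by (simp only: B(2)[OF j])
  qed
  finally show "prob (\<Inter>j\<in>J. A j) = (\<Prod>j\<in>J. prob (A j))" .
qed

text \<open>Poisson laws convolve: splitting off one summand according to its value reduces the
  induction step to the binomial theorem.\<close>

lemma prob_sum_poisson:
  fixes X :: "'i \<Rightarrow> 'a \<Rightarrow> nat"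
  assumes "finite I" "indep_vars (\<lambda>_. count_space UNIV) X I"
    and "\<And>i k. i \<in> I \<Longrightarrow> prob {\<omega>\<in>space M. X i \<omega> = k} = exp (- \<mu> i) * \<mu> i ^ k / fact k"
  shows "prob {\<omega>\<in>space M. (\<Sum>i\<in>I. X i \<omega>) = k} = exp (- sum \<mu> I) * sum \<mu> I ^ k / fact k"
  using assms
proof (induction I arbitrary: k rule: finite_induct)
  case empty
  then show ?case by (cases k) (auto simp: prob_space)
next
  case (insert x F)
  let ?S = "\<lambda>\<omega>. \<Sum>i\<in>F. X i \<omega>"
  have rv: "X i \<in> measurable M (count_space UNIV)" if "i \<in> insert x F" for i
    using insert.prems that by (auto simp: indep_vars_def)
  have rvS: "?S \<in> measurable M (count_space UNIV)"
    using rv by (intro measurable_sum_countable) auto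
  have "indep_var (PiM {x} (\<lambda>_. count_space UNIV)) (\<lambda>\<omega>. restrict (\<lambda>i. X i \<omega>) {x})
           (PiM F (\<lambda>_. count_space UNIV)) (\<lambda>\<omega>. restrict (\<lambda>i. X i \<omega>) F)"
    using insert by (intro indep_var_restrict[OF insert.prems(1)]) auto
  then have "indep_var (count_space UNIV) ((\<lambda>f. f x) \<circ> (\<lambda>\<omega>. restrict (\<lambda>i. X i \<omega>) {x}))
      (count_space UNIV) ((\<lambda>f. \<Sum>i\<in>F. f i) \<circ> (\<lambda>\<omega>. restrict (\<lambda>i. X i \<omega>) F))"
    by (rule indep_var_compose)
       (auto intro!: measurable_sum_countable measurable_component_singleton)
  then have ind: "indep_var (count_space UNIV) (X x) (count_space UNIV) ?S"
    by (simp add: comp_def cong: sum.cong)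
  have IH: "prob {\<omega>\<in>space M. ?S \<omega> = k} = exp (- sum \<mu> F) * sum \<mu> F ^ k / fact k" for k
    using insert.prems indep_vars_subset[OF insert.prems(1)] by (intro insert.IH) auto
  have "prob {\<omega>\<in>space M. X x \<omega> + ?S \<omega> = k} =
      prob (\<Union>j\<in>{..k}. {\<omega>\<in>space M. X x \<omega> = j \<and> ?S \<omega> = k - j})"
    by (intro arg_cong[where f=prob]) auto
  also have "\<dots> = (\<Sum>j\<le>k. prob {\<omega>\<in>space M. X x \<omega> = j \<and> ?S \<omega> = k - j})"
  proof (rule finite_measure_finite_Union)
    show "(\<lambda>j. {\<omega> \<in> space M. X x \<omega> = j \<and> ?S \<omega> = k - j}) ` {..k} \<subseteq> events"
    proof safe
      fix j
      have "{\<omega> \<in> space M. X x \<omega> = j \<and> ?S \<omega> = k - j} =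
          (X x -` {j} \<inter> space M) \<inter> (?S -` {k - j} \<inter> space M)" by auto
      also have "\<dots> \<in> events"
        by (intro sets.Int measurable_sets[OF rv] measurable_sets[OF rvS]) auto
      finally show "{\<omega> \<in> space M. X x \<omega> = j \<and> ?S \<omega> = k - j} \<in> events" .
    qed
  qed (auto simp: disjoint_family_on_def)
  also have "\<dots> = (\<Sum>j\<le>k. (exp (- \<mu> x) * \<mu> x ^ j / fact j) * (exp (- sum \<mu> F) * sum \<mu> F ^ (k - j) / fact (k - j)))"
  proof (rule sum.cong[OF refl])
    fix j assume "j \<in> {..k}"
    have "prob {\<omega>\<in>space M. X x \<omega> = j \<and> ?S \<omega> = k - j} =
      prob ((\<lambda>\<omega>. (X x \<omega>, ?S \<omega>)) -` ({j} \<times> {k - j}) \<inter> space M)"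
      by (intro arg_cong[where f=prob]) auto
    also have "\<dots> = prob (X x -` {j} \<inter> space M) * prob (?S -` {k - j} \<inter> space M)"
      using ind by (rule indep_varD) auto
    also have "X x -` {j} \<inter> space M = {\<omega>\<in>space M. X x \<omega> = j}" by auto
    also have "?S -` {k - j} \<inter> space M = {\<omega>\<in>space M. ?S \<omega> = k - j}" by auto
    finally show "prob {\<omega>\<in>space M. X x \<omega> = j \<and> ?S \<omega> = k - j} =
      (exp (- \<mu> x) * \<mu> x ^ j / fact j) * (exp (- sum \<mu> F) * sum \<mu> F ^ (k - j) / fact (k - j))"
      using IH insert.prems(2) by simp
  qed
  also have "\<dots> = exp (- \<mu> x) * exp (- sum \<mu> F) / fact k *
      (\<Sum>j\<le>k. of_nat (k choose j) * \<mu> x ^ j * sum \<mu> F ^ (k - j))"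
    unfolding sum_distrib_left by (intro sum.cong refl) (simp add: binomial_fact field_simps)
  also have "\<dots> = exp (- (\<mu> x + sum \<mu> F)) * (\<mu> x + sum \<mu> F) ^ k / fact k"
    by (simp add: binomial_ring exp_add[symmetric])
  finally show ?case using insert.hyps by simp
qed

end

locale prm = prob_space M for M :: "'w measure" +
  fixes I :: "nat set" and Nm :: "nat \<Rightarrow> 'w \<Rightarrow> (real \<times> real) set"
  assumes prm: "prm_family M I Nm"
begin

lemma atoms_subset_quadrant: "c \<in> I \<Longrightarrow> \<omega> \<in> space M \<Longrightarrow> Nm c \<omega> \<subseteq> quadrant"
  using prm by (auto simp: prm_family_def)

lemma poisson_law_ecount:
  "c \<in> I \<Longrightarrow> test_set B \<Longrightarrow> poisson_law M (\<lambda>\<omega>. ecount (Nm c \<omega>) B) (measure lborel B)"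
  using prm by (auto simp: prm_family_def test_set_def)

lemma measurable_ecount [measurable (raw)]:
  "c \<in> I \<Longrightarrow> test_set B \<Longrightarrow> (\<lambda>\<omega>. ecount (Nm c \<omega>) B) \<in> measurable M (count_space UNIV)"
  using poisson_law_ecount by (auto simp: poisson_law_def)

lemma measurable_card_atoms [measurable (raw)]:
  assumes "c \<in> I" "test_set B"
  shows "(\<lambda>\<omega>. card (Nm c \<omega> \<inter> B)) \<in> measurable M (count_space UNIV)"
  unfolding fin_enat_ecount[symmetric]
  by (rule measurable_compose[OF measurable_ecount[OF assms]]) simp

lemma sets_ecount: "c \<in> I \<Longrightarrow> test_set B \<Longrightarrow> {\<omega> \<in> space M. Q (ecount (Nm c \<omega>) B)} \<in> events"
  using measurable_sets[OF measurable_ecount, of c B "{x. Q x}"] by (simp add: vimage_def Int_def conj_commute)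

lemma prob_ecount:
  "c \<in> I \<Longrightarrow> test_set B \<Longrightarrow> prob {\<omega> \<in> space M. ecount (Nm c \<omega>) B = enat k} =
     exp (- measure lborel B) * measure lborel B ^ k / fact k"
  using poisson_law_ecount by (auto simp: poisson_law_def)

text \<open>The Poisson weights of the finite values sum to 1, which leaves no mass for
  \<open>\<infinity>\<close>.\<close>

lemma AE_finite_atoms:
  assumes c: "c \<in> I" and B: "test_set B"
  shows "AE \<omega> in M. finite (Nm c \<omega> \<inter> B)"
proof -
  let ?E = "\<lambda>k. {\<omega> \<in> space M. ecount (Nm c \<omega>) B = enat k}"
  have "(\<lambda>k. prob (?E k)) sums prob (\<Union>k. ?E k)"
    by (rule finite_measure_UNION) (auto simp: disjoint_family_on_def intro!: sets_ecount[OF c B])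
  moreover have "(\<lambda>k. prob (?E k)) sums (exp (- measure lborel B) * exp (measure lborel B))"
    unfolding prob_ecount[OF c B] using sums_mult[OF exp_converges[of "measure lborel B"], of "exp (- measure lborel B)"]
    by (simp add: field_simps)
  ultimately have "prob (\<Union>k. ?E k) = exp (- measure lborel B) * exp (measure lborel B)"
    by (rule sums_unique2)
  then have "prob (\<Union>k. ?E k) = 1" by (simp add: exp_minus)
  then have "AE \<omega> in M. \<omega> \<in> (\<Union>k. ?E k)"
    by (intro AE_prob_1)
  then show ?thesis by (rule AE_mp) (auto simp: ecount_eq_enat_iff)
qed

lemma AE_card_atoms: "c \<in> I \<Longrightarrow> test_set B \<Longrightarrow> AE \<omega> in M. ecount (Nm c \<omega>) B = enat (card (Nm c \<omega> \<inter> B))"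
  using AE_finite_atoms[of c B] by (rule AE_mp) (auto simp: ecount_def)

lemma prob_card_atoms:
  assumes "c \<in> I" "test_set B"
  shows "prob {\<omega> \<in> space M. card (Nm c \<omega> \<inter> B) = k} =
     exp (- measure lborel B) * measure lborel B ^ k / fact k"
proof -
  have "prob {\<omega> \<in> space M. card (Nm c \<omega> \<inter> B) = k} = prob {\<omega> \<in> space M. ecount (Nm c \<omega>) B = enat k}"
  proof (rule measure_eq_AE)
    show "AE \<omega> in M. (\<omega> \<in> {\<omega> \<in> space M. card (Nm c \<omega> \<inter> B) = k}) = (\<omega> \<in> {\<omega> \<in> space M. ecount (Nm c \<omega>) B = enat k})"
      using AE_card_atoms[OF assms] by (rule AE_mp) auto
    show "{\<omega> \<in> space M. card (Nm c \<omega> \<inter> B) = k} \<in> events"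
      using sets_ecount[OF assms, of "\<lambda>e. fin_enat e = k"] by (simp add: fin_enat_ecount)
  qed (rule sets_ecount[OF assms])
  then show ?thesis using prob_ecount[OF assms] by simp
qed

lemma prob_no_atom:
  assumes "c \<in> I" "test_set B"
  shows "prob {\<omega> \<in> space M. ecount (Nm c \<omega>) B = 0} = exp (- measure lborel B)"
  using prob_ecount[OF assms, of 0] by (simp add: zero_enat_def)

lemma prob_some_atom:
  assumes "c \<in> I" "test_set B"
  shows "prob {\<omega> \<in> space M. 1 \<le> ecount (Nm c \<omega>) B} = 1 - exp (- measure lborel B)"
proof -
  have "{\<omega> \<in> space M. 1 \<le> ecount (Nm c \<omega>) B} = space M - {\<omega> \<in> space M. ecount (Nm c \<omega>) B = 0}"
    by (auto simp: one_le_ecount_iff ecount_eq_0_iff)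
  then show ?thesis
    using prob_compl[OF sets_ecount[OF assms, of "\<lambda>e. e = 0"]] prob_no_atom[OF assms] by simp
qed

lemma AE_no_atom:
  assumes "c \<in> I" "test_set B" "measure lborel B = 0"
  shows "AE \<omega> in M. Nm c \<omega> \<inter> B = {}"
proof -
  have "AE \<omega> in M. \<omega> \<in> {\<omega> \<in> space M. ecount (Nm c \<omega>) B = 0}"
    using prob_no_atom[OF assms(1,2)] assms(3) by (intro AE_prob_1) simp
  then show ?thesis by (rule AE_mp) (auto simp: ecount_eq_0_iff)
qed

text \<open>\<open>prm_family\<close> indexes its regions by natural numbers; an injection into them
  carries the independence over to any finite index set.\<close>

lemma indep_vars_ecount:
  fixes J :: "'i set" and c :: "'i \<Rightarrow> nat" and B :: "'i \<Rightarrow> (real \<times> real) set"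
  assumes "finite J" "\<And>j. j \<in> J \<Longrightarrow> c j \<in> I" "\<And>j. j \<in> J \<Longrightarrow> test_set (B j)"
    and disj: "\<And>i j. i \<in> J \<Longrightarrow> j \<in> J \<Longrightarrow> i \<noteq> j \<Longrightarrow> c i = c j \<Longrightarrow> B i \<inter> B j = {}"
  shows "indep_vars (\<lambda>_. count_space UNIV) (\<lambda>j \<omega>. ecount (Nm (c j) \<omega>) (B j)) J"
proof -
  obtain f :: "'i \<Rightarrow> nat" where f: "inj_on f J"
    using finite_imp_inj_to_nat_seg[OF assms(1)] by blast
  define ab where "ab k = (c (inv_into J f k), B (inv_into J f k))" for k
  have ab: "ab (f j) = (c j, B j)" if "j \<in> J" for j
    using that f by (simp add: ab_def)
  have pf: "\<And>(J::nat set) (ab :: nat \<Rightarrow> nat \<times> (real \<times> real) set). finite J \<Longrightarrow>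
        (\<forall>j\<in>J. fst (ab j) \<in> I \<and> snd (ab j) \<in> sets borel \<and> snd (ab j) \<subseteq> quadrant
                 \<and> emeasure lborel (snd (ab j)) < \<infinity>) \<Longrightarrow>
        (\<forall>i\<in>J. \<forall>j\<in>J. i \<noteq> j \<longrightarrow> fst (ab i) = fst (ab j) \<longrightarrow> snd (ab i) \<inter> snd (ab j) = {}) \<Longrightarrow>
        indep_vars (\<lambda>_. count_space UNIV) (\<lambda>j \<omega>. ecount (Nm (fst (ab j)) \<omega>) (snd (ab j))) J"
    using prm unfolding prm_family_def by blast
  have "indep_vars (\<lambda>_. count_space UNIV) (\<lambda>j \<omega>. ecount (Nm (fst (ab j)) \<omega>) (snd (ab j))) (f ` J)"
  proof (rule pf)
    show "finite (f ` J)" using assms(1) by simp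
    show "\<forall>j\<in>f ` J. fst (ab j) \<in> I \<and> snd (ab j) \<in> sets borel \<and> snd (ab j) \<subseteq> quadrant
                 \<and> emeasure lborel (snd (ab j)) < \<infinity>"
      using assms(2,3) by (auto simp: ab test_set_def)
    show "\<forall>i\<in>f ` J. \<forall>j\<in>f ` J. i \<noteq> j \<longrightarrow> fst (ab i) = fst (ab j) \<longrightarrow> snd (ab i) \<inter> snd (ab j) = {}"
    proof safe
      fix i j x y assume "i \<in> J" "j \<in> J" "f i \<noteq> f j" "fst (ab (f i)) = fst (ab (f j))"
        "(x, y) \<in> snd (ab (f i))" "(x, y) \<in> snd (ab (f j))"
      then show "(x, y) \<in> {}" using disj[of i j] by (auto simp: ab)
    qed
  qed
  from indep_vars_reindex[OF this f]
  show ?thesis by (rule indep_vars_cong[THEN iffD1, rotated -1]) (auto simp: ab)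
qed

text \<open>Covers two distinct atoms in \<open>B\<close> both for one actor, where two must be
  counted, and for two actors, where one of each is enough.\<close>

definition collide :: "nat \<Rightarrow> nat \<Rightarrow> (real \<times> real) set \<Rightarrow> 'w set" where
  "collide c d B = (if c = d then {\<omega> \<in> space M. 2 \<le> ecount (Nm c \<omega>) B}
     else {\<omega> \<in> space M. 1 \<le> ecount (Nm c \<omega>) B} \<inter> {\<omega> \<in> space M. 1 \<le> ecount (Nm d \<omega>) B})"

lemma sets_collide: "c \<in> I \<Longrightarrow> d \<in> I \<Longrightarrow> test_set B \<Longrightarrow> collide c d B \<in> events"
  unfolding collide_def by (auto intro!: sets_ecount)

text \<open>Second order in the area, because a pair of atoms is needed. Both cases rest on
  \<open>1 - \<mu> \<le> exp (- \<mu>)\<close>.\<close>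

lemma prob_collide_le:
  assumes c: "c \<in> I" and d: "d \<in> I" and B: "test_set B"
  shows "prob (collide c d B) \<le> (measure lborel B)\<^sup>2"
proof -
  define \<mu> where "\<mu> = measure lborel B"
  have \<mu>: "0 \<le> \<mu>" by (simp add: \<mu>_def)
  have e: "1 - \<mu> \<le> exp (- \<mu>)" using exp_ge_add_one_self[of "- \<mu>"] by simp
  show ?thesis
  proof (cases "c = d")
    case True
    let ?E = "\<lambda>k. {\<omega> \<in> space M. ecount (Nm c \<omega>) B = enat k}"
    have "enat (Suc 0) = 1" "enat 0 = 0" by (simp_all add: one_enat_def zero_enat_def)
    moreover have "2 \<le> e \<longleftrightarrow> e \<noteq> enat 0 \<and> e \<noteq> enat 1" for e
      by (cases e) (auto simp: numeral_eq_enat)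
    ultimately have "collide c d B = space M - (?E 0 \<union> ?E 1)"
      using True unfolding collide_def by auto
    then have "prob (collide c d B) = 1 - prob (?E 0 \<union> ?E 1)"
      using sets_ecount[OF c B] by (simp add: prob_compl sets.Un)
    also have "prob (?E 0 \<union> ?E 1) = prob (?E 0) + prob (?E 1)"
      by (rule finite_measure_Union) (auto intro!: sets_ecount[OF c B])
    also have "\<dots> = exp (- \<mu>) * (1 + \<mu>)"
      unfolding prob_ecount[OF c B] by (simp add: \<mu>_def algebra_simps)
    also have "1 - exp (- \<mu>) * (1 + \<mu>) \<le> 1 - (1 - \<mu>) * (1 + \<mu>)"
      using e \<mu> by (intro diff_left_mono mult_right_mono) auto
    also have "\<dots> = \<mu>\<^sup>2" by (simp add: power2_eq_square algebra_simps)
    finally show ?thesis by (simp add: \<mu>_def)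
  next
    case False
    have ind: "indep_vars (\<lambda>_. count_space UNIV) (\<lambda>j \<omega>. ecount (Nm j \<omega>) B) {c, d}"
      using assms by (intro indep_vars_ecount[of "{c, d}" "\<lambda>j. j" "\<lambda>_. B"]) auto
    have eq: "(\<lambda>\<omega>. ecount (Nm j \<omega>) B) -` {1..} \<inter> space M = {\<omega> \<in> space M. 1 \<le> ecount (Nm j \<omega>) B}" for j
      by auto
    have "prob (collide c d B) = prob (\<Inter>j\<in>{c, d}. (\<lambda>\<omega>. ecount (Nm j \<omega>) B) -` {1..} \<inter> space M)"
      using False by (simp add: collide_def eq)
    also have "\<dots> = (\<Prod>j\<in>{c, d}. prob ((\<lambda>\<omega>. ecount (Nm j \<omega>) B) -` {1..} \<inter> space M))"
      by (rule indep_varsD_finite[OF ind]) auto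
    also have "\<dots> = (1 - exp (- \<mu>))\<^sup>2"
      unfolding eq using False assms prob_some_atom by (simp add: \<mu>_def power2_eq_square)
    also have "\<dots> \<le> \<mu>\<^sup>2" using e \<mu> by (intro power_mono) auto
    finally show ?thesis by (simp add: \<mu>_def)
  qed
qed

text \<open>\<open>g\<close> will be the time or the height coordinate; points with equal
  \<open>g\<close> share a piece. With \<open>n\<close> pieces of area at most \<open>C / n\<close>
  the collision probabilities add up to at most \<open>C\<^sup>2 / n\<close>, which vanishes as
  \<open>n\<close> grows.\<close>

lemma AE_no_collision:
  fixes D :: "nat \<Rightarrow> nat \<Rightarrow> (real \<times> real) set"
  assumes c: "c \<in> I" and d: "d \<in> I" and "0 \<le> C"
    and D: "\<And>n k. 0 < n \<Longrightarrow> k < n \<Longrightarrow> test_set (D n k)"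
    and le: "\<And>n k. 0 < n \<Longrightarrow> k < n \<Longrightarrow> measure lborel (D n k) \<le> C / n"
    and cover: "\<And>n x y. 0 < n \<Longrightarrow> x \<in> B \<Longrightarrow> y \<in> B \<Longrightarrow> g x = g y \<Longrightarrow> \<exists>k<n. x \<in> D n k \<and> y \<in> D n k"
  shows "AE \<omega> in M. \<forall>x\<in>Nm c \<omega> \<inter> B. \<forall>y\<in>Nm d \<omega> \<inter> B. g x = g y \<longrightarrow> c = d \<and> x = y"
proof -
  define F where "F n = (\<Union>k<n. collide c d (D n k))" for n
  have F: "F n \<in> events" if "0 < n" for n
    using sets_collide[OF c d D[OF that]] by (auto simp: F_def)
  have Fle: "prob (F n) \<le> C\<^sup>2 / n" if n: "0 < n" for n :: nat
  proof -
    have "prob (F n) \<le> (\<Sum>k<n. prob (collide c d (D n k)))"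
      unfolding F_def using sets_collide[OF c d D[OF n]]
      by (intro finite_measure_subadditive_finite) auto
    also have "\<dots> \<le> (\<Sum>k<n. (C / n)\<^sup>2)"
    proof (rule sum_mono)
      fix k assume "k \<in> {..<n}"
      then show "prob (collide c d (D n k)) \<le> (C / n)\<^sup>2"
        using order_trans[OF prob_collide_le[OF c d D[OF n]] power_mono[OF le[OF n]]] by simp
    qed
    also have "\<dots> = C\<^sup>2 / n" using n by (simp add: power2_eq_square field_simps)
    finally show ?thesis .
  qed
  \<comment> \<open>Only this measurable set covering the collisions is shown to be null; the
    collisions themselves are not claimed to form an event.\<close>
  have G: "(\<Inter>n\<in>{0<..}. F n) \<in> events" using F by (intro sets.countable_INT) auto
  have "prob (\<Inter>n\<in>{0<..}. F n) \<le> 0"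
  proof (rule LIMSEQ_le_const)
    show "(\<lambda>n. C\<^sup>2 / real n) \<longlonglongrightarrow> 0" by (rule lim_const_over_n)
    have "prob (\<Inter>n\<in>{0<..}. F n) \<le> C\<^sup>2 / n" if n: "0 < n" for n :: nat
      by (rule order_trans[OF finite_measure_mono Fle[OF n]]) (use n F[OF n] in auto)
    then show "\<exists>N. \<forall>n\<ge>N. prob (\<Inter>n\<in>{0<..}. F n) \<le> C\<^sup>2 / real n"
      by (intro exI[of _ 1]) auto
  qed
  then have "prob (\<Inter>n\<in>{0<..}. F n) = 0" by (simp add: measure_le_0_iff)
  then have null: "(\<Inter>n\<in>{0<..}. F n) \<in> null_sets M" using G by (simp add: null_sets_def emeasure_eq_measure)
  show ?thesis
  proof (rule AE_I'[OF null], intro subsetI INT_I)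
    fix \<omega> n assume "\<omega> \<in> {\<omega> \<in> space M. \<not> (\<forall>x\<in>Nm c \<omega> \<inter> B. \<forall>y\<in>Nm d \<omega> \<inter> B. g x = g y \<longrightarrow> c = d \<and> x = y)}"
      and n: "n \<in> {0::nat<..}"
    then have \<omega>: "\<omega> \<in> space M" and
      *: "\<not> (\<forall>x\<in>Nm c \<omega> \<inter> B. \<forall>y\<in>Nm d \<omega> \<inter> B. g x = g y \<longrightarrow> c = d \<and> x = y)" by auto
    then obtain x y where xy: "x \<in> Nm c \<omega>" "x \<in> B" "y \<in> Nm d \<omega>" "y \<in> B" "g x = g y" "\<not> (c = d \<and> x = y)"
      by blast
    obtain k where k: "k < n" "x \<in> D n k" "y \<in> D n k"
      using cover[of n x y] n xy by auto
    have "\<omega> \<in> collide c d (D n k)"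
    proof (cases "c = d")
      case True
      then show ?thesis using two_le_ecount[of x _ y] xy k \<omega> by (auto simp: collide_def)
    next
      case False
      then show ?thesis using xy k \<omega> by (auto simp: collide_def one_le_ecount_iff)
    qed
    then show "\<omega> \<in> F n" using k by (auto simp: F_def)
  qed
qed

end

section \<open>Almost sure properties of the atoms\<close>

text \<open>What a configuration must satisfy for the pathwise arguments. Distinct times across all
  actors give \<open>simple\<close>; distinct heights within an actor make \<open>Zlag\<close>
  meaningful; the instants 0 and \<open>t\<close> carry no atoms.\<close>

definition good_atoms :: "nat set \<Rightarrow> real \<Rightarrow> (nat \<Rightarrow> (real \<times> real) set) \<Rightarrow> bool" where
  "good_atoms I t S \<longleftrightarrow>
    (\<forall>c\<in>I. S c \<subseteq> quadrant) \<and>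
    (\<forall>c\<in>I. \<forall>n::nat. finite (S c \<inter> {0..real n} \<times> {0..real n})) \<and>
    (\<forall>c\<in>I. \<forall>x\<in>S c. fst x \<noteq> 0 \<and> fst x \<noteq> t) \<and>
    (\<forall>c\<in>I. \<forall>d\<in>I. \<forall>x\<in>S c. \<forall>y\<in>S d. fst x = fst y \<longrightarrow> c = d \<and> x = y) \<and>
    (\<forall>c\<in>I. \<forall>x\<in>S c. \<forall>y\<in>S c. snd x = snd y \<longrightarrow> x = y)"

lemma exists_slot:
  fixes u m :: real
  assumes "0 < n" "0 \<le> u" "u \<le> m"
  shows "\<exists>k<n. u \<in> {real k * (m / real n)..real (Suc k) * (m / real n)}"
proof -
  define k where "k = (LEAST k. u \<le> real (Suc k) * (m / real n))"
  have ex: "u \<le> real (Suc (n - 1)) * (m / real n)" using assms by simp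
  have 1: "u \<le> real (Suc k) * (m / real n)"
    unfolding k_def by (rule LeastI[where P="\<lambda>k. u \<le> real (Suc k) * (m / real n)", OF ex])
  have 2: "k \<le> n - 1"
    unfolding k_def by (rule Least_le[where P="\<lambda>k. u \<le> real (Suc k) * (m / real n)", OF ex])
  have 3: "real k * (m / real n) \<le> u"
  proof (cases k)
    case 0 then show ?thesis using assms by simp
  next
    case (Suc j)
    then have "\<not> u \<le> real (Suc j) * (m / real n)"
      unfolding k_def by (intro not_less_Least) simp
    then show ?thesis using Suc by simp
  qed
  show ?thesis using 1 2 3 assms(1) by (intro exI[of _ k]) auto
qed

lemma quadrant_in_box:
  assumes "x \<in> quadrant"
  obtains n :: nat where "\<And>m. n \<le> m \<Longrightarrow> x \<in> {0..real m} \<times> {0..real m}"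
proof -
  obtain n :: nat where n: "max (fst x) (snd x) \<le> real n" using real_arch_simple by blast
  show thesis
  proof (rule that)
    fix m assume "n \<le> m"
    then have "real n \<le> real m" by simp
    then show "x \<in> {0..real m} \<times> {0..real m}" using n assms by (cases x) (auto simp: quadrant_def)
  qed
qed

context prm
begin

text \<open>Time slots of width \<open>m / n\<close> serve the first claim, height layers the
  second; either piece has area \<open>m * m / n\<close>.\<close>

lemma AE_no_collision_box:
  assumes c: "c \<in> I" and d: "d \<in> I"
  shows "AE \<omega> in M. \<forall>x\<in>Nm c \<omega> \<inter> {0..real m} \<times> {0..real m}. \<forall>y\<in>Nm d \<omega> \<inter> {0..real m} \<times> {0..real m}.
    fst x = fst y \<longrightarrow> c = d \<and> x = y"
    and "AE \<omega> in M. \<forall>x\<in>Nm c \<omega> \<inter> {0..real m} \<times> {0..real m}. \<forall>y\<in>Nm d \<omega> \<inter> {0..real m} \<times> {0..real m}.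
    snd x = snd y \<longrightarrow> c = d \<and> x = y"
proof -
  let ?J = "\<lambda>n k. {real k * (real m / real n)..real (Suc k) * (real m / real n)}"
  have len: "measure lborel (?J n k) = real m / n" if "0 < n" for n k :: nat
  proof -
    have "real k * (real m / real n) \<le> real (Suc k) * (real m / real n)"
      by (intro mult_right_mono) auto
    then show ?thesis by (simp add: algebra_simps add_divide_distrib)
  qed
  show "AE \<omega> in M. \<forall>x\<in>Nm c \<omega> \<inter> {0..real m} \<times> {0..real m}. \<forall>y\<in>Nm d \<omega> \<inter> {0..real m} \<times> {0..real m}.
    fst x = fst y \<longrightarrow> c = d \<and> x = y"
  proof (rule AE_no_collision[OF c d, where C="real m * real m" and D="\<lambda>n k. ?J n k \<times> {0..real m}"])
    fix n k :: nat assume "0 < n"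
    show "test_set (?J n k \<times> {0..real m})" by (intro test_set_box) auto
    show "measure lborel (?J n k \<times> {0..real m}) \<le> real m * real m / real n"
      using len[OF \<open>0 < n\<close>, of k] by (subst measure_lborel_Times) simp_all
  next
    fix n :: nat and x y assume *: "0 < n" "x \<in> {0..real m} \<times> {0..real m}" "y \<in> {0..real m} \<times> {0..real m}" "fst x = fst y"
    obtain k where "k < n" "fst x \<in> ?J n k" using exists_slot[OF *(1), of "fst x" "real m"] *(2) by auto
    then show "\<exists>k<n. x \<in> ?J n k \<times> {0..real m} \<and> y \<in> ?J n k \<times> {0..real m}"
      using * by (intro exI[of _ k]) (cases x, cases y, auto)
  qed simp
  show "AE \<omega> in M. \<forall>x\<in>Nm c \<omega> \<inter> {0..real m} \<times> {0..real m}. \<forall>y\<in>Nm d \<omega> \<inter> {0..real m} \<times> {0..real m}.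
    snd x = snd y \<longrightarrow> c = d \<and> x = y"
  proof (rule AE_no_collision[OF c d, where C="real m * real m" and D="\<lambda>n k. {0..real m} \<times> ?J n k"])
    fix n k :: nat assume "0 < n"
    show "test_set ({0..real m} \<times> ?J n k)" by (intro test_set_box) auto
    show "measure lborel ({0..real m} \<times> ?J n k) \<le> real m * real m / real n"
      using len[OF \<open>0 < n\<close>, of k] by (subst measure_lborel_Times) simp_all
  next
    fix n :: nat and x y assume *: "0 < n" "x \<in> {0..real m} \<times> {0..real m}" "y \<in> {0..real m} \<times> {0..real m}" "snd x = snd y"
    obtain k where "k < n" "snd x \<in> ?J n k" using exists_slot[OF *(1), of "snd x" "real m"] *(2) by auto
    then show "\<exists>k<n. x \<in> {0..real m} \<times> ?J n k \<and> y \<in> {0..real m} \<times> ?J n k"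
      using * by (intro exI[of _ k]) (cases x, cases y, auto)
  qed simp
qed

lemma AE_not_on_line:
  assumes "c \<in> I" "0 \<le> t"
  shows "AE \<omega> in M. \<forall>x\<in>Nm c \<omega>. fst x \<noteq> t"
proof -
  have "AE \<omega> in M. Nm c \<omega> \<inter> {t..t} \<times> {0..real n} = {}" for n
    using assms by (intro AE_no_atom test_set_box) (simp_all add: measure_lborel_Times)
  then have "AE \<omega> in M. \<forall>n. Nm c \<omega> \<inter> {t..t} \<times> {0..real n} = {}"
    by (simp add: AE_all_countable)
  then show ?thesis
  proof (rule AE_mp, intro AE_I2 impI ballI notI)
    fix \<omega> x assume \<omega>: "\<omega> \<in> space M" "\<forall>n. Nm c \<omega> \<inter> {t..t} \<times> {0..real n} = {}"
      and x: "x \<in> Nm c \<omega>" "fst x = t"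
    have "x \<in> quadrant" using x atoms_subset_quadrant[OF assms(1) \<omega>(1)] by blast
    then obtain n :: nat where "x \<in> {0..real n} \<times> {0..real n}" using quadrant_in_box by blast
    then have "x \<in> Nm c \<omega> \<inter> {t..t} \<times> {0..real n}" using x by (cases x) auto
    with \<omega>(2) show False by blast
  qed
qed

lemma AE_good_atoms:
  assumes t: "0 \<le> t"
  shows "AE \<omega> in M. good_atoms I t (\<lambda>c. Nm c \<omega>)"
proof -
  have "AE \<omega> in M. \<forall>c\<in>I. \<forall>n::nat. finite (Nm c \<omega> \<inter> {0..real n} \<times> {0..real n})"
    by (simp add: AE_ball_countable AE_all_countable AE_finite_atoms test_set_box)
  moreover have "AE \<omega> in M. \<forall>c\<in>I. \<forall>x\<in>Nm c \<omega>. fst x \<noteq> 0 \<and> fst x \<noteq> t"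
    using AE_not_on_line t by (auto simp: AE_ball_countable ball_conj_distrib intro!: AE_conjI)
  moreover have "AE \<omega> in M. \<forall>c\<in>I. \<forall>d\<in>I. \<forall>m::nat. \<forall>x\<in>Nm c \<omega> \<inter> {0..real m} \<times> {0..real m}.
     \<forall>y\<in>Nm d \<omega> \<inter> {0..real m} \<times> {0..real m}. fst x = fst y \<longrightarrow> c = d \<and> x = y"
    using AE_no_collision_box(1) by (simp only: AE_ball_countable AE_all_countable countableI_type) blast
  moreover have "AE \<omega> in M. \<forall>c\<in>I. \<forall>m::nat. \<forall>x\<in>Nm c \<omega> \<inter> {0..real m} \<times> {0..real m}.
     \<forall>y\<in>Nm c \<omega> \<inter> {0..real m} \<times> {0..real m}. snd x = snd y \<longrightarrow> c = c \<and> x = y"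
    using AE_no_collision_box(2) by (simp only: AE_ball_countable AE_all_countable countableI_type) blast
  moreover have "AE \<omega> in M. \<omega> \<in> space M" by (rule AE_space)
  ultimately show ?thesis
  proof (eventually_elim, goal_cases)
    case (1 \<omega>)
    note fin = 1(1) and line = 1(2) and times = 1(3) and heights = 1(4)
    have quad: "Nm c \<omega> \<subseteq> quadrant" if "c \<in> I" for c
      using atoms_subset_quadrant[OF that 1(5)] .
    \<comment> \<open>Two points of the quadrant share a box of integer size, so countably many
      boxes suffice.\<close>
    have box: "\<exists>m::nat. x \<in> {0..real m} \<times> {0..real m} \<and> y \<in> {0..real m} \<times> {0..real m}"
      if xy: "x \<in> quadrant" "y \<in> quadrant" for x y :: "real \<times> real"
    proof -
      obtain m :: nat where m: "\<And>k. m \<le> k \<Longrightarrow> x \<in> {0..real k} \<times> {0..real k}"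
        using quadrant_in_box[OF xy(1)] by blast
      obtain n :: nat where n: "\<And>k. n \<le> k \<Longrightarrow> y \<in> {0..real k} \<times> {0..real k}"
        using quadrant_in_box[OF xy(2)] by blast
      show ?thesis using m[of "max m n"] n[of "max m n"] by (intro exI[of _ "max m n"]) simp
    qed
    show ?case
      unfolding good_atoms_def
    proof (intro conjI)
      show "\<forall>c\<in>I. Nm c \<omega> \<subseteq> quadrant" using quad by blast
      show "\<forall>c\<in>I. \<forall>n::nat. finite (Nm c \<omega> \<inter> {0..real n} \<times> {0..real n})" by (rule fin)
      show "\<forall>c\<in>I. \<forall>x\<in>Nm c \<omega>. fst x \<noteq> 0 \<and> fst x \<noteq> t" by (rule line)
      show "\<forall>c\<in>I. \<forall>d\<in>I. \<forall>x\<in>Nm c \<omega>. \<forall>y\<in>Nm d \<omega>. fst x = fst y \<longrightarrow> c = d \<and> x = y"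
      proof (intro ballI impI)
        fix c d x y assume *: "c \<in> I" "d \<in> I" "x \<in> Nm c \<omega>" "y \<in> Nm d \<omega>" "fst x = fst y"
        then obtain m :: nat where "x \<in> {0..real m} \<times> {0..real m}" "y \<in> {0..real m} \<times> {0..real m}"
          using box[of x y] quad by blast
        then show "c = d \<and> x = y" using times * by blast
      qed
      show "\<forall>c\<in>I. \<forall>x\<in>Nm c \<omega>. \<forall>y\<in>Nm c \<omega>. snd x = snd y \<longrightarrow> x = y"
      proof (intro ballI impI)
        fix c x y assume *: "c \<in> I" "x \<in> Nm c \<omega>" "y \<in> Nm c \<omega>" "snd x = snd y"
        then obtain m :: nat where "x \<in> {0..real m} \<times> {0..real m}" "y \<in> {0..real m} \<times> {0..real m}"
          using box[of x y] quad by blast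
        then show "x = y" using heights * by blast
      qed
    qed
  qed
qed

text \<open>The strip has infinite area: its part up to height \<open>n\<close> is free of atoms
  with probability \<open>exp (- ((t - s) * n))\<close>, which tends to 0.\<close>

lemma AE_some_atom:
  assumes a: "a \<in> I" and "0 \<le> s" "s < t"
  shows "AE \<omega> in M. Nm a \<omega> \<inter> {s..t} \<times> {0..} \<noteq> {}"
proof -
  let ?F = "\<lambda>n::nat. {\<omega> \<in> space M. ecount (Nm a \<omega>) ({s..t} \<times> {0..real n}) = 0}"
  have ts: "test_set ({s..t} \<times> {0..real n})" for n using assms by (intro test_set_box) auto
  have F: "?F n \<in> events" for n by (intro sets_ecount a ts)
  have G: "(\<Inter>n. ?F n) \<in> events" using F by (intro sets.countable_INT) auto
  have "prob (\<Inter>n. ?F n) \<le> 0"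
  proof (rule LIMSEQ_le_const)
    have "(\<lambda>n. exp (- (t - s)) ^ n) \<longlonglongrightarrow> 0"
      using assms by (intro LIMSEQ_realpow_zero) auto
    then show "(\<lambda>n. exp (- ((t - s) * real n))) \<longlonglongrightarrow> 0"
      by (simp add: exp_of_nat_mult[symmetric] algebra_simps)
    have "prob (\<Inter>n. ?F n) \<le> exp (- ((t - s) * real n))" for n
    proof -
      have "prob (\<Inter>n. ?F n) \<le> prob (?F n)" by (intro finite_measure_mono F) blast
      also have "\<dots> = exp (- ((t - s) * real n))"
        using assms by (subst prob_no_atom[OF a ts]) (simp add: measure_lborel_Times)
      finally show ?thesis .
    qed
    then show "\<exists>N. \<forall>n\<ge>N. prob (\<Inter>n. ?F n) \<le> exp (- ((t - s) * real n))" by blast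
  qed
  then have "prob (\<Inter>n. ?F n) = 0" by (simp add: measure_le_0_iff)
  then have null: "(\<Inter>n. ?F n) \<in> null_sets M" using G by (simp add: null_sets_def emeasure_eq_measure)
  show ?thesis
  proof (rule AE_I'[OF null], intro subsetI INT_I)
    fix \<omega> n assume "\<omega> \<in> {\<omega> \<in> space M. \<not> Nm a \<omega> \<inter> {s..t} \<times> {0..} \<noteq> {}}"
    then show "\<omega> \<in> ?F n" by (auto simp: ecount_eq_0_iff)
  qed
qed

end

section \<open>The lowest atom over a time interval: existence, lag, measurability\<close>

lemma Eheight_le:
  assumes "(v, z) \<in> Nm a \<omega>" "s \<le> v" "v \<le> u" "0 \<le> z"
  shows "Eheight Nm a s u \<omega> \<le> ereal z"
proof (rule ereal_le_epsilon2)
  fix e :: real assume "0 < e"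
  \<comment> \<open>\<open>Eheight\<close> admits positive levels only, so an atom at height 0 has
    to be caught with \<open>z + e\<close>.\<close>
  have "(v, z) \<in> Nm a \<omega> \<inter> {s..u} \<times> {0..z + e}" using assms \<open>0 < e\<close> by auto
  then have "1 \<le> ecount (Nm a \<omega>) ({s..u} \<times> {0..z + e})" unfolding one_le_ecount_iff by blast
  then have "Eheight Nm a s u \<omega> \<le> ereal (z + e)"
    unfolding Eheight_def using assms \<open>0 < e\<close> by (intro Inf_lower) auto
  then show "Eheight Nm a s u \<omega> \<le> ereal z + ereal e" by simp
qed

lemma Eheight_ge:
  assumes "\<And>v z. (v, z) \<in> Nm a \<omega> \<Longrightarrow> s \<le> v \<Longrightarrow> v \<le> u \<Longrightarrow> 0 \<le> z \<Longrightarrow> e \<le> ereal z"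
  shows "e \<le> Eheight Nm a s u \<omega>"
  unfolding Eheight_def
proof (rule Inf_greatest)
  fix y assume "y \<in> {ereal r |r. 0 < r \<and> 1 \<le> ecount (Nm a \<omega>) ({s..u} \<times> {0..r})}"
  then obtain r where r: "y = ereal r" "Nm a \<omega> \<inter> {s..u} \<times> {0..r} \<noteq> {}"
    by (auto simp: one_le_ecount_iff)
  then obtain v z where "(v, z) \<in> Nm a \<omega>" "s \<le> v" "v \<le> u" "0 \<le> z" "z \<le> r" by auto
  with assms[of v z] show "e \<le> y" unfolding r(1) by (metis ereal_less_eq(3) order_trans)
qed

lemma good_atoms_finite:
  assumes "good_atoms I t S" "c \<in> I" "A \<subseteq> {..m} \<times> {..m}"
  shows "finite (S c \<inter> A)"
proof -
  obtain n :: nat where n: "m \<le> real n" using real_arch_simple by blast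
  have "finite (S c \<inter> {0..real n} \<times> {0..real n})" "S c \<subseteq> quadrant"
    using assms(1,2) by (auto simp: good_atoms_def)
  moreover have "S c \<inter> A \<subseteq> S c \<inter> {0..real n} \<times> {0..real n}"
    using assms(3) \<open>S c \<subseteq> quadrant\<close> n by (fastforce simp: quadrant_def)
  ultimately show ?thesis using finite_subset by blast
qed

text \<open>Over the interval only finitely many atoms lie at or below the height of a given one, so
  the infimum is attained.\<close>

lemma lowest_atom:
  assumes good: "good_atoms I t (\<lambda>c. Nm c \<omega>)" and a: "a \<in> I"
    and ne: "Nm a \<omega> \<inter> {s..u} \<times> {0..} \<noteq> {}"
  obtains \<tau> e where "(\<tau>, e) \<in> Nm a \<omega>" "s \<le> \<tau>" "\<tau> \<le> u" "0 \<le> e"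
    "\<forall>v z. (v, z) \<in> Nm a \<omega> \<longrightarrow> s \<le> v \<longrightarrow> v \<le> u \<longrightarrow> e \<le> z"
    "Eheight Nm a s u \<omega> = ereal e" "Zlag Nm a s u \<omega> = u - \<tau>"
proof -
  obtain v0 z0 where x0: "(v0, z0) \<in> Nm a \<omega>" "s \<le> v0" "v0 \<le> u" "0 \<le> z0" using ne by auto
  define F where "F = Nm a \<omega> \<inter> {s..u} \<times> {..z0}"
  have finF: "finite F" unfolding F_def
    by (rule good_atoms_finite[OF good a, of _ "max u z0"]) auto
  have neF: "F \<noteq> {}" using x0 by (auto simp: F_def)
  define e where "e = Min (snd ` F)"
  have "e \<in> snd ` F" unfolding e_def using finF neF by (intro Min_in) auto
  then obtain \<tau> where \<tau>: "(\<tau>, e) \<in> Nm a \<omega>" "s \<le> \<tau>" "\<tau> \<le> u" "e \<le> z0" by (auto simp: F_def)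
  have low: "e \<le> z" if "(v, z) \<in> Nm a \<omega>" "s \<le> v" "v \<le> u" for v z
  proof (cases "z \<le> z0")
    case True
    then have "(v, z) \<in> F" using that by (simp add: F_def)
    then show ?thesis unfolding e_def using finF by (intro Min_le) force+
  qed (use \<tau> in simp)
  have e0: "0 \<le> e" using good a \<tau>(1) by (fastforce simp: good_atoms_def quadrant_def)
  have E: "Eheight Nm a s u \<omega> = ereal e"
    using Eheight_le[of \<tau> e Nm a \<omega>] \<tau> e0 low by (intro antisym Eheight_ge) auto
  have heights: "x = y" if "x \<in> Nm a \<omega>" "y \<in> Nm a \<omega>" "snd x = snd y" for x y
    using good a that unfolding good_atoms_def by blast
  \<comment> \<open>Distinct heights within one actor make the description in \<open>Zlag\<close>
    well defined.\<close>
  have "(THE v. (v, e) \<in> Nm a \<omega> \<and> s \<le> v \<and> v \<le> u) = \<tau>"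
  proof (rule the_equality)
    fix v assume "(v, e) \<in> Nm a \<omega> \<and> s \<le> v \<and> v \<le> u"
    then show "v = \<tau>" using heights[of "(v, e)" "(\<tau>, e)"] \<tau>(1) by simp
  qed (use \<tau> in simp)
  then have "Zlag Nm a s u \<omega> = u - \<tau>" by (simp add: Zlag_def E)
  with \<tau> low e0 E show thesis by (intro that[of \<tau> e]) auto
qed

text \<open>The description operator in \<open>Zlag\<close> gives no direct access to measurability.
  The lowest atom over \<open>[s, t]\<close> comes after \<open>u\<close> exactly when it undercuts
  everything in \<open>[s, u]\<close>, which is a comparison of two heights.\<close>

lemma Zlag_less_iff:
  assumes good: "good_atoms I t (\<lambda>c. Nm c \<omega>)" and a: "a \<in> I"
    and ne: "Nm a \<omega> \<inter> {s..t} \<times> {0..} \<noteq> {}" and u: "s \<le> u" "u < t"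
  shows "Zlag Nm a s t \<omega> < t - u \<longleftrightarrow> Eheight Nm a s t \<omega> < Eheight Nm a s u \<omega>"
proof -
  obtain \<tau> e where 1: "(\<tau>, e) \<in> Nm a \<omega>" "s \<le> \<tau>" "\<tau> \<le> t" "0 \<le> e"
    "\<forall>v z. (v, z) \<in> Nm a \<omega> \<longrightarrow> s \<le> v \<longrightarrow> v \<le> t \<longrightarrow> e \<le> z"
    "Eheight Nm a s t \<omega> = ereal e" "Zlag Nm a s t \<omega> = t - \<tau>"
    using lowest_atom[where Nm=Nm and \<omega>=\<omega>, OF good a ne] by blast
  have "u < \<tau> \<longleftrightarrow> ereal e < Eheight Nm a s u \<omega>"
  proof
    assume "u < \<tau>"
    show "ereal e < Eheight Nm a s u \<omega>"
    proof (cases "Nm a \<omega> \<inter> {s..u} \<times> {0..} = {}")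
      case True
      then have "\<infinity> \<le> Eheight Nm a s u \<omega>" by (intro Eheight_ge) auto
      then show ?thesis by simp
    next
      case False
      obtain \<tau>' e' where 2: "(\<tau>', e') \<in> Nm a \<omega>" "s \<le> \<tau>'" "\<tau>' \<le> u" "0 \<le> e'"
        "\<forall>v z. (v, z) \<in> Nm a \<omega> \<longrightarrow> s \<le> v \<longrightarrow> v \<le> u \<longrightarrow> e' \<le> z"
        "Eheight Nm a s u \<omega> = ereal e'" "Zlag Nm a s u \<omega> = u - \<tau>'"
        using lowest_atom[where Nm=Nm and \<omega>=\<omega>, OF good a False] by blast
      have "e \<le> e'" using 1(5) 2(1,2,3) u by (meson less_imp_le order_trans)
      moreover have "e \<noteq> e'"
      proof
        assume "e = e'"
        then have "(\<tau>, e) = (\<tau>', e')" using good a 1(1) 2(1) unfolding good_atoms_def by fastforce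
        with 2(3) \<open>u < \<tau>\<close> show False by simp
      qed
      ultimately show ?thesis by (simp add: 2(6))
    qed
  next
    assume *: "ereal e < Eheight Nm a s u \<omega>"
    show "u < \<tau>"
    proof (rule ccontr)
      assume "\<not> u < \<tau>"
      then have "Eheight Nm a s u \<omega> \<le> ereal e" using 1 by (intro Eheight_le) auto
      with * show False by simp
    qed
  qed
  then show ?thesis by (simp add: 1(6,7))
qed

lemma ereal_less_rat:
  assumes "ereal r < y" obtains q where "q \<in> \<rat>" "r < q" "ereal q < y"
proof -
  obtain z where z: "ereal r < ereal z" "ereal z < y" using ereal_dense2[OF assms] by auto
  then obtain q where "q \<in> \<rat>" "r < q" "q < z" using Rats_dense_in_real[of r z] by auto
  then show thesis using that z(2) by (metis ereal_less(2) less_ereal.simps(1) less_trans)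
qed

text \<open>Whether some atom lies below a level is monotone in the level, so rational levels decide
  it.\<close>

lemma (in prm) measurable_Eheight:
  assumes a: "a \<in> I" and "0 \<le> s"
  shows "Eheight Nm a s u \<in> borel_measurable M"
proof (rule borel_measurableI_less)
  fix y :: ereal
  have "Eheight Nm a s u \<omega> < y \<longleftrightarrow> (\<exists>q\<in>\<rat> \<inter> {q. 0 < q \<and> ereal q < y}. 1 \<le> ecount (Nm a \<omega>) ({s..u} \<times> {0..q}))" for \<omega>
  proof
    assume "Eheight Nm a s u \<omega> < y"
    then obtain r where r: "0 < r" "1 \<le> ecount (Nm a \<omega>) ({s..u} \<times> {0..r})" "ereal r < y"
      unfolding Eheight_def Inf_less_iff by blast
    obtain q where q: "q \<in> \<rat>" "r < q" "ereal q < y" using ereal_less_rat[OF r(3)] .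
    have "{s..u} \<times> {0..r} \<subseteq> {s..u} \<times> {0..q}" using q by auto
    then have "1 \<le> ecount (Nm a \<omega>) ({s..u} \<times> {0..q})"
      using r(2) unfolding one_le_ecount_iff by blast
    then show "\<exists>q\<in>\<rat> \<inter> {q. 0 < q \<and> ereal q < y}. 1 \<le> ecount (Nm a \<omega>) ({s..u} \<times> {0..q})"
      using q r(1) by (intro bexI[of _ q]) auto
  next
    assume "\<exists>q\<in>\<rat> \<inter> {q. 0 < q \<and> ereal q < y}. 1 \<le> ecount (Nm a \<omega>) ({s..u} \<times> {0..q})"
    then show "Eheight Nm a s u \<omega> < y" unfolding Eheight_def Inf_less_iff by blast
  qed
  then have "{\<omega> \<in> space M. Eheight Nm a s u \<omega> < y} =
    (\<Union>q\<in>\<rat> \<inter> {q. 0 < q \<and> ereal q < y}. {\<omega> \<in> space M. 1 \<le> ecount (Nm a \<omega>) ({s..u} \<times> {0..q})})"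
    by blast
  also have "\<dots> \<in> events"
  proof (rule sets.countable_UN')
    show "countable (\<rat> \<inter> {q. 0 < q \<and> ereal q < y})" by (intro countable_Int1 countable_rat)
    show "(\<lambda>q. {\<omega> \<in> space M. 1 \<le> ecount (Nm a \<omega>) ({s..u} \<times> {0..q})}) ` (\<rat> \<inter> {q. 0 < q \<and> ereal q < y}) \<subseteq> events"
      by (rule image_subsetI, rule sets_ecount[OF a test_set_box]) (use assms in auto)
  qed
  finally show "{\<omega> \<in> space M. Eheight Nm a s u \<omega> < y} \<in> events" .
qed

section \<open>Independence over overlapping regions\<close>

text \<open>For \<open>\<S>\<close> ranging over the subsets of \<open>\<B>\<close> these are the
  atoms of the Boolean algebra generated by \<open>\<B>\<close>.\<close>

definition venn_cell :: "'a set set \<Rightarrow> 'a set set \<Rightarrow> 'a set" where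
  "venn_cell \<B> \<S> = \<Inter>\<S> - \<Union>(\<B> - \<S>)"

lemma venn_cell_disjoint:
  assumes "\<S> \<subseteq> \<B>" "\<S>' \<subseteq> \<B>" "\<S> \<noteq> \<S>'"
  shows "venn_cell \<B> \<S> \<inter> venn_cell \<B> \<S>' = {}"
  using assms unfolding venn_cell_def by blast

lemma eq_UN_venn_cell:
  assumes "B \<in> \<B>" shows "B = (\<Union>\<S>\<in>{\<S>\<in>Pow \<B>. B \<in> \<S>}. venn_cell \<B> \<S>)"
proof (intro equalityI subsetI)
  fix x assume "x \<in> B"
  with assms have "x \<in> venn_cell \<B> {A\<in>\<B>. x \<in> A}" "B \<in> {A\<in>\<B>. x \<in> A}" "{A\<in>\<B>. x \<in> A} \<subseteq> \<B>"
    by (auto simp: venn_cell_def)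
  then show "x \<in> (\<Union>\<S>\<in>{\<S>\<in>Pow \<B>. B \<in> \<S>}. venn_cell \<B> \<S>)" by blast
qed (auto simp: venn_cell_def)

context prm
begin

abbreviation "cs \<equiv> count_space UNIV :: enat measure"

text \<open>The defining independence covers disjoint regions only; overlapping regions are
  reduced to it by cutting them into Venn cells.\<close>
lemma indep_vars_ecount_vectors:
  assumes "finite C" "C \<subseteq> I" "finite \<B>" "\<And>B. B \<in> \<B> \<Longrightarrow> test_set B"
  shows "indep_vars (\<lambda>_. PiM \<B> (\<lambda>_. cs)) (\<lambda>c \<omega>. \<lambda>B\<in>\<B>. ecount (Nm c \<omega>) B) C"
proof -
  \<comment> \<open>The empty index is left out: its cell is the complement of all regions and has
    infinite area.\<close>
  define J where "J = C \<times> (Pow \<B> - {{}})"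
  have finJ: "finite J" using assms by (simp add: J_def)
  have cell: "test_set (venn_cell \<B> \<S>)" if "\<S> \<in> Pow \<B> - {{}}" for \<S>
  proof -
    obtain B where B: "B \<in> \<S>" "B \<in> \<B>" using \<open>\<S> \<in> Pow \<B> - {{}}\<close> by auto
    show ?thesis
    proof (rule test_set_subset[OF assms(4)[OF B(2)]])
      show "venn_cell \<B> \<S> \<subseteq> B" using B by (auto simp: venn_cell_def)
      have "finite \<S>" using assms(3) that finite_subset by blast
      moreover have "A \<in> sets borel" if "A \<in> \<B>" for A using assms(4)[OF that] by (simp add: test_set_def)
      ultimately have "(\<Inter>A\<in>\<S>. A) \<in> sets borel" "\<Union>(\<B> - \<S>) \<in> sets borel"
        using that B assms(3) by (blast intro!: sets.finite_INT sets.finite_Union)+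
      then show "venn_cell \<B> \<S> \<in> sets borel"
        unfolding venn_cell_def by (simp add: sets.Diff)
    qed
  qed
  have ind: "indep_vars (\<lambda>_. cs) (\<lambda>j \<omega>. ecount (Nm (fst j) \<omega>) (venn_cell \<B> (snd j))) J"
  proof (rule indep_vars_ecount[OF finJ])
    fix i j assume "i \<in> J" "j \<in> J" "i \<noteq> j" "fst i = fst j"
    then show "venn_cell \<B> (snd i) \<inter> venn_cell \<B> (snd j) = {}"
      by (intro venn_cell_disjoint) (auto simp: J_def)
  next
    fix j assume "j \<in> J"
    then have "fst j \<in> C" "snd j \<in> Pow \<B> - {{}}" by (auto simp: J_def)
    then show "fst j \<in> I" "test_set (venn_cell \<B> (snd j))"
      using assms(2) by (blast, intro cell)
  qed
  \<comment> \<open>The cells are grouped by actor: the block of \<open>c\<close> determines its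
    counts on all of \<open>\<B>\<close>, since each region is a disjoint union of cells.\<close>
  define K where "K c = {c} \<times> (Pow \<B> - {{}})" for c :: nat
  have "indep_vars (\<lambda>c. PiM (K c) (\<lambda>_. cs))
      (\<lambda>c \<omega>. restrict (\<lambda>j. ecount (Nm (fst j) \<omega>) (venn_cell \<B> (snd j))) (K c)) C"
    by (rule indep_vars_restrict[OF ind]) (auto simp: K_def J_def disjoint_family_on_def)
  then have "indep_vars (\<lambda>_. PiM \<B> (\<lambda>_. cs))
      (\<lambda>c \<omega>. (\<lambda>f. \<lambda>B\<in>\<B>. \<Sum>\<S>\<in>{\<S>\<in>Pow \<B>. B \<in> \<S>}. f (c, \<S>))
        (restrict (\<lambda>j. ecount (Nm (fst j) \<omega>) (venn_cell \<B> (snd j))) (K c))) C"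
  proof (rule indep_vars_compose2)
    fix c
    show "(\<lambda>f. \<lambda>B\<in>\<B>. \<Sum>\<S>\<in>{\<S>\<in>Pow \<B>. B \<in> \<S>}. f (c, \<S>))
        \<in> measurable (PiM (K c) (\<lambda>_. cs)) (PiM \<B> (\<lambda>_. cs))"
    proof (rule measurable_restrict, rule measurable_sum_countable)
      fix B \<S> assume "\<S> \<in> {\<S>\<in>Pow \<B>. B \<in> \<S>}"
      then have "(c, \<S>) \<in> K c" by (auto simp: K_def)
      then show "(\<lambda>f. f (c, \<S>)) \<in> measurable (PiM (K c) (\<lambda>_. cs)) cs"
        by (rule measurable_component_singleton)
    qed
  qed
  then show ?thesis
  proof (rule indep_vars_cong[THEN iffD1, rotated -1])
    fix c assume c: "c \<in> C"
    show "(\<lambda>\<omega>. (\<lambda>f. \<lambda>B\<in>\<B>. \<Sum>\<S>\<in>{\<S>\<in>Pow \<B>. B \<in> \<S>}. f (c, \<S>))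
        (restrict (\<lambda>j. ecount (Nm (fst j) \<omega>) (venn_cell \<B> (snd j))) (K c))) =
       (\<lambda>\<omega>. \<lambda>B\<in>\<B>. ecount (Nm c \<omega>) B)"
    proof (rule ext, rule restrict_ext)
      fix \<omega> B assume B: "B \<in> \<B>"
      have "ecount (Nm c \<omega>) B = ecount (Nm c \<omega>) (\<Union>\<S>\<in>{\<S>\<in>Pow \<B>. B \<in> \<S>}. venn_cell \<B> \<S>)"
        using eq_UN_venn_cell[OF B] by simp
      also have "\<dots> = (\<Sum>\<S>\<in>{\<S>\<in>Pow \<B>. B \<in> \<S>}. ecount (Nm c \<omega>) (venn_cell \<B> \<S>))"
      proof (rule ecount_UN_disjoint)
        show "finite {\<S> \<in> Pow \<B>. B \<in> \<S>}" using assms(3) by simp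
        show "disjoint_family_on (venn_cell \<B>) {\<S> \<in> Pow \<B>. B \<in> \<S>}"
          unfolding disjoint_family_on_def by (intro ballI impI venn_cell_disjoint) auto
      qed
      also have "\<dots> = (\<Sum>\<S>\<in>{\<S>\<in>Pow \<B>. B \<in> \<S>}.
          restrict (\<lambda>j. ecount (Nm (fst j) \<omega>) (venn_cell \<B> (snd j))) (K c) (c, \<S>))"
        by (intro sum.cong refl) (auto simp: K_def)
      finally show "(\<Sum>\<S>\<in>{\<S>\<in>Pow \<B>. B \<in> \<S>}.
          restrict (\<lambda>j. ecount (Nm (fst j) \<omega>) (venn_cell \<B> (snd j))) (K c) (c, \<S>)) = ecount (Nm c \<omega>) B"
        by simp
    qed
  qed simp_all
qed

text \<open>Groups the joint independence over \<open>insert a C\<close> into \<open>a\<close>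
  against all of \<open>C\<close>; measurable predicates on the count vectors allow cylinder events
  on both sides.\<close>

lemma prob_indep_atoms:
  assumes a: "a \<in> I" "a \<notin> C" and C: "finite C" "C \<subseteq> I" and \<B>: "finite \<B>" "\<And>B. B \<in> \<B> \<Longrightarrow> test_set B"
    and Q: "Measurable.pred (PiM \<B> (\<lambda>_. cs)) Q"
    and R: "Measurable.pred (PiM C (\<lambda>_. PiM \<B> (\<lambda>_. cs))) R"
  shows "prob {\<omega> \<in> space M. Q (\<lambda>B\<in>\<B>. ecount (Nm a \<omega>) B) \<and> R (\<lambda>c\<in>C. \<lambda>B\<in>\<B>. ecount (Nm c \<omega>) B)} =
    prob {\<omega> \<in> space M. Q (\<lambda>B\<in>\<B>. ecount (Nm a \<omega>) B)} *
    prob {\<omega> \<in> space M. R (\<lambda>c\<in>C. \<lambda>B\<in>\<B>. ecount (Nm c \<omega>) B)}"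
proof -
  let ?V = "\<lambda>c \<omega>. \<lambda>B\<in>\<B>. ecount (Nm c \<omega>) B"
  let ?P = "PiM \<B> (\<lambda>_. cs)"
  have "indep_vars (\<lambda>_. ?P) ?V (insert a C)"
    using assms by (intro indep_vars_ecount_vectors) auto
  then have "indep_var (PiM {a} (\<lambda>_. ?P)) (\<lambda>\<omega>. restrict (\<lambda>c. ?V c \<omega>) {a})
      (PiM C (\<lambda>_. ?P)) (\<lambda>\<omega>. restrict (\<lambda>c. ?V c \<omega>) C)"
    by (rule indep_var_restrict) (use a in auto)
  then have ind: "indep_var (count_space UNIV) ((\<lambda>f. Q (f a)) \<circ> (\<lambda>\<omega>. restrict (\<lambda>c. ?V c \<omega>) {a}))
      (count_space UNIV) (R \<circ> (\<lambda>\<omega>. restrict (\<lambda>c. ?V c \<omega>) C))"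
  proof (rule indep_var_compose)
    show "(\<lambda>f. Q (f a)) \<in> measurable (PiM {a} (\<lambda>_. ?P)) (count_space UNIV)"
      by (rule measurable_compose[OF _ Q]) (rule measurable_component_singleton, simp)
  qed (rule R)
  define X where "X = (\<lambda>\<omega>. Q (?V a \<omega>))"
  define Y where "Y = (\<lambda>\<omega>. R (\<lambda>c\<in>C. ?V c \<omega>))"
  have "(\<lambda>f. Q (f a)) \<circ> (\<lambda>\<omega>. restrict (\<lambda>c. ?V c \<omega>) {a}) = X"
    "R \<circ> (\<lambda>\<omega>. restrict (\<lambda>c. ?V c \<omega>) C) = Y"
    by (simp_all add: X_def Y_def fun_eq_iff)
  with ind have ind: "indep_var (count_space UNIV) X (count_space UNIV) Y" by simp
  have "prob ((\<lambda>\<omega>. (X \<omega>, Y \<omega>)) -` ({True} \<times> {True}) \<inter> space M) =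
     prob (X -` {True} \<inter> space M) * prob (Y -` {True} \<inter> space M)"
    by (rule indep_varD[OF ind]) auto
  moreover have "(\<lambda>\<omega>. (X \<omega>, Y \<omega>)) -` ({True} \<times> {True}) \<inter> space M = {\<omega> \<in> space M. X \<omega> \<and> Y \<omega>}"
    "X -` {True} \<inter> space M = {\<omega> \<in> space M. X \<omega>}"
    "Y -` {True} \<inter> space M = {\<omega> \<in> space M. Y \<omega>}" by auto
  ultimately have "prob {\<omega> \<in> space M. X \<omega> \<and> Y \<omega>} = prob {\<omega> \<in> space M. X \<omega>} * prob {\<omega> \<in> space M. Y \<omega>}"
    by simp
  then show ?thesis by (simp only: X_def Y_def)
qed

end

section \<open>Time windows read backwards from a fixed instant\<close>

lemma gap_above:
  fixes T :: "real set"
  assumes "finite T"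
  shows "\<exists>\<delta>>0. \<forall>x\<in>T. r < x \<longrightarrow> r + \<delta> < x"
proof -
  \<comment> \<open>Half the distance to the next point makes the inequality strict; the 1 keeps
    \<open>F\<close> nonempty when no point lies above \<open>r\<close>.\<close>
  define F where "F = insert 1 ((\<lambda>x. (x - r) / 2) ` {x\<in>T. r < x})"
  have F: "finite F" "F \<noteq> {}" "\<And>x. x \<in> F \<Longrightarrow> 0 < x" using assms by (auto simp: F_def)
  have "0 < Min F" using F by simp
  moreover have "r + Min F < x" if "x \<in> T" "r < x" for x
  proof -
    have "Min F \<le> (x - r) / 2" using F(1) that by (intro Min_le) (auto simp: F_def)
    then show ?thesis using that by (simp add: field_simps)
  qed
  ultimately show ?thesis by blast
qed

text \<open>Time is read backwards from \<open>t\<close>; once \<open>[0, t)\<close> is used up, the window continues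
  after \<open>t\<close>, so that it has length \<open>r\<close> for every \<open>r\<close>.\<close>
definition age :: "real \<Rightarrow> real \<Rightarrow> real" where
  "age t u = (if u < t then t - u else u)"

definition window :: "real \<Rightarrow> real \<Rightarrow> real set" where
  "window t r = {u. 0 \<le> u \<and> u \<noteq> t \<and> age t u \<le> r}"

text \<open>This holds at \<open>t = 0\<close> as well because \<open>window\<close> leaves out the
  instant \<open>t\<close>, which has length zero anyway.\<close>

lemma window_0: "0 \<le> t \<Longrightarrow> window t 0 = {}"
  by (auto simp: window_def age_def)

lemma window_mono: "r \<le> r' \<Longrightarrow> window t r \<subseteq> window t r'"
  by (auto simp: window_def)

lemma window_eq:
  assumes "0 \<le> t" "0 \<le> r"
  shows "window t r = {max 0 (t - r)..<t} \<union> {t<..r}"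
  using assms by (auto simp: window_def age_def)

lemma sets_window [measurable]: "0 \<le> t \<Longrightarrow> 0 \<le> r \<Longrightarrow> window t r \<in> sets borel"
  by (simp add: window_eq)

lemma window_subset: "0 \<le> t \<Longrightarrow> window t r \<subseteq> {0..max t r}"
  by (auto simp: window_def age_def split: if_splits)

text \<open>Reading backwards to 0 and then forwards from \<open>t\<close> rearranges the half-line
  without changing lengths, so the length is \<open>r\<close> whether or not 0 has been
  reached.\<close>

lemma emeasure_window:
  assumes "0 \<le> t" "0 \<le> r"
  shows "emeasure lborel (window t r) = ennreal r"
proof -
  have "emeasure lborel (window t r) = emeasure lborel {max 0 (t - r)..<t} + emeasure lborel {t<..r}"
    unfolding window_eq[OF assms] by (rule plus_emeasure[symmetric]) auto
  also have "\<dots> = ennreal r"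
    using assms by (cases "r \<le> t") (auto simp flip: ennreal_plus)
  finally show ?thesis .
qed

lemma emeasure_window_diff:
  assumes "0 \<le> t" "0 \<le> r" "r \<le> r'"
  shows "emeasure lborel (window t r' - window t r) = ennreal (r' - r)"
  using assms emeasure_Diff[of lborel "window t r" "window t r'"] window_mono[of r r' t]
  by (simp add: emeasure_window ennreal_minus)

lemma test_set_window_diff:
  assumes "0 \<le> t" "0 \<le> r" "r \<le> r'" "0 \<le> h"
  shows "test_set ((window t r' - window t r) \<times> {0..h})"
proof (rule test_set_Times)
  show "window t r' - window t r \<in> sets borel" using assms by (intro sets.Diff sets_window) auto
  show "window t r' - window t r \<subseteq> {0..}" by (auto simp: window_def)
  show "emeasure lborel (window t r' - window t r) < \<infinity>" using assms by (simp add: emeasure_window_diff)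
qed (auto simp: emeasure_lborel_Icc_eq)

lemma test_set_window:
  assumes "0 \<le> t" "0 \<le> r" "0 \<le> h"
  shows "test_set (window t r \<times> {0..h})"
  using test_set_window_diff[of t 0 r h] assms by (simp add: window_0)

lemma measure_window_diff_Times:
  assumes "0 \<le> t" "0 \<le> r" "r \<le> r'" "0 \<le> h"
  shows "measure lborel ((window t r' - window t r) \<times> {0..h}) = (r' - r) * h"
proof -
  have "window t r' - window t r \<in> sets borel" using assms by (intro sets.Diff sets_window) auto
  moreover have "measure lborel (window t r' - window t r) = r' - r"
    using assms by (simp add: measure_def emeasure_window_diff)
  ultimately show ?thesis using assms by (simp add: measure_lborel_Times)
qed

section \<open>The Poisson process of low atoms of the other actors\<close>

text \<open>The factor \<open>k\<close> cancels against the factorial, which shifts the exponential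
  series by one index.\<close>

lemma poisson_mean:
  "(\<lambda>k. real k * (exp (- m) * m ^ k / fact k)) sums (m :: real)"
proof -
  have "(\<lambda>k. (m * exp (- m)) * (m ^ k /\<^sub>R fact k)) sums ((m * exp (- m)) * exp m)"
    by (intro sums_mult exp_converges)
  moreover have "(m * exp (- m)) * exp m = m" by (simp add: exp_minus)
  moreover have "(m * exp (- m)) * (m ^ k /\<^sub>R fact k) = real (Suc k) * (exp (- m) * m ^ Suc k / fact (Suc k))" for k
    by (simp add: divide_simps)
  ultimately have "(\<lambda>k. real (Suc k) * (exp (- m) * m ^ Suc k / fact (Suc k))) sums m"
    by (simp only:)
  then show ?thesis by (subst (asm) sums_Suc_iff) simp
qed

text \<open>Each actor has its own strip height, so that the total rate \<open>sum H C\<close> can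
  be tuned; \<open>G\<close> collects outcomes with regular atoms.\<close>

locale prm_strips = prm +
  fixes a :: nat and C :: "nat set" and H :: "nat \<Rightarrow> real" and t :: real and G :: "'a set"
  assumes a: "a \<in> I" "a \<notin> C" and C: "finite C" "C \<subseteq> I"
    and H: "\<And>c. 0 \<le> H c" and t: "0 \<le> t"
    and G: "G \<in> events" "prob G = 1" "\<And>\<omega>. \<omega> \<in> G \<Longrightarrow> good_atoms I t (\<lambda>c. Nm c \<omega>)"
begin

text \<open>Off the event \<open>G\<close> the process is put to zero: there the atoms may accumulate, and
  \<^const>\<open>Zlag\<close> need not be measurable.\<close>
definition strip_process :: "real \<Rightarrow> 'a \<Rightarrow> nat" where
  "strip_process r \<omega> = (if 0 \<le> r \<and> \<omega> \<in> G then \<Sum>c\<in>C. card (Nm c \<omega> \<inter> window t r \<times> {0..H c}) else 0)"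

lemma AE_G: "AE \<omega> in M. \<omega> \<in> G"
  using G(2) by (rule AE_prob_1)

lemma test_set_strip: "0 \<le> r \<Longrightarrow> test_set (window t r \<times> {0..H c})"
  using t H by (intro test_set_window)

lemma finite_strip: "\<omega> \<in> G \<Longrightarrow> c \<in> C \<Longrightarrow> finite (Nm c \<omega> \<inter> window t r \<times> {0..H c})"
proof (rule good_atoms_finite[where S="\<lambda>c. Nm c \<omega>", OF G(3)])
  show "window t r \<times> {0..H c} \<subseteq> {..max (max t r) (H c)} \<times> {..max (max t r) (H c)}"
    using window_subset[OF t, of r] by fastforce
qed (use C in auto)

lemma measurable_strip_process: "0 \<le> r \<Longrightarrow> strip_process r \<in> measurable M (count_space UNIV)"
proof -
  assume r: "0 \<le> r"
  have "(\<lambda>\<omega>. \<Sum>c\<in>C. card (Nm c \<omega> \<inter> window t r \<times> {0..H c})) \<in> measurable M (count_space UNIV)"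
    using C test_set_strip[OF r] by (intro measurable_sum_countable measurable_card_atoms) auto
  then have "(\<lambda>\<omega>. if \<omega> \<in> G then \<Sum>c\<in>C. card (Nm c \<omega> \<inter> window t r \<times> {0..H c}) else 0)
      \<in> measurable M (count_space UNIV)"
    using G(1) by (intro measurable_If_set) auto
  with r show ?thesis by (simp add: strip_process_def[abs_def])
qed

lemma strip_process_0: "strip_process 0 \<omega> = 0"
  by (simp add: strip_process_def window_0[OF t])

lemma mono_strip_process: "mono_on {0..} (\<lambda>r. strip_process r \<omega>)"
proof (rule mono_onI)
  fix r r' :: real assume "r \<in> {0..}" "r \<le> r'"
  then show "strip_process r \<omega> \<le> strip_process r' \<omega>"
    using window_mono[of r r' t] finite_strip[of \<omega> _ r']
    by (auto simp: strip_process_def intro!: sum_mono card_mono)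
qed

text \<open>Windows are closed at their age bound, and only finitely many relevant atoms have age at
  most \<open>r + 1\<close>, so no new atom enters immediately after \<open>r\<close>.\<close>

lemma strip_process_right_continuous:
  assumes r: "0 \<le> r"
  shows "\<exists>\<delta>>0. \<forall>r'\<in>{r..r + \<delta>}. strip_process r' \<omega> = strip_process r \<omega>"
proof (cases "\<omega> \<in> G")
  case True
  define T where "T = (\<lambda>x. age t (fst x)) ` (\<Union>c\<in>C. Nm c \<omega> \<inter> window t (r + 1) \<times> {0..H c})"
  have "finite T" unfolding T_def using finite_strip[OF True] C(1) by blast
  then obtain \<delta> where \<delta>: "0 < \<delta>" "\<forall>x\<in>T. r < x \<longrightarrow> r + \<delta> < x" using gap_above by blast
  \<comment> \<open>The cap 1 keeps \<open>r'\<close> inside the range of ages collected in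
    \<open>T\<close>.\<close>
  have eq: "strip_process r' \<omega> = strip_process r \<omega>" if r': "r' \<in> {r..r + min \<delta> 1}" for r'
  proof -
    have "Nm c \<omega> \<inter> window t r' \<times> {0..H c} = Nm c \<omega> \<inter> window t r \<times> {0..H c}" if c: "c \<in> C" for c
    proof
      show "Nm c \<omega> \<inter> window t r \<times> {0..H c} \<subseteq> Nm c \<omega> \<inter> window t r' \<times> {0..H c}"
        using window_mono[of r r' t] r' by auto
      show "Nm c \<omega> \<inter> window t r' \<times> {0..H c} \<subseteq> Nm c \<omega> \<inter> window t r \<times> {0..H c}"
      proof
        fix x assume x: "x \<in> Nm c \<omega> \<inter> window t r' \<times> {0..H c}"
        moreover have "window t r' \<subseteq> window t (r + 1)" using r' by (intro window_mono) auto
        ultimately have "age t (fst x) \<in> T" using c unfolding T_def by blast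
        moreover have "age t (fst x) \<le> r + \<delta>" using x r' by (auto simp: window_def)
        ultimately have "age t (fst x) \<le> r" using \<delta>(2) by fastforce
        then show "x \<in> Nm c \<omega> \<inter> window t r \<times> {0..H c}" using x by (auto simp: window_def)
      qed
    qed
    then show ?thesis using r r' by (simp add: strip_process_def)
  qed
  show ?thesis
  proof (intro exI conjI ballI)
    show "0 < min \<delta> 1" using \<delta>(1) by simp
  qed (rule eq)
qed (auto simp: strip_process_def intro: exI[of _ 1])

lemma strip_process_increment:
  assumes "\<omega> \<in> G" "0 \<le> r" "r \<le> r'"
  shows "strip_process r' \<omega> - strip_process r \<omega> =
    (\<Sum>c\<in>C. card (Nm c \<omega> \<inter> (window t r' - window t r) \<times> {0..H c}))"
proof -
  have "(\<Sum>c\<in>C. card (Nm c \<omega> \<inter> window t r' \<times> {0..H c})) =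
    (\<Sum>c\<in>C. card (Nm c \<omega> \<inter> window t r \<times> {0..H c}) + card (Nm c \<omega> \<inter> (window t r' - window t r) \<times> {0..H c}))"
  proof (rule sum.cong[OF refl])
    fix c assume c: "c \<in> C"
    have eq: "Nm c \<omega> \<inter> window t r' \<times> {0..H c} =
      (Nm c \<omega> \<inter> window t r \<times> {0..H c}) \<union> (Nm c \<omega> \<inter> (window t r' - window t r) \<times> {0..H c})"
      using window_mono[OF assms(3), of t] by auto
    show "card (Nm c \<omega> \<inter> window t r' \<times> {0..H c}) =
      card (Nm c \<omega> \<inter> window t r \<times> {0..H c}) + card (Nm c \<omega> \<inter> (window t r' - window t r) \<times> {0..H c})"
      unfolding eq
    proof (rule card_Un_disjoint)
      show "finite (Nm c \<omega> \<inter> window t r \<times> {0..H c})" by (rule finite_strip[OF assms(1) c])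
      show "finite (Nm c \<omega> \<inter> (window t r' - window t r) \<times> {0..H c})"
        by (rule finite_subset[OF _ finite_strip[OF assms(1) c, of r']]) auto
    qed auto
  qed
  then show ?thesis using assms by (simp add: strip_process_def sum.distrib)
qed

lemma test_set_strip_diff:
  "0 \<le> r \<Longrightarrow> r \<le> r' \<Longrightarrow> test_set ((window t r' - window t r) \<times> {0..H c})"
  using t H by (intro test_set_window_diff)

text \<open>On \<open>G\<close> the increment counts the atoms in the strips over the ring between
  the two windows, a sum of independent Poisson counts with means
  \<open>(r' - r) * H c\<close>.\<close>

lemma prob_strip_process_increment:
  assumes "0 \<le> r" "r \<le> r'"
  shows "prob {\<omega> \<in> space M. strip_process r' \<omega> - strip_process r \<omega> = k} =
    exp (- (sum H C * (r' - r))) * (sum H C * (r' - r)) ^ k / fact k"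
proof -
  let ?B = "\<lambda>c. (window t r' - window t r) \<times> {0..H c}"
  have "prob {\<omega> \<in> space M. (\<Sum>c\<in>C. card (Nm c \<omega> \<inter> ?B c)) = k} =
     exp (- (\<Sum>c\<in>C. (r' - r) * H c)) * (\<Sum>c\<in>C. (r' - r) * H c) ^ k / fact k"
  proof (rule prob_sum_poisson[OF C(1)])
    have "indep_vars (\<lambda>_. cs) (\<lambda>c \<omega>. ecount (Nm c \<omega>) (?B c)) C"
      using C test_set_strip_diff[OF assms] by (intro indep_vars_ecount) auto
    then have "indep_vars (\<lambda>_. count_space UNIV) (\<lambda>c \<omega>. fin_enat (ecount (Nm c \<omega>) (?B c))) C"
      by (rule indep_vars_compose2) simp
    then show "indep_vars (\<lambda>_. count_space UNIV) (\<lambda>c \<omega>. card (Nm c \<omega> \<inter> ?B c)) C"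
      by (simp only: fin_enat_ecount)
    fix c k assume "c \<in> C"
    then show "prob {\<omega> \<in> space M. card (Nm c \<omega> \<inter> ?B c) = k} =
      exp (- ((r' - r) * H c)) * ((r' - r) * H c) ^ k / fact k"
      using prob_card_atoms[of c "?B c" k] C test_set_strip_diff[OF assms]
        measure_window_diff_Times[OF t assms H] by auto
  qed
  also have "(\<Sum>c\<in>C. (r' - r) * H c) = sum H C * (r' - r)"
    by (simp add: sum_distrib_left mult.commute)
  finally have 1: "prob {\<omega> \<in> space M. (\<Sum>c\<in>C. card (Nm c \<omega> \<inter> ?B c)) = k} =
    exp (- (sum H C * (r' - r))) * (sum H C * (r' - r)) ^ k / fact k" .
  have "prob {\<omega> \<in> space M. strip_process r' \<omega> - strip_process r \<omega> = k} =
    prob {\<omega> \<in> space M. (\<Sum>c\<in>C. card (Nm c \<omega> \<inter> ?B c)) = k}"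
  proof (rule measure_eq_AE)
    show "AE \<omega> in M. (\<omega> \<in> {\<omega> \<in> space M. strip_process r' \<omega> - strip_process r \<omega> = k}) =
      (\<omega> \<in> {\<omega> \<in> space M. (\<Sum>c\<in>C. card (Nm c \<omega> \<inter> ?B c)) = k})"
      using AE_G by (rule AE_mp) (rule AE_I2, simp add: strip_process_increment[OF _ assms])
    have m: "strip_process r \<in> measurable M (count_space UNIV)" "strip_process r' \<in> measurable M (count_space UNIV)"
      using assms by (auto intro: measurable_strip_process)
    have "(\<lambda>\<omega>. strip_process r' \<omega> - strip_process r \<omega>) \<in> measurable M (count_space UNIV)"
      by (rule measurable_compose_countable[where f="\<lambda>n \<omega>. n - strip_process r \<omega>" and g="strip_process r'", OF _ m(2)])
         (rule measurable_compose[OF m(1)], simp)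
    from measurable_sets[OF this, of "{k}"]
    show "{\<omega> \<in> space M. strip_process r' \<omega> - strip_process r \<omega> = k} \<in> events"
      by (simp add: vimage_def Int_def conj_commute)
    have "(\<lambda>\<omega>. \<Sum>c\<in>C. card (Nm c \<omega> \<inter> ?B c)) \<in> measurable M (count_space UNIV)"
      using C test_set_strip_diff[OF assms] by (intro measurable_sum_countable measurable_card_atoms) auto
    from measurable_sets[OF this, of "{k}"]
    show "{\<omega> \<in> space M. (\<Sum>c\<in>C. card (Nm c \<omega> \<inter> ?B c)) = k} \<in> events"
      by (simp add: vimage_def Int_def conj_commute)
  qed
  with 1 show ?thesis by simp
qed

text \<open>Rings between consecutive windows are disjoint and different actors are independent, so
  the counts indexed by ring and actor are jointly independent. Grouping them by ring gives the
  increments, up to the null set off \<open>G\<close>.\<close>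

lemma indep_strip_process_increments:
  fixes ts :: "nat \<Rightarrow> real"
  assumes "0 \<le> ts 0" "\<And>i. ts i \<le> ts (Suc i)"
  shows "indep_vars (\<lambda>_. count_space UNIV) (\<lambda>i \<omega>. strip_process (ts (Suc i)) \<omega> - strip_process (ts i) \<omega>) {..<n}"
proof -
  have mono: "ts i \<le> ts j" if "i \<le> j" for i j using lift_Suc_mono_le[of ts, OF assms(2) that] .
  have nn: "0 \<le> ts i" for i using mono[of 0 i] assms(1) by simp
  let ?B = "\<lambda>i c. (window t (ts (Suc i)) - window t (ts i)) \<times> {0..H c}"
  have ts_diff: "test_set (?B i c)" for i c using test_set_strip_diff nn assms(2) .
  have ind: "indep_vars (\<lambda>_. cs) (\<lambda>j \<omega>. ecount (Nm (snd j) \<omega>) (?B (fst j) (snd j))) ({..<n} \<times> C)"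
  proof (rule indep_vars_ecount)
    fix i j :: "nat \<times> nat" assume "i \<noteq> j" "snd i = snd j"
    then have "fst i \<noteq> fst j" by (auto simp: prod_eq_iff)
    moreover have "?B k c \<inter> ?B l d = {}" if "k < l" for k l c d
      using window_mono[OF mono[of "Suc k" l], of t] that by fastforce
    ultimately show "?B (fst i) (snd i) \<inter> ?B (fst j) (snd j) = {}"
      by (cases "fst i" "fst j" rule: linorder_cases) (simp, simp, blast)
  qed (use C ts_diff in auto)
  define K where "K i = {i} \<times> C" for i :: nat
  have "indep_vars (\<lambda>i. PiM (K i) (\<lambda>_. cs))
      (\<lambda>i \<omega>. restrict (\<lambda>j. ecount (Nm (snd j) \<omega>) (?B (fst j) (snd j))) (K i)) {..<n}"
    by (rule indep_vars_restrict[OF ind]) (auto simp: K_def disjoint_family_on_def)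
  then have "indep_vars (\<lambda>_. count_space UNIV)
      (\<lambda>i \<omega>. (\<lambda>f. \<Sum>c\<in>C. fin_enat (f (i, c)))
        (restrict (\<lambda>j. ecount (Nm (snd j) \<omega>) (?B (fst j) (snd j))) (K i))) {..<n}"
  proof (rule indep_vars_compose2)
    fix i
    show "(\<lambda>f. \<Sum>c\<in>C. fin_enat (f (i, c))) \<in> measurable (PiM (K i) (\<lambda>_. cs)) (count_space UNIV)"
    proof (rule measurable_sum_countable)
      fix c assume "c \<in> C"
      then have "(i, c) \<in> K i" by (simp add: K_def)
      then have "(\<lambda>f. f (i, c)) \<in> measurable (PiM (K i) (\<lambda>_. cs)) cs"
        by (rule measurable_component_singleton)
      then show "(\<lambda>f. fin_enat (f (i, c))) \<in> measurable (PiM (K i) (\<lambda>_. cs)) (count_space UNIV)"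
        by (rule measurable_compose) simp
    qed
  qed
  then show ?thesis
  proof (rule indep_vars_cong_AE)
    fix i
    have m: "strip_process (ts i) \<in> measurable M (count_space UNIV)"
      "strip_process (ts (Suc i)) \<in> measurable M (count_space UNIV)"
      using nn by (auto intro: measurable_strip_process)
    show "(\<lambda>\<omega>. strip_process (ts (Suc i)) \<omega> - strip_process (ts i) \<omega>) \<in> measurable M (count_space UNIV)"
      by (rule measurable_compose_countable[where f="\<lambda>n \<omega>. n - strip_process (ts i) \<omega>" and g="strip_process (ts (Suc i))", OF _ m(2)])
         (rule measurable_compose[OF m(1)], simp)
  next
    show "AE \<omega> in M. \<forall>i\<in>{..<n}. (\<lambda>f. \<Sum>c\<in>C. fin_enat (f (i, c)))
        (restrict (\<lambda>j. ecount (Nm (snd j) \<omega>) (?B (fst j) (snd j))) (K i)) =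
       strip_process (ts (Suc i)) \<omega> - strip_process (ts i) \<omega>"
      using AE_G
    proof (rule AE_mp, intro AE_I2 impI ballI)
      fix \<omega> i assume "\<omega> \<in> G"
      then show "(\<lambda>f. \<Sum>c\<in>C. fin_enat (f (i, c)))
        (restrict (\<lambda>j. ecount (Nm (snd j) \<omega>) (?B (fst j) (snd j))) (K i)) =
       strip_process (ts (Suc i)) \<omega> - strip_process (ts i) \<omega>"
        using strip_process_increment[OF _ nn assms(2)] by (simp add: K_def fin_enat_ecount)
    qed
  qed
qed

lemma poisson_process_strip_process: "poisson_process M (sum H C) strip_process"
  unfolding poisson_process_def
proof (intro conjI allI impI ballI)
  show "strip_process r \<in> measurable M (count_space UNIV)" if "0 \<le> r" for r
    by (rule measurable_strip_process[OF that])
  show "strip_process 0 \<omega> = 0" for \<omega> by (rule strip_process_0)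
  show "mono_on {0..} (\<lambda>r. strip_process r \<omega>)" for \<omega> by (rule mono_strip_process)
  show "\<exists>\<delta>>0. \<forall>r'\<in>{r..r + \<delta>}. strip_process r' \<omega> = strip_process r \<omega>" if "0 \<le> r" for r \<omega>
    by (rule strip_process_right_continuous[OF that])
  show "prob {\<omega> \<in> space M. strip_process r' \<omega> - strip_process r \<omega> = k} =
    exp (- (sum H C * (r' - r))) * (sum H C * (r' - r)) ^ k / fact k" if "0 \<le> r" "r \<le> r'" for r r' k
    by (rule prob_strip_process_increment[OF that])
  show "indep_vars (\<lambda>_. count_space UNIV) (\<lambda>i \<omega>. strip_process (ts (Suc i)) \<omega> - strip_process (ts i) \<omega>) {..<n}"
    if "0 \<le> ts 0" "\<forall>i. ts i \<le> ts (Suc i)" for ts n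
    by (rule indep_strip_process_increments) (use that in auto)
qed

text \<open>Both sigma-algebras are generated by intersection-stable families of finite-dimensional
  events, so independence is tested on these. There the process is almost surely a function of
  counts of the actors in \<open>C\<close>, which are independent of those of
  \<open>a\<close>.\<close>

lemma indep_strip_process: "indep_of_prm M strip_process (Nm a)"
proof -
  define E1 where "E1 = (\<lambda>L. {\<omega> \<in> space M. \<forall>p\<in>L. strip_process (fst p) \<omega> \<in> snd p}) ` {L. finite L \<and> L \<subseteq> {0..} \<times> UNIV}"
  define E2 where "E2 = (\<lambda>L. {\<omega> \<in> space M. \<forall>p\<in>L. ecount (Nm a \<omega>) (fst p) \<in> snd p}) ` {L. finite L \<and> (\<forall>p\<in>L. test_set (fst p))}"
  have Int1: "Int_stable E1"
  proof (rule Int_stableI)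
    fix X Y assume "X \<in> E1" "Y \<in> E1"
    then obtain K L where
      K: "finite K" "K \<subseteq> {0..} \<times> UNIV" "X = {\<omega> \<in> space M. \<forall>p\<in>K. strip_process (fst p) \<omega> \<in> snd p}" and
      L: "finite L" "L \<subseteq> {0..} \<times> UNIV" "Y = {\<omega> \<in> space M. \<forall>p\<in>L. strip_process (fst p) \<omega> \<in> snd p}"
      unfolding E1_def by blast
    have "X \<inter> Y = {\<omega> \<in> space M. \<forall>p\<in>K \<union> L. strip_process (fst p) \<omega> \<in> snd p}" using K L by blast
    moreover have "K \<union> L \<in> {L. finite L \<and> L \<subseteq> {0..} \<times> UNIV}" using K L by blast
    ultimately show "X \<inter> Y \<in> E1" unfolding E1_def by blast
  qed
  have Int2: "Int_stable E2"
  proof (rule Int_stableI)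
    fix X Y assume "X \<in> E2" "Y \<in> E2"
    then obtain K L where
      K: "finite K" "\<forall>p\<in>K. test_set (fst p)" "X = {\<omega> \<in> space M. \<forall>p\<in>K. ecount (Nm a \<omega>) (fst p) \<in> snd p}" and
      L: "finite L" "\<forall>p\<in>L. test_set (fst p)" "Y = {\<omega> \<in> space M. \<forall>p\<in>L. ecount (Nm a \<omega>) (fst p) \<in> snd p}"
      unfolding E2_def by blast
    have "X \<inter> Y = {\<omega> \<in> space M. \<forall>p\<in>K \<union> L. ecount (Nm a \<omega>) (fst p) \<in> snd p}" using K L by blast
    moreover have "K \<union> L \<in> {L. finite L \<and> (\<forall>p\<in>L. test_set (fst p))}" using K L by blast
    ultimately show "X \<inter> Y \<in> E2" unfolding E2_def by blast
  qed
  have ev1: "{\<omega> \<in> space M. \<forall>p\<in>L. strip_process (fst p) \<omega> \<in> snd p} \<in> events"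
    if "finite L" "L \<subseteq> {0..} \<times> UNIV" for L
  proof (rule sets.sets_Collect_finite_All[OF _ that(1)])
    fix p assume "p \<in> L"
    then have "0 \<le> fst p" using that(2) by auto
    from measurable_sets[OF measurable_strip_process[OF this], of "snd p"]
    show "{\<omega> \<in> space M. strip_process (fst p) \<omega> \<in> snd p} \<in> events"
      by (simp add: vimage_def Int_def conj_commute)
  qed
  have ev2: "{\<omega> \<in> space M. \<forall>p\<in>L. ecount (Nm a \<omega>) (fst p) \<in> snd p} \<in> events"
    if "finite L" "\<forall>p\<in>L. test_set (fst p)" for L
    by (rule sets.sets_Collect_finite_All[OF _ that(1)]) (rule sets_ecount[OF a(1)], use that(2) in blast)
  have ind: "prob ({\<omega> \<in> space M. \<forall>p\<in>L. strip_process (fst p) \<omega> \<in> snd p} \<inter>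
        {\<omega> \<in> space M. \<forall>p\<in>K. ecount (Nm a \<omega>) (fst p) \<in> snd p}) =
      prob {\<omega> \<in> space M. \<forall>p\<in>L. strip_process (fst p) \<omega> \<in> snd p} *
      prob {\<omega> \<in> space M. \<forall>p\<in>K. ecount (Nm a \<omega>) (fst p) \<in> snd p}" (is "prob (?X \<inter> ?Y) = _")
    if L: "finite L" "L \<subseteq> {0..} \<times> UNIV" and K: "finite K" "\<forall>p\<in>K. test_set (fst p)" for L K
  proof -
    \<comment> \<open>One collection of regions for both sides, since
      \<open>prob_indep_atoms\<close> takes the same \<open>\<B>\<close> for all actors.\<close>
    define \<B> where "\<B> = fst ` K \<union> (\<lambda>(r, c). window t r \<times> {0..H c}) ` (fst ` L \<times> C)"
    define Q where "Q f \<longleftrightarrow> (\<forall>p\<in>K. f (fst p) \<in> snd p)" for f :: "(real \<times> real) set \<Rightarrow> enat"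
    define R where "R f \<longleftrightarrow> (\<forall>p\<in>L. (\<Sum>c\<in>C. fin_enat (f c (window t (fst p) \<times> {0..H c}))) \<in> snd p)"
      for f :: "nat \<Rightarrow> (real \<times> real) set \<Rightarrow> enat"
    let ?V = "\<lambda>c \<omega>. \<lambda>B\<in>\<B>. ecount (Nm c \<omega>) B"
    have fin\<B>: "finite \<B>" using L K C by (simp add: \<B>_def)
    have ts\<B>: "test_set B" if "B \<in> \<B>" for B
    proof -
      have "0 \<le> r" if "r \<in> fst ` L" for r using that L(2) by auto
      then show ?thesis using \<open>B \<in> \<B>\<close> K(2) test_set_strip unfolding \<B>_def by auto
    qed
    have in\<B>: "fst p \<in> \<B>" if "p \<in> K" for p using that by (simp add: \<B>_def)
    have in\<B>': "window t (fst p) \<times> {0..H c} \<in> \<B>" if "p \<in> L" "c \<in> C" for p c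
    proof -
      have "(fst p, c) \<in> fst ` L \<times> C" using that by simp
      then have "(\<lambda>(r, c). window t r \<times> {0..H c}) (fst p, c) \<in> \<B>" unfolding \<B>_def by (intro UnI2 imageI)
      then show ?thesis by simp
    qed
    have mQ: "Measurable.pred (PiM \<B> (\<lambda>_. cs)) Q"
      unfolding Q_def[abs_def]
    proof (rule pred_intros_finite(3)[OF K(1)])
      fix p assume "p \<in> K"
      then have "(\<lambda>f. f (fst p)) \<in> measurable (PiM \<B> (\<lambda>_. cs)) cs"
        by (intro measurable_component_singleton in\<B>)
      then show "Measurable.pred (PiM \<B> (\<lambda>_. cs)) (\<lambda>f. f (fst p) \<in> snd p)"
        by (rule measurable_compose) simp
    qed
    have mR: "Measurable.pred (PiM C (\<lambda>_. PiM \<B> (\<lambda>_. cs))) R"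
      unfolding R_def[abs_def]
    proof (rule pred_intros_finite(3)[OF L(1)])
      fix p assume p: "p \<in> L"
      have "(\<lambda>f. \<Sum>c\<in>C. fin_enat (f c (window t (fst p) \<times> {0..H c})))
          \<in> measurable (PiM C (\<lambda>_. PiM \<B> (\<lambda>_. cs))) (count_space UNIV)"
      proof (rule measurable_sum_countable)
        fix c assume c: "c \<in> C"
        have "(\<lambda>f. f c) \<in> measurable (PiM C (\<lambda>_. PiM \<B> (\<lambda>_. cs))) (PiM \<B> (\<lambda>_. cs))"
          using c by (rule measurable_component_singleton)
        moreover have "(\<lambda>g. g (window t (fst p) \<times> {0..H c})) \<in> measurable (PiM \<B> (\<lambda>_. cs)) cs"
          by (intro measurable_component_singleton in\<B>' p c)
        ultimately have "(\<lambda>f. f c (window t (fst p) \<times> {0..H c})) \<in> measurable (PiM C (\<lambda>_. PiM \<B> (\<lambda>_. cs))) cs"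
          by (rule measurable_compose)
        then show "(\<lambda>f. fin_enat (f c (window t (fst p) \<times> {0..H c})))
           \<in> measurable (PiM C (\<lambda>_. PiM \<B> (\<lambda>_. cs))) (count_space UNIV)"
          by (rule measurable_compose) simp
      qed
      then show "Measurable.pred (PiM C (\<lambda>_. PiM \<B> (\<lambda>_. cs)))
          (\<lambda>f. (\<Sum>c\<in>C. fin_enat (f c (window t (fst p) \<times> {0..H c}))) \<in> snd p)"
        by (rule measurable_compose) simp
    qed
    have Y: "?Y = {\<omega> \<in> space M. Q (?V a \<omega>)}"
      using in\<B> by (auto simp: Q_def)
    \<comment> \<open>The event \<open>?X\<close> without the truncation off \<open>G\<close>: it
      depends on atom counts alone and differs from \<open>?X\<close> by a null set.\<close>
    define X' where "X' = {\<omega> \<in> space M. R (\<lambda>c\<in>C. ?V c \<omega>)}"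
    have X'_iff: "R (\<lambda>c\<in>C. ?V c \<omega>) \<longleftrightarrow> (\<forall>p\<in>L. (\<Sum>c\<in>C. card (Nm c \<omega> \<inter> window t (fst p) \<times> {0..H c})) \<in> snd p)" for \<omega>
      using in\<B>' unfolding R_def fin_enat_ecount[symmetric] by (intro ball_cong refl) (simp cong: sum.cong)
    have X'ev: "X' \<in> events"
      unfolding X'_def X'_iff
    proof (rule sets.sets_Collect_finite_All[OF _ L(1)])
      fix p assume "p \<in> L"
      then have "0 \<le> fst p" using L(2) by auto
      then have "(\<lambda>\<omega>. \<Sum>c\<in>C. card (Nm c \<omega> \<inter> window t (fst p) \<times> {0..H c})) \<in> measurable M (count_space UNIV)"
        using C test_set_strip by (intro measurable_sum_countable measurable_card_atoms) auto
      from measurable_sets[OF this, of "snd p"]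
      show "{\<omega> \<in> space M. (\<Sum>c\<in>C. card (Nm c \<omega> \<inter> window t (fst p) \<times> {0..H c})) \<in> snd p} \<in> events"
        by (simp add: vimage_def Int_def conj_commute)
    qed
    have AE_X: "AE \<omega> in M. \<omega> \<in> ?X \<longleftrightarrow> \<omega> \<in> X'"
      using AE_G
    proof (rule AE_mp, intro AE_I2 impI)
      fix \<omega> assume \<omega>: "\<omega> \<in> space M" "\<omega> \<in> G"
      have "strip_process (fst p) \<omega> = (\<Sum>c\<in>C. card (Nm c \<omega> \<inter> window t (fst p) \<times> {0..H c}))" if "p \<in> L" for p
        using that L(2) \<omega> by (auto simp: strip_process_def)
      then show "\<omega> \<in> ?X \<longleftrightarrow> \<omega> \<in> X'" using \<omega> by (simp add: X'_def X'_iff)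
    qed
    have "prob (?X \<inter> ?Y) = prob (X' \<inter> ?Y)"
      by (rule measure_eq_AE) (use AE_X ev1[OF L] ev2[OF K] X'ev in auto)
    also have "X' \<inter> ?Y = {\<omega> \<in> space M. Q (?V a \<omega>) \<and> R (\<lambda>c\<in>C. ?V c \<omega>)}"
      unfolding Y X'_def by blast
    also have "prob \<dots> = prob ?Y * prob X'"
      unfolding Y X'_def by (rule prob_indep_atoms[OF a C fin\<B> ts\<B> mQ mR])
    also have "prob X' = prob ?X"
      by (rule measure_eq_AE) (use AE_X ev1[OF L] X'ev in auto)
    finally show ?thesis by (simp add: mult.commute)
  qed
  have "indep_set E1 E2"
    unfolding indep_sets2_eq
  proof (intro conjI ballI)
    show "E1 \<subseteq> events" unfolding E1_def using ev1 by blast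
    show "E2 \<subseteq> events" unfolding E2_def using ev2 by blast
    fix X Y assume "X \<in> E1" "Y \<in> E2"
    then show "prob (X \<inter> Y) = prob X * prob Y" unfolding E1_def E2_def using ind by blast
  qed
  then have big: "indep_set (sigma_sets (space M) E1) (sigma_sets (space M) E2)"
    by (rule indep_set_sigma_sets[OF _ Int1 Int2])
  have sub1: "sigma_sets (space M) {strip_process r -` A \<inter> space M | r A. r \<ge> 0} \<subseteq> sigma_sets (space M) E1"
  proof (rule sigma_sets_mono', rule subsetI)
    fix X assume "X \<in> {strip_process r -` A \<inter> space M | r A. r \<ge> 0}"
    then obtain r A where rA: "0 \<le> r" "X = strip_process r -` A \<inter> space M" by blast
    then have "X = {\<omega> \<in> space M. \<forall>p\<in>{(r, A)}. strip_process (fst p) \<omega> \<in> snd p}" by auto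
    moreover have "{(r, A)} \<in> {L. finite L \<and> L \<subseteq> {0..} \<times> UNIV}" using rA by simp
    ultimately show "X \<in> E1" unfolding E1_def by blast
  qed
  have sub2: "sigma_sets (space M) {(\<lambda>\<omega>. ecount (Nm a \<omega>) B) -` A \<inter> space M | B A.
           B \<in> sets (borel :: (real \<times> real) measure) \<and> B \<subseteq> quadrant \<and> emeasure lborel B < \<infinity>} \<subseteq> sigma_sets (space M) E2"
  proof (rule sigma_sets_mono', rule subsetI)
    fix X assume "X \<in> {(\<lambda>\<omega>. ecount (Nm a \<omega>) B) -` A \<inter> space M | B A.
           B \<in> sets (borel :: (real \<times> real) measure) \<and> B \<subseteq> quadrant \<and> emeasure lborel B < \<infinity>}"
    then obtain B A where BA: "test_set B" "X = (\<lambda>\<omega>. ecount (Nm a \<omega>) B) -` A \<inter> space M"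
      unfolding test_set_def by blast
    then have "X = {\<omega> \<in> space M. \<forall>p\<in>{(B, A)}. ecount (Nm a \<omega>) (fst p) \<in> snd p}" by auto
    moreover have "{(B, A)} \<in> {L. finite L \<and> (\<forall>p\<in>L. test_set (fst p))}" using BA by simp
    ultimately show "X \<in> E2" unfolding E2_def by blast
  qed
  show ?thesis
    unfolding indep_of_prm_def indep_sets2_eq
    using big sub1 sub2 unfolding indep_sets2_eq by blast
qed

end

section \<open>The mean number of low atoms since the lowest atom of an actor\<close>

text \<open>\<open>Mgt \<phi>\<close> is monotone, so a level reached before \<open>y\<close> is
  also reached at a rational before \<open>y\<close>; the sublevel sets are countable unions of
  half-lines.\<close>

lemma measurable_Mgt_inv:
  assumes "\<And>r. \<phi> r \<ge> 0"
  shows "Mgt_inv \<phi> \<in> borel_measurable borel"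
proof (rule borel_measurableI_less)
  fix y :: ereal
  have "Mgt_inv \<phi> x < y \<longleftrightarrow> (\<exists>q\<in>\<rat> \<inter> {q. 0 \<le> q \<and> ereal q < y}. x \<le> ereal (Mgt \<phi> q))" for x
  proof
    assume "Mgt_inv \<phi> x < y"
    then obtain r where r: "0 \<le> r" "x \<le> ereal (Mgt \<phi> r)" "ereal r < y"
      unfolding Mgt_inv_def Inf_less_iff by blast
    obtain q where q: "q \<in> \<rat>" "r < q" "ereal q < y" using ereal_less_rat[OF r(3)] .
    have "ereal (Mgt \<phi> r) \<le> ereal (Mgt \<phi> q)" using q monoD[OF mono_Mgt[OF assms], of r q] by simp
    with r(2) have "x \<le> ereal (Mgt \<phi> q)" by (rule order_trans)
    then show "\<exists>q\<in>\<rat> \<inter> {q. 0 \<le> q \<and> ereal q < y}. x \<le> ereal (Mgt \<phi> q)"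
      using q r(1) by (intro bexI[of _ q]) auto
  next
    assume "\<exists>q\<in>\<rat> \<inter> {q. 0 \<le> q \<and> ereal q < y}. x \<le> ereal (Mgt \<phi> q)"
    then show "Mgt_inv \<phi> x < y" unfolding Mgt_inv_def Inf_less_iff by blast
  qed
  then have "{x \<in> space borel. Mgt_inv \<phi> x < y} =
      (\<Union>q\<in>\<rat> \<inter> {q. 0 \<le> q \<and> ereal q < y}. {..ereal (Mgt \<phi> q)})"
    by auto
  also have "\<dots> \<in> sets borel"
    by (rule sets.countable_UN') (auto intro: countable_Int1 countable_rat)
  finally show "{x \<in> space borel. Mgt_inv \<phi> x < y} \<in> sets borel" .
qed

locale prm_lag = prm_strips +
  fixes s :: real
  assumes s: "0 \<le> s" "s < t"
    and some_atom: "\<And>\<omega>. \<omega> \<in> G \<Longrightarrow> Nm a \<omega> \<inter> {s..t} \<times> {0..} \<noteq> {}"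
begin

lemma lowest_atom_G:
  assumes "\<omega> \<in> G"
  obtains \<tau> e where "(\<tau>, e) \<in> Nm a \<omega>" "0 < \<tau>" "s \<le> \<tau>" "\<tau> < t" "0 \<le> e"
    "\<forall>v z. (v, z) \<in> Nm a \<omega> \<longrightarrow> s \<le> v \<longrightarrow> v \<le> t \<longrightarrow> e \<le> z"
    "Eheight Nm a s t \<omega> = ereal e" "Zlag Nm a s t \<omega> = t - \<tau>"
proof -
  obtain \<tau> e where 1: "(\<tau>, e) \<in> Nm a \<omega>" "s \<le> \<tau>" "\<tau> \<le> t" "0 \<le> e"
    "\<forall>v z. (v, z) \<in> Nm a \<omega> \<longrightarrow> s \<le> v \<longrightarrow> v \<le> t \<longrightarrow> e \<le> z"
    "Eheight Nm a s t \<omega> = ereal e" "Zlag Nm a s t \<omega> = t - \<tau>"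
    using lowest_atom[where Nm=Nm and \<omega>=\<omega>, OF G(3)[OF assms] a(1) some_atom[OF assms]] by blast
  have "\<tau> \<noteq> 0" "\<tau> \<noteq> t" using G(3)[OF assms] a(1) 1(1) unfolding good_atoms_def by fastforce+
  then show thesis using that[of \<tau> e] 1 s by auto
qed

text \<open>On \<open>G\<close> the lag lies in \<open>(0, t - s]\<close>, so only thresholds in
  that range matter; there \<open>Zlag_less_iff\<close> at \<open>u = t - y\<close> turns the event
  into a comparison of measurable heights.\<close>

lemma measurable_Zlag: "(\<lambda>\<omega>. if \<omega> \<in> G then Zlag Nm a s t \<omega> else 0) \<in> borel_measurable M"
  unfolding borel_measurable_iff_less
proof
  fix y :: real
  have Z: "0 < Zlag Nm a s t \<omega>" "Zlag Nm a s t \<omega> \<le> t - s" if "\<omega> \<in> G" for \<omega>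
    using lowest_atom_G[OF that] by (metis diff_gt_0_iff_gt, metis diff_left_mono)
  consider "y \<le> 0" | "0 < y" "y \<le> t - s" | "t - s < y" "0 < y" using s by linarith
  then show "{\<omega> \<in> space M. (if \<omega> \<in> G then Zlag Nm a s t \<omega> else 0) < y} \<in> events"
  proof cases
    case 1
    then have "{\<omega> \<in> space M. (if \<omega> \<in> G then Zlag Nm a s t \<omega> else 0) < y} = {}"
      using Z(1) by force
    then show ?thesis by (simp only: sets.empty_sets)
  next
    case 2
    have iff: "Zlag Nm a s t \<omega> < y \<longleftrightarrow> Eheight Nm a s t \<omega> < Eheight Nm a s (t - y) \<omega>" if "\<omega> \<in> G" for \<omega>
      using Zlag_less_iff[where Nm=Nm and \<omega>=\<omega> and u="t - y", OF G(3)[OF that] a(1) some_atom[OF that]] 2 by simp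
    have "{\<omega> \<in> space M. (if \<omega> \<in> G then Zlag Nm a s t \<omega> else 0) < y} =
      (G \<inter> {\<omega> \<in> space M. Eheight Nm a s t \<omega> < Eheight Nm a s (t - y) \<omega>}) \<union> (space M - G)"
      using iff 2 sets.sets_into_space[OF G(1)] by auto
    also have "\<dots> \<in> events"
      using measurable_Eheight[OF a(1) s(1)] G(1) by (intro sets.Un sets.Int sets.Diff borel_measurable_less) auto
    finally show ?thesis .
  next
    case 3
    then have "{\<omega> \<in> space M. (if \<omega> \<in> G then Zlag Nm a s t \<omega> else 0) < y} = space M"
      using Z(2) by force
    then show ?thesis by (simp only: sets.top)
  qed
qed

text \<open>Measurability at fixed times does not settle a random time. By monotone and right
  continuous paths, the level \<open>k\<close> is reached at the lag exactly when it is reached at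
  every rational time after it, a countable intersection.\<close>

lemma measurable_strip_Zlag:
  "(\<lambda>\<omega>. real (strip_process (Zlag Nm a s t \<omega>) \<omega>)) \<in> borel_measurable M"
  unfolding borel_measurable_iff_ge
proof
  fix y :: real
  let ?Z = "\<lambda>\<omega>. if \<omega> \<in> G then Zlag Nm a s t \<omega> else 0"
  define k where "k = nat \<lceil>y\<rceil>"
  have y: "y \<le> real n \<longleftrightarrow> k \<le> n" for n by (simp add: k_def nat_ceiling_le_eq)
  \<comment> \<open>For \<open>k = 0\<close> the event is the whole space. For \<open>k > 0\<close>
    it lies inside \<open>G\<close>, since the process vanishes elsewhere; this removes the outcomes
    where \<open>Zlag\<close> is not controlled.\<close>
  show "{\<omega> \<in> space M. y \<le> real (strip_process (Zlag Nm a s t \<omega>) \<omega>)} \<in> events"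
  proof (cases "k = 0")
    case True
    then show ?thesis by (simp add: y)
  next
    case False
    have iff: "k \<le> strip_process (Zlag Nm a s t \<omega>) \<omega> \<longleftrightarrow>
      (\<forall>q\<in>\<rat> \<inter> {0..}. ?Z \<omega> < q \<longrightarrow> k \<le> strip_process q \<omega>)" if \<omega>: "\<omega> \<in> G" for \<omega>
    proof -
      define z where "z = Zlag Nm a s t \<omega>"
      have z: "0 \<le> z" using lowest_atom_G[OF \<omega>] unfolding z_def by (metis diff_ge_0_iff_ge less_imp_le)
      obtain \<delta> where \<delta>: "0 < \<delta>" "\<forall>r'\<in>{z..z + \<delta>}. strip_process r' \<omega> = strip_process z \<omega>"
        using strip_process_right_continuous[OF z] by blast
      have "k \<le> strip_process z \<omega> \<longleftrightarrow> (\<forall>q\<in>\<rat> \<inter> {0..}. z < q \<longrightarrow> k \<le> strip_process q \<omega>)"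
      proof (intro iffI ballI impI)
        fix q assume "k \<le> strip_process z \<omega>" "z < q"
        then show "k \<le> strip_process q \<omega>"
          using mono_onD[OF mono_strip_process[of \<omega>], of z q] z by simp
      next
        assume *: "\<forall>q\<in>\<rat> \<inter> {0..}. z < q \<longrightarrow> k \<le> strip_process q \<omega>"
        obtain q where q: "q \<in> \<rat>" "z < q" "q < z + \<delta>"
          using Rats_dense_in_real[of z "z + \<delta>"] \<delta>(1) by auto
        then have "k \<le> strip_process q \<omega>" using * z by simp
        moreover have "strip_process q \<omega> = strip_process z \<omega>"
          by (rule bspec[OF \<delta>(2)]) (use q in simp)
        ultimately show "k \<le> strip_process z \<omega>" by simp
      qed
      then show ?thesis using \<omega> by (simp add: z_def)
    qed
    have "{\<omega> \<in> space M. y \<le> real (strip_process (Zlag Nm a s t \<omega>) \<omega>)} =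
      G \<inter> {\<omega> \<in> space M. \<forall>q\<in>\<rat> \<inter> {0..}. ?Z \<omega> < q \<longrightarrow> k \<le> strip_process q \<omega>}"
    proof (intro equalityI subsetI)
      fix \<omega> assume *: "\<omega> \<in> {\<omega> \<in> space M. y \<le> real (strip_process (Zlag Nm a s t \<omega>) \<omega>)}"
      then have k: "k \<le> strip_process (Zlag Nm a s t \<omega>) \<omega>" by (simp add: y)
      with False have "\<omega> \<in> G" by (auto simp: strip_process_def split: if_splits)
      with k iff[of \<omega>] * show "\<omega> \<in> G \<inter> {\<omega> \<in> space M. \<forall>q\<in>\<rat> \<inter> {0..}. ?Z \<omega> < q \<longrightarrow> k \<le> strip_process q \<omega>}"
        by blast
    next
      fix \<omega> assume *: "\<omega> \<in> G \<inter> {\<omega> \<in> space M. \<forall>q\<in>\<rat> \<inter> {0..}. ?Z \<omega> < q \<longrightarrow> k \<le> strip_process q \<omega>}"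
      then have "k \<le> strip_process (Zlag Nm a s t \<omega>) \<omega>" using iff[of \<omega>] by blast
      then show "\<omega> \<in> {\<omega> \<in> space M. y \<le> real (strip_process (Zlag Nm a s t \<omega>) \<omega>)}"
        using * by (simp add: y)
    qed
    also have "\<dots> \<in> events"
    proof (rule sets.Int[OF G(1)])
      have "{\<omega> \<in> space M. \<forall>q\<in>\<rat> \<inter> {0..}. ?Z \<omega> < q \<longrightarrow> k \<le> strip_process q \<omega>} =
        (\<Inter>q\<in>\<rat> \<inter> {0..}. {\<omega> \<in> space M. ?Z \<omega> < q \<longrightarrow> k \<le> strip_process q \<omega>})"
        using Rats_0 by fastforce
      also have "\<dots> \<in> events"
      proof (rule sets.countable_INT')
        show "countable (\<rat> \<inter> {0::real..})" by (intro countable_Int1 countable_rat)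
        show "\<rat> \<inter> {0::real..} \<noteq> {}" using Rats_0 by fastforce
        show "(\<lambda>q. {\<omega> \<in> space M. ?Z \<omega> < q \<longrightarrow> k \<le> strip_process q \<omega>}) ` (\<rat> \<inter> {0..}) \<subseteq> events"
        proof (rule image_subsetI)
          fix q :: real assume q: "q \<in> \<rat> \<inter> {0..}"
          have 1: "{\<omega> \<in> space M. ?Z \<omega> < q} \<in> events"
            using measurable_Zlag unfolding borel_measurable_iff_less by blast
          have "strip_process q -` {k..} \<inter> space M \<in> events"
            using q by (intro measurable_sets[OF measurable_strip_process]) auto
          then have 2: "{\<omega> \<in> space M. k \<le> strip_process q \<omega>} \<in> events"
            by (simp add: vimage_def Int_def conj_commute)
          show "{\<omega> \<in> space M. ?Z \<omega> < q \<longrightarrow> k \<le> strip_process q \<omega>} \<in> events"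
            by (intro sets.sets_Collect_imp 1 2)
        qed
      qed
      finally show "{\<omega> \<in> space M. \<forall>q\<in>\<rat> \<inter> {0..}. ?Z \<omega> < q \<longrightarrow> k \<le> strip_process q \<omega>} \<in> events" .
    qed
    finally show ?thesis .
  qed
qed

text \<open>Decomposing by the value \<open>k\<close> of the process, \<open>W\<close> is
  independent of each level set, and the Poisson weights have mean
  \<open>sum H C * r\<close>.\<close>

lemma nn_integral_indicator_strip:
  assumes W: "W \<in> sigma_sets (space M) {(\<lambda>\<omega>. ecount (Nm a \<omega>) B) -` A \<inter> space M | B A.
           B \<in> sets (borel :: (real \<times> real) measure) \<and> B \<subseteq> quadrant \<and> emeasure lborel B < \<infinity>}"
    and r: "0 \<le> r"
  shows "(\<integral>\<^sup>+\<omega>. indicator W \<omega> * ennreal (strip_process r \<omega>) \<partial>M) = ennreal (prob W * (sum H C * r))"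
proof -
  let ?P = "\<lambda>k. strip_process r -` {k} \<inter> space M"
  note ind = indep_strip_process[unfolded indep_of_prm_def]
  have Wev: "W \<in> events" using indep_setD_ev2[OF ind] W by blast
  have P: "?P k \<in> sigma_sets (space M) {strip_process r -` A \<inter> space M | r A. r \<ge> 0}" for k
    using r by (intro sigma_sets.Basic) blast
  have Pev: "?P k \<in> events" for k by (rule measurable_sets[OF measurable_strip_process[OF r]]) simp
  have WP: "prob (W \<inter> ?P k) = prob W * prob (?P k)" for k
    using indep_setD[OF ind P W] by (simp add: Int_commute)
  have pk: "prob (?P k) = exp (- (sum H C * r)) * (sum H C * r) ^ k / fact k" for k
    using prob_strip_process_increment[of 0 r k] r
    by (simp add: strip_process_0 vimage_def Int_def conj_commute)
  have Hn: "0 \<le> sum H C" using H by (intro sum_nonneg)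
  have "(\<integral>\<^sup>+\<omega>. indicator W \<omega> * ennreal (strip_process r \<omega>) \<partial>M) =
    (\<integral>\<^sup>+\<omega>. (\<Sum>k. ennreal (real k) * indicator (W \<inter> ?P k) \<omega>) \<partial>M)"
  proof (rule nn_integral_cong)
    fix \<omega> assume "\<omega> \<in> space M"
    then have "(\<Sum>k. ennreal (real k) * indicator (W \<inter> ?P k) \<omega>) =
      (\<Sum>k\<in>{strip_process r \<omega>}. ennreal (real k) * indicator (W \<inter> ?P k) \<omega>)"
      by (intro suminf_finite) (auto simp: indicator_def)
    then show "indicator W \<omega> * ennreal (strip_process r \<omega>) = (\<Sum>k. ennreal (real k) * indicator (W \<inter> ?P k) \<omega>)"
      using \<open>\<omega> \<in> space M\<close> by (simp add: indicator_def)
  qed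
  also have "\<dots> = (\<Sum>k. \<integral>\<^sup>+\<omega>. ennreal (real k) * indicator (W \<inter> ?P k) \<omega> \<partial>M)"
    by (intro nn_integral_suminf borel_measurable_times_ennreal borel_measurable_indicator sets.Int[OF Wev Pev]) auto
  also have "\<dots> = (\<Sum>k. ennreal (real k * (prob W * prob (?P k))))"
  proof (rule suminf_cong)
    fix k
    have "(\<integral>\<^sup>+\<omega>. ennreal (real k) * indicator (W \<inter> ?P k) \<omega> \<partial>M) = ennreal (real k) * emeasure M (W \<inter> ?P k)"
      using Wev Pev by (intro nn_integral_cmult_indicator) auto
    then show "(\<integral>\<^sup>+\<omega>. ennreal (real k) * indicator (W \<inter> ?P k) \<omega> \<partial>M) = ennreal (real k * (prob W * prob (?P k)))"
      by (simp add: emeasure_eq_measure WP ennreal_mult)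
  qed
  also have "\<dots> = ennreal (prob W * (sum H C * r))"
  proof (rule suminf_ennreal_eq)
    have "(\<lambda>k. prob W * (real k * (exp (- (sum H C * r)) * (sum H C * r) ^ k / fact k))) sums (prob W * (sum H C * r))"
      by (intro sums_mult poisson_mean)
    then show "(\<lambda>k. real k * (prob W * prob (?P k))) sums (prob W * (sum H C * r))"
      by (simp add: pk mult.left_commute)
  qed simp
  finally show ?thesis .
qed

text \<open>The event that the atoms of \<open>a\<close> avoid all height layers below the \<open>m\<close>-th and meet the
  \<open>m\<close>-th layer in the \<open>k\<close>-th time slot. Summing over \<open>m\<close> gives a geometric series with value
  about \<open>1 / n\<close>: this is how the uniform law of \<^const>\<open>Zlag\<close> enters.\<close>
definition low_in_slot :: "nat \<Rightarrow> nat \<Rightarrow> nat \<Rightarrow> 'a set" where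
  "low_in_slot n k m =
     {\<omega> \<in> space M. ecount (Nm a \<omega>) ({s..t} \<times> {0..<real m / real n}) = 0} \<inter>
     {\<omega> \<in> space M. 1 \<le> ecount (Nm a \<omega>)
        ({s + real k * ((t - s) / real n)..s + real (Suc k) * ((t - s) / real n)} \<times> {real m / real n..<real (Suc m) / real n})}"

text \<open>The two regions are disjoint because the layer begins where the lower region ends. Their
  areas are \<open>(t - s) * (m / n)\<close> and \<open>(t - s) / n\<^sup>2\<close>.\<close>

lemma
  assumes n: "0 < n"
  shows prob_low_in_slot: "prob (low_in_slot n k m) =
      exp (- ((t - s) / real n)) ^ m * (1 - exp (- ((t - s) / (real n)\<^sup>2)))" (is ?A)
    and low_in_slot_sigma: "low_in_slot n k m \<in> sigma_sets (space M) {(\<lambda>\<omega>. ecount (Nm a \<omega>) B) -` A \<inter> space M | B A.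
           B \<in> sets (borel :: (real \<times> real) measure) \<and> B \<subseteq> quadrant \<and> emeasure lborel B < \<infinity>}" (is ?B)
proof -
  define B1 where "B1 = {s..t} \<times> {0..<real m / real n}"
  define B2 where "B2 = {s + real k * ((t - s) / real n)..s + real (Suc k) * ((t - s) / real n)}
    \<times> {real m / real n..<real (Suc m) / real n}"
  have lek: "s + real k * ((t - s) / real n) \<le> s + real (Suc k) * ((t - s) / real n)"
    using s n by (intro add_left_mono mult_right_mono) auto
  have lem: "real m / real n \<le> real (Suc m) / real n" using n by (intro divide_right_mono) auto
  have k0: "0 \<le> s + real k * ((t - s) / real n)" using s n by (intro add_nonneg_nonneg mult_nonneg_nonneg) auto
  have m0: "0 \<le> real m / real n" by simp
  have B1: "test_set B1" unfolding B1_def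
    by (rule test_set_Times) (use s in auto)
  have B2: "test_set B2" unfolding B2_def
  proof (rule test_set_Times)
    show "{s + real k * ((t - s) / real n)..s + real (Suc k) * ((t - s) / real n)} \<subseteq> {0..}"
      using k0 by (meson atLeastAtMost_iff atLeast_iff order_trans subsetI)
    show "{real m / real n..<real (Suc m) / real n} \<subseteq> {0..}"
      using m0 by (meson atLeastLessThan_iff atLeast_iff order_trans subsetI)
  qed (use lek lem in simp_all)
  have mB1: "measure lborel B1 = (t - s) * (real m / real n)"
    unfolding B1_def using s by (subst measure_lborel_Times) simp_all
  have mB2: "measure lborel B2 = (t - s) / (real n)\<^sup>2"
    unfolding B2_def using lek lem n
    by (subst measure_lborel_Times) (simp_all add: field_simps power2_eq_square)
  let ?X = "\<lambda>B Q. (\<lambda>\<omega>. ecount (Nm a \<omega>) B) -` Q \<inter> space M"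
  have eq: "low_in_slot n k m = ?X B1 {0} \<inter> ?X B2 {1..}"
    unfolding low_in_slot_def B1_def[symmetric] B2_def[symmetric] by auto
  have disj: "B1 \<inter> B2 = {}" by (auto simp: B1_def B2_def)
  have ind: "indep_vars (\<lambda>_. cs) (\<lambda>B \<omega>. ecount (Nm a \<omega>) (if B then B1 else B2)) UNIV"
    by (rule indep_vars_ecount) (use a(1) B1 B2 disj in \<open>auto split: if_splits\<close>)
  have "prob (\<Inter>B\<in>UNIV. ?X (if B then B1 else B2) (if B then {0} else {1..})) =
      (\<Prod>B\<in>UNIV. prob (?X (if B then B1 else B2) (if B then {0} else {1..})))"
    by (rule indep_varsD_finite[OF ind]) auto
  then have "prob (low_in_slot n k m) = prob (?X B1 {0}) * prob (?X B2 {1..})"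
    by (simp add: eq UNIV_bool Int_commute mult.commute)
  also have "?X B1 {0} = {\<omega> \<in> space M. ecount (Nm a \<omega>) B1 = 0}" by auto
  also have "?X B2 {1..} = {\<omega> \<in> space M. 1 \<le> ecount (Nm a \<omega>) B2}" by auto
  finally have "prob (low_in_slot n k m) = exp (- ((t - s) * (real m / real n))) * (1 - exp (- ((t - s) / (real n)\<^sup>2)))"
    using prob_no_atom[OF a(1) B1] prob_some_atom[OF a(1) B2] by (simp add: mB1 mB2)
  also have "exp (- ((t - s) * (real m / real n))) = exp (- ((t - s) / real n)) ^ m"
    by (simp add: exp_of_nat_mult[symmetric] mult.commute)
  finally show ?A .
  let ?G = "{(\<lambda>\<omega>. ecount (Nm a \<omega>) B) -` A \<inter> space M | B A.
           B \<in> sets (borel :: (real \<times> real) measure) \<and> B \<subseteq> quadrant \<and> emeasure lborel B < \<infinity>}"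
  interpret sa: sigma_algebra "space M" "sigma_sets (space M) ?G"
    by (rule sigma_algebra_sigma_sets) auto
  have basic: "?X B Q \<in> sigma_sets (space M) ?G" if "test_set B" for B Q
    using that unfolding test_set_def by (intro sigma_sets.Basic) blast
  show ?B unfolding eq by (intro sa.Int basic B1 B2)
qed

text \<open>The lag is bounded by the time from the left end of its slot to \<open>t\<close>, which
  replaces a random time by a fixed one. The sum runs over all slots and layers; the pair of the
  lowest atom is among them.\<close>

lemma strip_Zlag_le_slots:
  assumes \<omega>: "\<omega> \<in> G" and n: "0 < n"
  shows "ennreal (strip_process (Zlag Nm a s t \<omega>) \<omega>) \<le>
    (\<Sum>k<n. \<Sum>m. indicator (low_in_slot n k m) \<omega> * ennreal (strip_process (t - s - real k * ((t - s) / real n)) \<omega>))"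
proof -
  obtain \<tau> e where 1: "(\<tau>, e) \<in> Nm a \<omega>" "0 < \<tau>" "s \<le> \<tau>" "\<tau> < t" "0 \<le> e"
    "\<forall>v z. (v, z) \<in> Nm a \<omega> \<longrightarrow> s \<le> v \<longrightarrow> v \<le> t \<longrightarrow> e \<le> z"
    "Eheight Nm a s t \<omega> = ereal e" "Zlag Nm a s t \<omega> = t - \<tau>"
    using lowest_atom_G[OF \<omega>] by blast
  obtain k where k: "k < n" "\<tau> - s \<in> {real k * ((t - s) / real n)..real (Suc k) * ((t - s) / real n)}"
    using exists_slot[OF n, of "\<tau> - s" "t - s"] 1 by auto
  \<comment> \<open>The layer from \<open>m / n\<close> to \<open>(m + 1) / n\<close> that contains
    the height \<open>e\<close>.\<close>
  define m where "m = nat \<lfloor>e * real n\<rfloor>"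
  have "real m \<le> e * real n" "e * real n < real m + 1"
    using 1(5) n unfolding m_def by (simp_all add: of_nat_nat)
  then have m: "real m / real n \<le> e" "e < real (Suc m) / real n" using n by (simp_all add: field_simps)
  define f where "f k m = indicator (low_in_slot n k m) \<omega> *
    ennreal (strip_process (t - s - real k * ((t - s) / real n)) \<omega>)" for k m
  have "\<omega> \<in> space M" using \<omega> sets.sets_into_space[OF G(1)] by blast
  have "Nm a \<omega> \<inter> {s..t} \<times> {0..<real m / real n} = {}"
  proof -
    have False if "(v, z) \<in> Nm a \<omega>" "s \<le> v" "v \<le> t" "z < real m / real n" for v z
      using 1(6) that m(1) by (meson leD le_less_trans order_trans)
    then show ?thesis by auto
  qed
  moreover have "(\<tau>, e) \<in> Nm a \<omega> \<inter>
     {s + real k * ((t - s) / real n)..s + real (Suc k) * ((t - s) / real n)} \<times> {real m / real n..<real (Suc m) / real n}"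
    using 1(1) k(2) m by auto
  ultimately have in_slot: "\<omega> \<in> low_in_slot n k m"
    using \<open>\<omega> \<in> space M\<close> unfolding low_in_slot_def ecount_eq_0_iff one_le_ecount_iff by blast
  have "strip_process (Zlag Nm a s t \<omega>) \<omega> \<le> strip_process (t - s - real k * ((t - s) / real n)) \<omega>"
    using mono_onD[OF mono_strip_process[of \<omega>], of "t - \<tau>" "t - s - real k * ((t - s) / real n)"] 1 k by auto
  then have "ennreal (strip_process (Zlag Nm a s t \<omega>) \<omega>) \<le> f k m"
    using in_slot by (simp add: f_def ennreal_leI)
  also have "\<dots> = (\<Sum>m\<in>{m}. f k m)" by simp
  also have "\<dots> \<le> (\<Sum>m. f k m)" by (rule sum_le_suminf) auto
  also have "\<dots> \<le> (\<Sum>k<n. \<Sum>m. f k m)" using k(1) by (intro member_le_sum[where f="\<lambda>k. \<Sum>m. f k m"]) auto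
  finally show ?thesis by (simp only: f_def)
qed

text \<open>By independence each slot contributes \<open>y / (1 - x)\<close>, the value of the
  geometric series over layers, times the mean at a fixed time. Since \<open>y / (1 - x)\<close> is
  about \<open>1 / n\<close>, this is a Riemann sum for \<open>\<mu> * L / 2\<close> with explicit
  error factors.\<close>

lemma nn_integral_strip_Zlag_le_approx:
  assumes n: "0 < n"
  shows "(\<integral>\<^sup>+\<omega>. ennreal (strip_process (Zlag Nm a s t \<omega>) \<omega>) \<partial>M) \<le>
    ennreal (sum H C * (t - s) / 2 * ((1 + (t - s) / real n) * (1 + 1 / real n)))"
proof -
  define L where "L = t - s"
  have L: "0 < L" using s by (simp add: L_def)
  define x where "x = exp (- (L / real n))"
  define y where "y = 1 - exp (- (L / (real n)\<^sup>2))"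
  have x: "0 < x" "x < 1" using L n by (simp_all add: x_def)
  have y: "0 \<le> y" "y \<le> L / (real n)\<^sup>2"
    using L exp_ge_add_one_self[of "- (L / (real n)\<^sup>2)"] by (simp_all add: y_def)
  define \<mu> where "\<mu> = sum H C"
  have \<mu>: "0 \<le> \<mu>" unfolding \<mu>_def using H by (intro sum_nonneg)
  define r where "r k = L - real k * (L / real n)" for k
  have r: "0 \<le> r k" if "k < n" for k
  proof -
    have "real k * (L / real n) \<le> real n * (L / real n)" using that L by (intro mult_right_mono) auto
    then show ?thesis using n by (simp add: r_def)
  qed
  have Wev: "low_in_slot n k m \<in> events" for k m
    using indep_setD_ev2[OF indep_strip_process[unfolded indep_of_prm_def]] low_in_slot_sigma[OF n] by blast
  have mP: "(\<lambda>\<omega>. ennreal (real (strip_process (r k) \<omega>))) \<in> borel_measurable M" if "k < n" for k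
    by (rule measurable_compose[OF measurable_strip_process[OF r[OF that]]]) simp
  have "(\<integral>\<^sup>+\<omega>. ennreal (strip_process (Zlag Nm a s t \<omega>) \<omega>) \<partial>M) \<le>
    (\<integral>\<^sup>+\<omega>. (\<Sum>k<n. \<Sum>m. indicator (low_in_slot n k m) \<omega> * ennreal (strip_process (r k) \<omega>)) \<partial>M)"
    by (rule nn_integral_mono_AE, rule AE_mp[OF AE_G], rule AE_I2)
       (use strip_Zlag_le_slots[OF _ n] in \<open>simp add: r_def L_def\<close>)
  also have "\<dots> = (\<Sum>k<n. \<Sum>m. \<integral>\<^sup>+\<omega>. indicator (low_in_slot n k m) \<omega> * ennreal (strip_process (r k) \<omega>) \<partial>M)"
  proof (subst nn_integral_sum)
    fix k assume "k \<in> {..<n}"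
    then show "(\<lambda>\<omega>. \<Sum>m. indicator (low_in_slot n k m) \<omega> * ennreal (strip_process (r k) \<omega>)) \<in> borel_measurable M"
      using mP[of k] Wev
      by (intro borel_measurable_suminf_order borel_measurable_times_ennreal borel_measurable_indicator) auto
  next
    show "(\<Sum>k<n. \<integral>\<^sup>+\<omega>. (\<Sum>m. indicator (low_in_slot n k m) \<omega> * ennreal (strip_process (r k) \<omega>)) \<partial>M) =
      (\<Sum>k<n. \<Sum>m. \<integral>\<^sup>+\<omega>. indicator (low_in_slot n k m) \<omega> * ennreal (strip_process (r k) \<omega>) \<partial>M)"
      using mP Wev by (intro sum.cong refl nn_integral_suminf borel_measurable_times_ennreal borel_measurable_indicator) auto
  qed
  also have "\<dots> = (\<Sum>k<n. ennreal (y / (1 - x) * (\<mu> * r k)))"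
  proof (rule sum.cong[OF refl])
    fix k assume "k \<in> {..<n}"
    then have rk: "0 \<le> r k" using r by simp
    have "(\<Sum>m. \<integral>\<^sup>+\<omega>. indicator (low_in_slot n k m) \<omega> * ennreal (strip_process (r k) \<omega>) \<partial>M) =
      (\<Sum>m. ennreal (x ^ m * (y * (\<mu> * r k))))"
      by (intro suminf_cong)
         (simp add: nn_integral_indicator_strip[OF low_in_slot_sigma[OF n] rk] prob_low_in_slot[OF n]
            x_def y_def L_def \<mu>_def mult.assoc)
    also have "\<dots> = ennreal (1 / (1 - x) * (y * (\<mu> * r k)))"
      using x y \<mu> rk by (intro suminf_ennreal_eq sums_mult2 geometric_sums) auto
    finally show "(\<Sum>m. \<integral>\<^sup>+\<omega>. indicator (low_in_slot n k m) \<omega> * ennreal (strip_process (r k) \<omega>) \<partial>M) =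
      ennreal (y / (1 - x) * (\<mu> * r k))" by simp
  qed
  also have "\<dots> = ennreal (\<Sum>k<n. y / (1 - x) * (\<mu> * r k))"
    using x y \<mu> r by (intro sum_ennreal) auto
  also have "\<dots> \<le> ennreal (\<mu> * L / 2 * ((1 + L / real n) * (1 + 1 / real n)))"
  proof (rule ennreal_leI)
    have sum_r: "(\<Sum>k<n. r k) = L * (real n + 1) / 2"
    proof -
      have g: "(\<Sum>k<j. real k) = real j * (real j - 1) / 2" for j by (induction j) (auto simp: field_simps)
      have "(\<Sum>k<n. r k) = real n * L - (\<Sum>k<n. real k) * (L / real n)"
        unfolding r_def sum_subtractf sum_distrib_right by simp
      also have "\<dots> = real n * L - L * (real n - 1) / 2" using n by (simp add: g)
      finally show ?thesis by (simp add: field_simps)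
    qed
    \<comment> \<open>With \<open>u = L / n\<close>, \<open>exp u \<ge> 1 + u\<close> bounds
      \<open>1 - x\<close> from below; together with the upper bound on \<open>y\<close> the weight
      of a slot is at most \<open>1 / n\<close> up to the factor \<open>1 + L / n\<close>.\<close>
    have "1 + L / real n \<le> exp (L / real n)" by (rule exp_ge_add_one_self)
    then have "x \<le> 1 / (1 + L / real n)"
      using L by (simp add: x_def exp_minus field_simps add_pos_nonneg)
    moreover have "1 - 1 / (1 + L / real n) = (L / real n) / (1 + L / real n)"
      using L n by (simp add: field_simps add_pos_pos)
    ultimately have den: "(L / real n) / (1 + L / real n) \<le> 1 - x" by simp
    have pos: "0 < (L / real n) / (1 + L / real n)" using L n by (intro divide_pos_pos add_pos_pos) auto
    have "y / (1 - x) \<le> (L / (real n)\<^sup>2) / ((L / real n) / (1 + L / real n))"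
      using y den pos L by (intro frac_le) auto
    also have "\<dots> = (1 + L / real n) / real n"
      using L n by (simp add: power2_eq_square)
    finally have q: "y / (1 - x) \<le> (1 + L / real n) / real n" .
    have "(\<Sum>k<n. y / (1 - x) * (\<mu> * r k)) = y / (1 - x) * (\<mu> * (L * (real n + 1) / 2))"
      by (simp only: sum_distrib_left[symmetric] sum_r)
    also have "\<dots> \<le> (1 + L / real n) / real n * (\<mu> * (L * (real n + 1) / 2))"
      using \<mu> L by (intro mult_right_mono q) auto
    also have "\<dots> = \<mu> * L / 2 * ((1 + L / real n) * (1 + 1 / real n))"
      using n by (simp add: field_simps)
    finally show "(\<Sum>k<n. y / (1 - x) * (\<mu> * r k)) \<le> \<mu> * L / 2 * ((1 + L / real n) * (1 + 1 / real n))" .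
  qed
  finally show ?thesis by (simp add: \<mu>_def L_def)
qed

text \<open>Letting \<open>n\<close> grow removes both discretisation factors; what remains is the
  rate times the mean \<open>(t - s) / 2\<close> of a uniform lag.\<close>

lemma nn_integral_strip_Zlag_le:
  "(\<integral>\<^sup>+\<omega>. ennreal (strip_process (Zlag Nm a s t \<omega>) \<omega>) \<partial>M) \<le> ennreal (sum H C * (t - s) / 2)"
proof (rule LIMSEQ_le_const)
  have "(\<lambda>n. sum H C * (t - s) / 2 * ((1 + (t - s) / real n) * (1 + 1 / real n)))
     \<longlonglongrightarrow> sum H C * (t - s) / 2 * ((1 + 0) * (1 + 0))"
    by (intro tendsto_intros lim_const_over_n)
  then show "(\<lambda>n. ennreal (sum H C * (t - s) / 2 * ((1 + (t - s) / real n) * (1 + 1 / real n))))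
     \<longlonglongrightarrow> ennreal (sum H C * (t - s) / 2)"
    by (intro tendsto_ennrealI) simp
  show "\<exists>N. \<forall>n\<ge>N. (\<integral>\<^sup>+\<omega>. ennreal (strip_process (Zlag Nm a s t \<omega>) \<omega>) \<partial>M)
     \<le> ennreal (sum H C * (t - s) / 2 * ((1 + (t - s) / real n) * (1 + 1 / real n)))"
    using nn_integral_strip_Zlag_le_approx by (intro exI[of _ 1]) simp
qed

end

section \<open>The bound for the actor system\<close>

text \<open>The atoms counted by \<open>abs_X_le\<close> after the lowest atom of \<open>a\<close>
  have age at most \<open>Zlag\<close> and lie in the strips, so the process read at
  \<open>Zlag\<close> counts them all.\<close>

lemma (in prm_lag) abs_actor_le:
  assumes I: "I = {1..N}" and CI: "C = {1..N} - {a}" and h: "0 < h"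
    and \<phi>: "\<And>r. \<phi> r \<ge> 0" and bdd: "bdd_above (Phi \<phi> ` {0..2 * h})"
    and HK: "\<And>c. Mlt \<phi> (2 * h) \<le> H c"
    and sys: "system_eq \<phi> h N U0 (\<lambda>c. Nm c \<omega>) X" and \<omega>: "\<omega> \<in> G"
  shows "ereal \<bar>X a t\<bar> \<le> Mgt_inv \<phi> (Eheight Nm a s t \<omega>) + ereal h +
    ereal (2 * h / N * real (strip_process (Zlag Nm a s t \<omega>) \<omega>))"
proof -
  interpret actor_path \<phi> h N U0 "\<lambda>c. Nm c \<omega>" X
  proof
    show "0 < h" by (rule h)
    show "system_eq \<phi> h N U0 (\<lambda>c. Nm c \<omega>) X" by (rule sys)
    fix b c u z w assume "b \<in> {1..N}" "c \<in> {1..N}" "(u, z) \<in> Nm b \<omega>" "(u, w) \<in> Nm c \<omega>"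
    moreover have "\<forall>c\<in>I. \<forall>d\<in>I. \<forall>x\<in>Nm c \<omega>. \<forall>y\<in>Nm d \<omega>. fst x = fst y \<longrightarrow> c = d \<and> x = y"
      using G(3)[OF \<omega>] unfolding good_atoms_def by blast
    ultimately show "b = c \<and> z = w" using I by (metis fst_conv snd_conv)
  qed
  obtain \<tau> e where 1: "(\<tau>, e) \<in> Nm a \<omega>" "0 < \<tau>" "s \<le> \<tau>" "\<tau> < t" "0 \<le> e"
    "\<forall>v z. (v, z) \<in> Nm a \<omega> \<longrightarrow> s \<le> v \<longrightarrow> v \<le> t \<longrightarrow> e \<le> z"
    "Eheight Nm a s t \<omega> = ereal e" "Zlag Nm a s t \<omega> = t - \<tau>"
    using lowest_atom_G[OF \<omega>] by blast
  let ?K = "Mlt \<phi> (2 * h)"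
  have "ereal \<bar>X a t\<bar> \<le> Mgt_inv \<phi> (ereal e) + ereal h +
     ereal (2 * h / N * real (\<Sum>c\<in>{1..N} - {a}. card (Nm c \<omega> \<inter> {\<tau><..t} \<times> {..?K})))"
  proof (rule abs_X_le[OF _ \<phi> bdd 1(1,2)])
    show "finite (Nm c \<omega> \<inter> {\<tau><..t} \<times> {..?K})" if "c \<in> {1..N}" for c
      by (rule good_atoms_finite[where S="\<lambda>c. Nm c \<omega>" and m="max t ?K", OF G(3)[OF \<omega>]]) (use that I in auto)
  qed (use 1 a I in auto)
  also have "\<dots> \<le> Mgt_inv \<phi> (ereal e) + ereal h + ereal (2 * h / N * real (strip_process (t - \<tau>) \<omega>))"
  proof -
    have "(\<Sum>c\<in>C. card (Nm c \<omega> \<inter> {\<tau><..t} \<times> {..?K})) \<le> (\<Sum>c\<in>C. card (Nm c \<omega> \<inter> window t (t - \<tau>) \<times> {0..H c}))"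
    proof (intro sum_mono card_mono finite_strip \<omega>)
      fix c assume c: "c \<in> C"
      show "Nm c \<omega> \<inter> {\<tau><..t} \<times> {..?K} \<subseteq> Nm c \<omega> \<inter> window t (t - \<tau>) \<times> {0..H c}"
      proof
        fix x assume x: "x \<in> Nm c \<omega> \<inter> {\<tau><..t} \<times> {..?K}"
        \<comment> \<open>The interval up to \<open>t\<close> is closed while the window leaves out
          \<open>t\<close>; \<open>good_atoms\<close> excludes atoms at that instant.\<close>
        have "x \<in> quadrant" "fst x \<noteq> t"
          using G(3)[OF \<omega>] c C(2) x unfolding good_atoms_def by blast+
        then show "x \<in> Nm c \<omega> \<inter> window t (t - \<tau>) \<times> {0..H c}"
          using x 1(2) order_trans[OF _ HK[of c]] by (cases x) (auto simp: quadrant_def window_def age_def)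
      qed
    qed
    moreover have "strip_process (t - \<tau>) \<omega> = (\<Sum>c\<in>C. card (Nm c \<omega> \<inter> window t (t - \<tau>) \<times> {0..H c}))"
      using \<omega> 1(4) by (simp add: strip_process_def)
    ultimately have "(\<Sum>c\<in>{1..N} - {a}. card (Nm c \<omega> \<inter> {\<tau><..t} \<times> {..?K})) \<le> strip_process (t - \<tau>) \<omega>"
      by (simp only: CI[symmetric])
    then have "2 * h / N * real (\<Sum>c\<in>{1..N} - {a}. card (Nm c \<omega> \<inter> {\<tau><..t} \<times> {..?K}))
        \<le> 2 * h / N * real (strip_process (t - \<tau>) \<omega>)"
      using h by (intro mult_left_mono) (simp_all only: of_nat_le_iff, simp)
    then show ?thesis by (intro add_left_mono) simp
  qed
  finally show ?thesis by (simp only: 1)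
qed

lemma ennreal_le_e2ennreal_add:
  assumes "ereal u \<le> x + ereal v + ereal w" "0 \<le> x" "0 \<le> v" "0 \<le> w"
  shows "ennreal u \<le> e2ennreal x + ennreal v + ennreal w"
  using assms by (cases x) (auto simp flip: ennreal_plus intro!: ennreal_leI)

theorem theorem5:
  fixes M :: "'w measure"
    and \<phi> :: "real \<Rightarrow> real" and h :: real and N :: nat and a :: nat
    and U0 :: "nat \<Rightarrow> real"
    and Nm :: "nat \<Rightarrow> 'w \<Rightarrow> (real \<times> real) set"
    and U :: "nat \<Rightarrow> real \<Rightarrow> 'w \<Rightarrow> real"
  assumes "prob_space M"
    and "h > 0" and "N \<ge> 2" and "a \<in> {1..N}"
    and "\<And>r. \<phi> r \<ge> 0"
    and "bdd_above (Phi \<phi> ` {0..2 * h})"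
    and "filterlim (Mgt \<phi>) at_top at_top"
    and "prm_family M {1..N} Nm"
    and "is_actor_system M \<phi> h N U0 Nm U"
  shows
    "(\<forall>s t. 0 \<le> s \<longrightarrow> s < t \<longrightarrow>
       (\<exists>P. poisson_process M (real N * Mlt \<phi> (2 * h)) P \<and> indep_of_prm M P (Nm a) \<and>
          (\<forall>r\<ge>0. measure M {\<omega> \<in> space M. ereal \<bar>U a t \<omega>\<bar> > ereal r}
             \<le> measure M {\<omega> \<in> space M.
                  Mgt_inv \<phi> (Eheight Nm a s t \<omega>) + ereal h
                    + ereal (2 * h / real N * real (P (Zlag Nm a s t \<omega>) \<omega>)) > ereal r}))) \<and>
     (\<forall>t>0. (\<integral>\<^sup>+ \<omega>. ennreal \<bar>U a t \<omega>\<bar> \<partial>M)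
        \<le> (INF s\<in>{0<..t}. (\<integral>\<^sup>+ \<omega>. e2ennreal (Mgt_inv \<phi> (Eheight Nm a s t \<omega>)) \<partial>M)
              + ennreal h + ennreal (h * (t - s) * Mlt \<phi> (2 * h))))"
proof (intro conjI allI impI)
  interpret prm M "{1..N}" Nm
    using assms(1,8) by (intro prm.intro prm_axioms.intro)
  note h = \<open>h > 0\<close> and N = \<open>N \<ge> 2\<close> and a = \<open>a \<in> {1..N}\<close> and \<phi> = assms(5) and bdd = assms(6)
  have sys: "AE \<omega> in M. system_eq \<phi> h N U0 (\<lambda>b. Nm b \<omega>) (\<lambda>b t. U b t \<omega>)"
    using assms(9) by (simp add: is_actor_system_def)
  define K where "K = Mlt \<phi> (2 * h)"
  have K: "0 \<le> K" unfolding K_def using h by (intro Mlt_nonneg \<phi> bdd) auto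
  define C where "C = {1..N} - {a}"
  \<comment> \<open>The \<open>N - 1\<close> other actors give rate \<open>(N - 1) * K\<close>; doubling one strip yields \<open>N * K\<close>.\<close>
  define c0 where "c0 = (if a = 1 then 2 else 1 :: nat)"
  have c0: "c0 \<in> C" using a N by (auto simp: c0_def C_def)
  define H where "H c = (if c = c0 then 2 * K else K)" for c
  have sumH: "sum H C = real N * K"
  proof -
    have "sum H C = (\<Sum>c\<in>C. K + (if c = c0 then K else 0))" by (intro sum.cong) (auto simp: H_def)
    also have "\<dots> = real (card C) * K + K" using c0 by (simp add: sum.distrib C_def)
    also have "card C = N - 1" using a by (simp add: C_def)
    finally show ?thesis using N by (simp add: of_nat_diff algebra_simps)
  qed
  \<comment> \<open>Regular atoms and an atom of \<open>a\<close> during \<open>[s, t]\<close> both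
    hold almost surely; the complement of a measurable null set serves as \<open>G\<close>.\<close>
  have lag: "\<exists>G. prm_lag M {1..N} Nm a C H t G s" if st: "0 \<le> s" "s < t" for s t
  proof -
    have "AE \<omega> in M. good_atoms {1..N} t (\<lambda>c. Nm c \<omega>) \<and> Nm a \<omega> \<inter> {s..t} \<times> {0..} \<noteq> {}"
      using AE_good_atoms[of t] AE_some_atom[OF a st] st by (intro AE_conjI) auto
    then obtain Z where Z: "{\<omega> \<in> space M. \<not> (good_atoms {1..N} t (\<lambda>c. Nm c \<omega>) \<and> Nm a \<omega> \<inter> {s..t} \<times> {0..} \<noteq> {})} \<subseteq> Z"
      "emeasure M Z = 0" "Z \<in> events" by (rule AE_E)
    have "prm_lag M {1..N} Nm a C H t (space M - Z) s"
    proof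
      show "prob (space M - Z) = 1" using prob_compl[OF Z(3)] Z(2) by (simp add: measure_def)
      show "space M - Z \<in> events" using Z(3) by simp
      show "good_atoms {1..N} t (\<lambda>c. Nm c \<omega>)" "Nm a \<omega> \<inter> {s..t} \<times> {0..} \<noteq> {}" if "\<omega> \<in> space M - Z" for \<omega>
        using Z(1) that by blast+
      show "0 \<le> H c" for c using K by (simp add: H_def)
    qed (use a st in \<open>auto simp: C_def\<close>)
    then show ?thesis by blast
  qed
  have HK: "Mlt \<phi> (2 * h) \<le> H c" for c using K by (simp add: H_def K_def[symmetric])
  {
    fix s t :: real assume st: "0 \<le> s" "s < t"
    obtain G where "prm_lag M {1..N} Nm a C H t G s" using lag[OF st] by blast
    then interpret lag: prm_lag M "{1..N}" Nm a C H t G s .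
    let ?V = "\<lambda>\<omega>. Mgt_inv \<phi> (Eheight Nm a s t \<omega>) + ereal h
                    + ereal (2 * h / real N * real (lag.strip_process (Zlag Nm a s t \<omega>) \<omega>))"
    have AE_le: "AE \<omega> in M. ereal \<bar>U a t \<omega>\<bar> \<le> ?V \<omega>"
      using sys lag.AE_G
    proof eventually_elim
      case (elim \<omega>)
      show ?case by (rule lag.abs_actor_le[OF refl C_def h \<phi> bdd HK elim])
    qed
    have mV: "?V \<in> borel_measurable M"
      using measurable_compose[OF measurable_Eheight[OF a st(1)] measurable_Mgt_inv[OF \<phi>]] lag.measurable_strip_Zlag
      by (intro borel_measurable_ereal_add borel_measurable_ereal borel_measurable_times borel_measurable_const) auto
    show "\<exists>P. poisson_process M (real N * Mlt \<phi> (2 * h)) P \<and> indep_of_prm M P (Nm a) \<and>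
          (\<forall>r\<ge>0. measure M {\<omega> \<in> space M. ereal \<bar>U a t \<omega>\<bar> > ereal r}
             \<le> measure M {\<omega> \<in> space M.
                  Mgt_inv \<phi> (Eheight Nm a s t \<omega>) + ereal h
                    + ereal (2 * h / real N * real (P (Zlag Nm a s t \<omega>) \<omega>)) > ereal r})"
    proof (intro exI[of _ lag.strip_process] conjI allI impI)
      show "poisson_process M (real N * Mlt \<phi> (2 * h)) lag.strip_process"
        using lag.poisson_process_strip_process by (simp add: sumH K_def)
      show "indep_of_prm M lag.strip_process (Nm a)" by (rule lag.indep_strip_process)
      fix r :: real
      \<comment> \<open>The almost sure inequality makes the left event a subset of the right one up
        to a null set.\<close>
      show "prob {\<omega> \<in> space M. ereal \<bar>U a t \<omega>\<bar> > ereal r} \<le> prob {\<omega> \<in> space M. ?V \<omega> > ereal r}"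
      proof (rule finite_measure_mono_AE)
        show "AE \<omega> in M. \<omega> \<in> {\<omega> \<in> space M. ereal \<bar>U a t \<omega>\<bar> > ereal r} \<longrightarrow> \<omega> \<in> {\<omega> \<in> space M. ?V \<omega> > ereal r}"
          using AE_le
        proof eventually_elim
          case (elim \<omega>)
          then show ?case using less_le_trans[OF _ elim, of "ereal r"] by blast
        qed
        show "{\<omega> \<in> space M. ?V \<omega> > ereal r} \<in> events"
          by (rule borel_measurable_less[OF borel_measurable_const mV])
      qed
    qed
  }
  {
    fix t :: real assume t: "0 < t"
    show "(\<integral>\<^sup>+ \<omega>. ennreal \<bar>U a t \<omega>\<bar> \<partial>M)
        \<le> (INF s\<in>{0<..t}. (\<integral>\<^sup>+ \<omega>. e2ennreal (Mgt_inv \<phi> (Eheight Nm a s t \<omega>)) \<partial>M)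
              + ennreal h + ennreal (h * (t - s) * Mlt \<phi> (2 * h)))"
    \<comment> \<open>Each \<open>s\<close> is treated with its own process, as only expectations
      are compared.\<close>
    proof (rule INF_greatest)
      fix s assume s: "s \<in> {0<..t}"
      show "(\<integral>\<^sup>+ \<omega>. ennreal \<bar>U a t \<omega>\<bar> \<partial>M)
        \<le> (\<integral>\<^sup>+ \<omega>. e2ennreal (Mgt_inv \<phi> (Eheight Nm a s t \<omega>)) \<partial>M)
              + ennreal h + ennreal (h * (t - s) * Mlt \<phi> (2 * h))"
      proof (cases "s = t")
        case True
        \<comment> \<open>The degenerate interval \<open>[t, t]\<close> almost surely carries no
          atom, so the height is infinite, no finite \<open>r\<close> qualifies in
          \<open>Mgt_inv\<close>, and the right-hand side is infinite.\<close>
        have "AE \<omega> in M. e2ennreal (Mgt_inv \<phi> (Eheight Nm a s t \<omega>)) = \<top>"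
          using AE_good_atoms[OF less_imp_le[OF t]]
        proof eventually_elim
          case (elim \<omega>)
          have "\<infinity> \<le> Eheight Nm a s t \<omega>"
          proof (rule Eheight_ge)
            fix v z assume "(v, z) \<in> Nm a \<omega>" "s \<le> v" "v \<le> t"
            then have False using elim a True unfolding good_atoms_def by fastforce
            then show "\<infinity> \<le> ereal z" ..
          qed
          then have "Mgt_inv \<phi> (Eheight Nm a s t \<omega>) = \<infinity>"
            by (simp add: Mgt_inv_def top_ereal_def)
          then show ?case by simp
        qed
        then have "(\<integral>\<^sup>+ \<omega>. e2ennreal (Mgt_inv \<phi> (Eheight Nm a s t \<omega>)) \<partial>M) = (\<integral>\<^sup>+ \<omega>. \<top> \<partial>M)"
          by (rule nn_integral_cong_AE)
        also have "\<dots> = \<top>" by (simp add: emeasure_space_1)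
        finally show ?thesis by simp
      next
        case False
        then have st: "0 \<le> s" "s < t" using s by auto
        obtain G where "prm_lag M {1..N} Nm a C H t G s" using lag[OF st] by blast
        then interpret lag: prm_lag M "{1..N}" Nm a C H t G s .
        let ?E = "\<lambda>\<omega>. e2ennreal (Mgt_inv \<phi> (Eheight Nm a s t \<omega>))"
        let ?P = "\<lambda>\<omega>. real (lag.strip_process (Zlag Nm a s t \<omega>) \<omega>)"
        have mE: "?E \<in> borel_measurable M"
          by (intro measurable_compose[OF _ measurable_e2ennreal]
              measurable_compose[OF measurable_Eheight[OF a st(1)] measurable_Mgt_inv[OF \<phi>]])
        have mP: "(\<lambda>\<omega>. ennreal (?P \<omega>)) \<in> borel_measurable M"
          using lag.measurable_strip_Zlag by simp
        have "(\<integral>\<^sup>+ \<omega>. ennreal \<bar>U a t \<omega>\<bar> \<partial>M) \<le>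
          (\<integral>\<^sup>+ \<omega>. ?E \<omega> + ennreal h + ennreal (2 * h / N) * ennreal (?P \<omega>) \<partial>M)"
        proof (rule nn_integral_mono_AE)
          show "AE \<omega> in M. ennreal \<bar>U a t \<omega>\<bar> \<le> ?E \<omega> + ennreal h + ennreal (2 * h / N) * ennreal (?P \<omega>)"
            using sys lag.AE_G
          proof eventually_elim
            case (elim \<omega>)
            have "ennreal \<bar>U a t \<omega>\<bar> \<le> ?E \<omega> + ennreal h + ennreal (2 * h / N * ?P \<omega>)"
              by (rule ennreal_le_e2ennreal_add[OF lag.abs_actor_le[OF refl C_def h \<phi> bdd HK elim] Mgt_inv_nonneg])
                 (use h in simp_all)
            also have "ennreal (2 * h / N * ?P \<omega>) = ennreal (2 * h / N) * ennreal (?P \<omega>)"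
              using h by (intro ennreal_mult) auto
            finally show ?case .
          qed
        qed
        also have "\<dots> = (\<integral>\<^sup>+ \<omega>. ?E \<omega> \<partial>M) + ennreal h + ennreal (2 * h / N) * (\<integral>\<^sup>+ \<omega>. ennreal (?P \<omega>) \<partial>M)"
          using mE mP by (simp add: nn_integral_add nn_integral_cmult emeasure_space_1)
        also have "\<dots> \<le> (\<integral>\<^sup>+ \<omega>. ?E \<omega> \<partial>M) + ennreal h + ennreal (2 * h / N) * ennreal (real N * K * (t - s) / 2)"
          using lag.nn_integral_strip_Zlag_le by (intro add_left_mono mult_left_mono) (simp_all add: sumH)
        \<comment> \<open>Here \<open>N\<close> cancels against the rate and the 2 against the
          halved interval length.\<close>
        also have "ennreal (2 * h / N) * ennreal (real N * K * (t - s) / 2) = ennreal (h * (t - s) * Mlt \<phi> (2 * h))"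
          using h K N st by (subst ennreal_mult[symmetric]) (simp_all add: K_def[symmetric])
        finally show ?thesis .
      qed
    qed
  }
qed

end
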